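(* Let $n$ be a non-negative integer. Let $A = \Bbbk Q_A/I_A$ and $B = \Bbbk Q_B/I_B$ be finite dimensional algebras, and let $C = \Bbbk Q_C/I_C$ be a finite dimensional algebra which is a Morita context algebra on $A$ and $B$, satisfying the following conditions: (1) $(Q_C)_0 = (Q_A)_0 \cup (Q_B)_0$ (disjoint union); (2) $(Q_C)_1 = (Q_A)_1 \cup (Q_B)_1 \cup \{\alpha_j\}_{j\in J} \cup \{\beta_k\}_{k\in K}$ (disjoint union), where each arrow $\alpha_j$ starts at a vertex of $Q_A$ and ends at a vertex of $Q_B$, and each arrow $\beta_k$ starts at a vertex of $Q_B$ and ends at a vertex of $Q_A$; (3) the ideal of $\Bbbk Q_C$ generated by $I_A$, $I_B$, all $\alpha\alpha_j$ and $\beta\beta_k$ with $\alpha\in (Q_A)_1$, $\beta\in (Q_B)_1$, and all $\alpha_j\beta_k$ and $\beta_k\alpha_j$, with $j\in J$, $k\in K$, is contained in $I_C$; (4) the subgroup $\mathcal{O} = \langle \mathrm{add}\,\mathrm{Orb}_{\Omega_A}(\Pi_A(\Omega_C(C_0))) \times \mathrm{add}\,\mathrm{Orb}_{\Omega_B}(\Pi_B(\Omega_C(C_0)))\rangle$ of $K_0(C)$ is finitely generated. If $A$ and $B$ are $n$-Igusa-Todorov algebras, then $C$ is an $(n+1)$-Igusa-Todorov algebra.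
   Context: $\Bbbk$ is a field; quivers are finite and connected; $I_A, I_B, I_C$ are admissible ideals (an ideal $I$ of $\Bbbk Q$ is admissible if $J_Q^m\subset I\subset J_Q^2$ for some $m\ge 2$, $J_Q$ being the ideal generated by the arrows). Paths are composed from left to right. For an algebra $\Lambda$, $\mathrm{mod}\,\Lambda$ is the category of finitely generated right $\Lambda$-modules, identified for a bound quiver algebra $\Bbbk Q/I$ with finite dimensional representations of $Q$ bound by $I$. That $C$ is a Morita context algebra on $A$ and $B$ means that its diagonal corner algebras, for the idempotents given by the sums of the vertices of $Q_A$ and of $Q_B$, are $A$ and $B$ (i.e. $I_C\cap \Bbbk Q_A = I_A$ and $I_C\cap\Bbbk Q_B = I_B$). Modules over $A$ (resp. $B$) are regarded as $C$-modules supported on the vertices of $Q_A$ (resp. $Q_B$), with the arrows $\alpha_j,\beta_k$ acting as zero. The functors $\Pi_A:\mathrm{mod}\, C\to\mathrm{mod}\, A$ and $\Pi_B:\mathrm{mod}\, C\to \mathrm{mod}\, B$ restrict a representation of $Q_C$ to the vertices and arrows of $Q_A$, respectively $Q_B$. $\Omega_\Lambda(M)$ is the syzygy of $M$ (kernel of the projective cover). $C_0$ is the direct sum of a complete set of representatives of the isomorphism classes of simple $C$-modules. $\mathrm{Orb}_{\Omega_\Lambda}(M)=\{\Omega_\Lambda^n(M)\}_{n\ge 0}$. For a class $\mathcal{C}$ of modules, $\mathrm{add}\,\mathcal{C}$ is the full subcategory of finite direct sums of direct summands of modules in $\mathcal{C}$. $K_0(\Lambda)$ is the abelian group generated by the symbols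 $[M]$, $M\in\mathrm{mod}\,\Lambda$, modulo the relations $[M]=[M']+[M'']$ if $M\cong M'\oplus M''$ and $[P]=0$ for $P$ projective. For a class $\mathcal{C}$ of modules, $\langle\mathcal{C}\rangle$ is the subgroup generated by the classes of direct summands of modules of $\mathcal{C}$; thus $\mathcal{O}$ is the subgroup of $K_0(C)$ generated by the classes of the modules in $\mathrm{add}\,\mathrm{Orb}_{\Omega_A}(\Pi_A(\Omega_C(C_0)))$ and in $\mathrm{add}\,\mathrm{Orb}_{\Omega_B}(\Pi_B(\Omega_C(C_0)))$. An algebra $\Lambda$ is $n$-Igusa-Todorov if there is $V\in\mathrm{mod}\,\Lambda$ such that every $M\in\mathrm{mod}\,\Lambda$ admits an exact sequence $0\to V_1\to V_0\to\Omega^n(M)\to 0$ with $V_0,V_1\in\mathrm{add}(V)$. *)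

theory Defs
  imports
    "Graph_Theory.Digraph_Component"
    "HOL-Algebra.Algebra"
    "HOL-Library.Function_Algebras"
begin

text \<open>
  A quiver is a \<^typ>\<open>('v, 'e) pre_digraph\<close>: \<^const>\<open>tail\<close> is the source and \<^const>\<open>head\<close> the target of
  an arrow, loops and parallel arrows being allowed.
\<close>

section \<open>Path algebras and admissible ideals\<close>

text \<open>
  The triple \<open>(u, p, v)\<close> is the path from \<open>u\<close> to \<open>v\<close> whose successive arrows are listed in \<open>p\<close>,
  read from left to right; \<open>(u, [], u)\<close> is the stationary path at \<open>u\<close>.
\<close>

type_synonym ('v, 'e) path = "'v \<times> 'e list \<times> 'v"

definition paths :: "('v, 'e) pre_digraph \<Rightarrow> ('v, 'e) path set" where
  "paths Q = {(u, p, v). pre_digraph.awalk Q u p v}"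

text \<open>
  An element of the path algebra is its coefficient function.  If \<open>Q'\<close> is a subquiver of \<open>Q\<close>, the
  carrier of its path algebra is thus literally a subset of that of \<open>Q\<close>.  The product is the
  convolution over all factorisations of a path.
\<close>

definition walk_end :: "('v, 'e) pre_digraph \<Rightarrow> 'v \<Rightarrow> 'e list \<Rightarrow> 'v" where
  "walk_end Q u p = last (pre_digraph.awalk_verts Q u p)"

definition path_algebra ::
  "('v, 'e) pre_digraph \<Rightarrow> (('v, 'e) path \<Rightarrow> 'k::field) ring" where
  "path_algebra Q = \<lparr>
     carrier = {f. finite {r. f r \<noteq> 0} \<and> {r. f r \<noteq> 0} \<subseteq> paths Q},
     mult = (\<lambda>f g (u, p, v). \<Sum>i\<le>length p.
        f (u, take i p, walk_end Q u (take i p)) * g (walk_end Q u (take i p), drop i p, v)),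
     one = (\<lambda>(u, p, v). if u \<in> verts Q \<and> p = [] \<and> u = v then 1 else 0),
     ring.zero = (\<lambda>r. 0),
     add = (\<lambda>f g r. f r + g r)\<rparr>"

subsection \<open>The path algebra is a ring\<close>

lemma walk_end_Nil [simp]: "walk_end Q u [] = u"
  by (simp add: walk_end_def pre_digraph.awalk_verts.simps)

lemma walk_end_Cons [simp]: "walk_end Q u (a # p) = walk_end Q (head Q a) p"
  by (cases p) (auto simp: walk_end_def pre_digraph.awalk_verts.simps)

lemma walk_end_append: "walk_end Q u (p @ q) = walk_end Q (walk_end Q u p) q"
  by (induction p arbitrary: u) auto

lemma paths_append:
  assumes "(u, p, w) \<in> paths Q" "(w, q, v) \<in> paths Q"
  shows "(u, p @ q, v) \<in> paths Q"
proof -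
  have "pre_digraph.cas Q u p w \<Longrightarrow> pre_digraph.cas Q w q v \<Longrightarrow> pre_digraph.cas Q u (p @ q) v"
    for u by (induction p arbitrary: u) (auto simp: pre_digraph.cas.simps)
  then show ?thesis
    using assms by (auto simp: paths_def pre_digraph.awalk_def)
qed

lemma paths_walk_end:
  assumes "(u, p, w) \<in> paths Q"
  shows "walk_end Q u p = w"
proof -
  have "pre_digraph.cas Q u p w \<Longrightarrow> walk_end Q u p = w" for u
    by (induction p arbitrary: u) (auto simp: pre_digraph.cas.simps)
  then show ?thesis using assms by (auto simp: paths_def pre_digraph.awalk_def)
qed

lemma path_algebra_mult_closed:
  assumes "f \<in> carrier (path_algebra Q)" "g \<in> carrier (path_algebra Q)"
  shows "f \<otimes>\<^bsub>path_algebra Q\<^esub> g \<in> carrier (path_algebra Q)"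
proof -
  let ?F = "{r. f r \<noteq> 0}" and ?G = "{r. g r \<noteq> 0}"
  let ?c = "\<lambda>((u, p, w), (w', q, v)). (u, p @ q, v)"
  let ?S = "{r. (f \<otimes>\<^bsub>path_algebra Q\<^esub> g) r \<noteq> 0}"
  have *: "\<exists>p' q w. p = p' @ q \<and> (u, p', w) \<in> ?F \<and> (w, q, v) \<in> ?G"
    if "(u, p, v) \<in> ?S" for u p v
  proof -
    from that obtain i where
      "f (u, take i p, walk_end Q u (take i p)) * g (walk_end Q u (take i p), drop i p, v) \<noteq> 0"
      by (auto simp: path_algebra_def elim!: sum.not_neutral_contains_not_neutral)
    then show ?thesis
      by (intro exI[of _ "take i p"] exI[of _ "drop i p"] exI[of _ "walk_end Q u (take i p)"]) auto
  qed
  have "?S \<subseteq> ?c ` (?F \<times> ?G)"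
  proof
    fix r assume "r \<in> ?S"
    moreover obtain u p v where r: "r = (u, p, v)" by (cases r)
    ultimately obtain p' q w where "p = p' @ q" "(u, p', w) \<in> ?F" "(w, q, v) \<in> ?G"
      using * by blast
    then show "r \<in> ?c ` (?F \<times> ?G)"
      unfolding r by (intro image_eqI[of _ _ "((u, p', w), (w, q, v))"]) auto
  qed
  then have "finite ?S"
    by (rule finite_subset) (use assms in \<open>auto simp: path_algebra_def\<close>)
  moreover have "?S \<subseteq> paths Q"
  proof
    fix r assume "r \<in> ?S"
    moreover obtain u p v where r: "r = (u, p, v)" by (cases r)
    ultimately obtain p' q w where "p = p' @ q" "(u, p', w) \<in> ?F" "(w, q, v) \<in> ?G"
      using * by blast
    moreover have "?F \<subseteq> paths Q" "?G \<subseteq> paths Q" using assms by (auto simp: path_algebra_def)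
    ultimately show "r \<in> paths Q" unfolding r by (auto intro: paths_append)
  qed
  ultimately show ?thesis by (auto simp: path_algebra_def)
qed

lemma path_algebra_mult_assoc:
  "(f \<otimes>\<^bsub>path_algebra Q\<^esub> g) \<otimes>\<^bsub>path_algebra Q\<^esub> h = f \<otimes>\<^bsub>path_algebra Q\<^esub> (g \<otimes>\<^bsub>path_algebra Q\<^esub> h)"
proof (rule ext)
  fix r :: "'a \<times> 'b list \<times> 'a"
  obtain u p v where r: "r = (u, p, v)" by (cases r)
  define w where "w = (\<lambda>i. walk_end Q u (take i p))"
  define T where "T = (\<lambda>j i. f (u, take j p, w j) * g (w j, take (i - j) (drop j p), w i) *
    h (w i, drop i p, v))"
  have w: "walk_end Q (w j) (take k (drop j p)) = w (j + k)" for j k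
    by (simp add: w_def take_add walk_end_append)
  have "((f \<otimes>\<^bsub>path_algebra Q\<^esub> g) \<otimes>\<^bsub>path_algebra Q\<^esub> h) r = (\<Sum>i\<le>length p. \<Sum>j\<le>i. T j i)"
    unfolding r path_algebra_def
    by (auto simp: sum_distrib_right T_def w_def drop_take min_def intro!: sum.cong)
  also have "\<dots> = (\<Sum>j\<le>length p. \<Sum>k\<le>length p - j. T j (j + k))"
    unfolding sum.Sigma[OF finite_atMost ballI[OF finite_atMost]]
    by (rule sum.reindex_bij_witness[of _ "\<lambda>(j, k). (j + k, j)" "\<lambda>(i, j). (j, i - j)"]) auto
  also have "\<dots> = (f \<otimes>\<^bsub>path_algebra Q\<^esub> (g \<otimes>\<^bsub>path_algebra Q\<^esub> h)) r"
    unfolding r path_algebra_def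
    by (auto simp: sum_distrib_left T_def w[unfolded w_def] w_def add.commute mult.assoc intro!: sum.cong)
  finally show "((f \<otimes>\<^bsub>path_algebra Q\<^esub> g) \<otimes>\<^bsub>path_algebra Q\<^esub> h) r =
    (f \<otimes>\<^bsub>path_algebra Q\<^esub> (g \<otimes>\<^bsub>path_algebra Q\<^esub> h)) r" .
qed

lemma path_algebra_one_mult:
  assumes "f \<in> carrier (path_algebra Q)"
  shows "\<one>\<^bsub>path_algebra Q\<^esub> \<otimes>\<^bsub>path_algebra Q\<^esub> f = f"
proof (rule ext)
  fix r :: "'a \<times> 'b list \<times> 'a"
  obtain u p v where r: "r = (u, p, v)" by (cases r)
  have "f (u, p, v) = 0" if "u \<notin> verts Q"
    using assms that by (auto simp: path_algebra_def paths_def pre_digraph.awalk_def)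
  then have "(\<one>\<^bsub>path_algebra Q\<^esub> \<otimes>\<^bsub>path_algebra Q\<^esub> f) r = (\<Sum>i\<in>{..length p}. if i = 0 then f r else 0)"
    unfolding r path_algebra_def monoid.simps ring.simps prod.case
    by (intro sum.cong refl) auto
  then show "(\<one>\<^bsub>path_algebra Q\<^esub> \<otimes>\<^bsub>path_algebra Q\<^esub> f) r = f r" by simp
qed

lemma path_algebra_mult_one:
  assumes "wf_digraph Q" "f \<in> carrier (path_algebra Q)"
  shows "f \<otimes>\<^bsub>path_algebra Q\<^esub> \<one>\<^bsub>path_algebra Q\<^esub> = f"
proof (rule ext)
  fix r :: "'a \<times> 'b list \<times> 'a"
  obtain u p v where r: "r = (u, p, v)" by (cases r)
  have P: "(u, p, v') \<in> paths Q" if "f (u, p, v') \<noteq> 0" for v'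
    using assms(2) that by (auto simp: path_algebra_def)
  have E: "v' = walk_end Q u p \<and> v' \<in> verts Q" if "f (u, p, v') \<noteq> 0" for v'
    using P[OF that] paths_walk_end[OF P[OF that]] wf_digraph.awalk_last_in_verts[OF assms(1)]
    by (auto simp: paths_def walk_end_def)
  have "(f \<otimes>\<^bsub>path_algebra Q\<^esub> \<one>\<^bsub>path_algebra Q\<^esub>) r = (\<Sum>i\<in>{..length p}. if i = length p then f r else 0)"
    unfolding r path_algebra_def monoid.simps ring.simps prod.case
    by (intro sum.cong refl) (use E in auto)
  then show "(f \<otimes>\<^bsub>path_algebra Q\<^esub> \<one>\<^bsub>path_algebra Q\<^esub>) r = f r" by simp
qed

lemma ring_path_algebra:
  assumes "fin_digraph Q"
  shows "ring (path_algebra Q)"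
proof -
  interpret fin_digraph Q by fact
  have ag: "abelian_group (path_algebra Q :: (_ \<Rightarrow> 'c::field) ring)"
  proof (rule abelian_groupI)
    fix x y :: "('a,'b) path \<Rightarrow> 'c"
    assume "x \<in> carrier (path_algebra Q)" "y \<in> carrier (path_algebra Q)"
    then show "x \<oplus>\<^bsub>path_algebra Q\<^esub> y \<in> carrier (path_algebra Q)"
      by (auto simp: path_algebra_def intro: finite_subset[of _ "{r. x r \<noteq> 0} \<union> {r. y r \<noteq> 0}"])
        (metis (mono_tags, lifting) add_0 mem_Collect_eq subsetD)
  next
    fix x :: "('a,'b) path \<Rightarrow> 'c"
    assume "x \<in> carrier (path_algebra Q)"
    then show "\<exists>y\<in>carrier (path_algebra Q). y \<oplus>\<^bsub>path_algebra Q\<^esub> x = \<zero>\<^bsub>path_algebra Q\<^esub>"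
      by (intro bexI[of _ "\<lambda>r. - x r"]) (auto simp: path_algebra_def)
  qed (auto simp: path_algebra_def algebra_simps)
  have one: "\<one>\<^bsub>path_algebra Q\<^esub> \<in> carrier (path_algebra Q :: (_ \<Rightarrow> 'c::field) ring)"
  proof -
    have "{r. \<one>\<^bsub>path_algebra Q :: (_ \<Rightarrow> 'c::field) ring\<^esub> r \<noteq> 0} \<subseteq> (\<lambda>u. (u, [], u)) ` verts Q"
      by (auto simp: path_algebra_def split: if_splits)
    then show ?thesis
      using finite_subset[OF _ finite_imageI[OF finite_verts]]
      by (auto simp: path_algebra_def paths_def pre_digraph.awalk_def pre_digraph.cas.simps split: if_splits)
  qed
  show ?thesis
  proof (rule ringI)
    show "Group.monoid (path_algebra Q :: (_ \<Rightarrow> 'c::field) ring)"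
      by unfold_locales
        (auto simp: path_algebra_mult_closed path_algebra_mult_assoc one path_algebra_one_mult
          path_algebra_mult_one[OF wf_digraph])
  qed (use ag in \<open>auto simp: path_algebra_def fun_eq_iff algebra_simps sum.distrib\<close>)
qed

subsection \<open>Admissible ideals\<close>

definition arrow :: "('v, 'e) pre_digraph \<Rightarrow> 'e \<Rightarrow> ('v, 'e) path \<Rightarrow> 'k::field" where
  "arrow Q a = (\<lambda>r. if r = (tail Q a, [a], head Q a) then 1 else 0)"

definition arrow_ideal ::
  "('v, 'e) pre_digraph \<Rightarrow> (('v, 'e) path \<Rightarrow> 'k::field) set" where
  "arrow_ideal Q = genideal (path_algebra Q) (arrow Q ` arcs Q)"

text \<open>The power is taken in the multiplicative monoid \<^const>\<open>ideals_set\<close> of ideals.\<close>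

definition admissible ::
  "('v, 'e) pre_digraph \<Rightarrow> (('v, 'e) path \<Rightarrow> 'k::field) set \<Rightarrow> bool" where
  "admissible Q I \<longleftrightarrow> ideal I (path_algebra Q) \<and>
     (\<exists>m\<ge>2::nat. arrow_ideal Q [^]\<^bsub>ideals_set (path_algebra Q)\<^esub> m \<subseteq> I) \<and>
     I \<subseteq> arrow_ideal Q [^]\<^bsub>ideals_set (path_algebra Q)\<^esub> (2::nat)"

text \<open>The pair \<open>(Q, I)\<close> presents the finite dimensional algebra \<open>kQ/I\<close>.\<close>

definition bound_quiver ::
  "('v, 'e) pre_digraph \<Rightarrow> (('v, 'e) path \<Rightarrow> 'k::field) set \<Rightarrow> bool" where
  "bound_quiver Q I \<longleftrightarrow> fin_digraph Q \<and> connected Q \<and> admissible Q I"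

section \<open>Finite dimensional representations\<close>

text \<open>
  The spaces of a representation are finite dimensional subspaces of the infinite dimensional
  space of sequences over \<open>'k\<close>; up to isomorphism every finite dimensional representation
  is of this form.
\<close>

definition scale :: "'k::field \<Rightarrow> (nat \<Rightarrow> 'k) \<Rightarrow> nat \<Rightarrow> 'k" where
  "scale c x = (\<lambda>i. c * x i)"

global_interpretation seq: vector_space scale
  by unfold_locales (auto simp: scale_def fun_eq_iff algebra_simps)

definition fd_space :: "(nat \<Rightarrow> 'k::field) set \<Rightarrow> bool" where
  "fd_space V \<longleftrightarrow> (\<exists>B. finite B \<and> V = seq.span B)"

definition linear_map ::
  "(nat \<Rightarrow> 'k::field) set \<Rightarrow> (nat \<Rightarrow> 'k) set \<Rightarrow> ((nat \<Rightarrow> 'k) \<Rightarrow> nat \<Rightarrow> 'k) \<Rightarrow> bool" where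
  "linear_map V W f \<longleftrightarrow> (\<forall>x\<in>V. f x \<in> W) \<and>
     (\<forall>x\<in>V. \<forall>y\<in>V. f (x + y) = f x + f y) \<and> (\<forall>c. \<forall>x\<in>V. f (scale c x) = scale c (f x))"

record ('v, 'e, 'k) rep =
  space :: "'v \<Rightarrow> (nat \<Rightarrow> 'k) set"
  act :: "'e \<Rightarrow> (nat \<Rightarrow> 'k) \<Rightarrow> nat \<Rightarrow> 'k"

text \<open>
  Right modules: the first arrow of a path acts first.  Boundness is required componentwise:
  the \<open>v\<close>-component of the action of every element of \<open>I\<close> vanishes on the space at \<open>u\<close>.
  Values of the fields outside the quiver, and of the linear maps outside their domains,
  are irrelevant.
\<close>

definition mod_of ::
  "('v, 'e) pre_digraph \<Rightarrow> (('v, 'e) path \<Rightarrow> 'k::field) set \<Rightarrow> ('v, 'e, 'k) rep set" where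
  "mod_of Q I = {M.
     (\<forall>x\<in>verts Q. fd_space (space M x)) \<and>
     (\<forall>a\<in>arcs Q. linear_map (space M (tail Q a)) (space M (head Q a)) (act M a)) \<and>
     (\<forall>\<rho>\<in>I. \<forall>u\<in>verts Q. \<forall>v\<in>verts Q. \<forall>x\<in>space M u.
        (\<Sum>p | \<rho> (u, p, v) \<noteq> 0. scale (\<rho> (u, p, v)) (fold (act M) p x)) = 0)}"

definition rep_hom ::
  "('v, 'e) pre_digraph \<Rightarrow> ('v, 'e, 'k::field) rep \<Rightarrow> ('v, 'e, 'k) rep \<Rightarrow>
   ('v \<Rightarrow> (nat \<Rightarrow> 'k) \<Rightarrow> nat \<Rightarrow> 'k) \<Rightarrow> bool" where
  "rep_hom Q M N f \<longleftrightarrow> (\<forall>x\<in>verts Q. linear_map (space M x) (space N x) (f x)) \<and>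
     (\<forall>a\<in>arcs Q. \<forall>m\<in>space M (tail Q a).
        f (head Q a) (act M a m) = act N a (f (tail Q a) m))"

definition rep_mono ::
  "('v, 'e) pre_digraph \<Rightarrow> ('v, 'e, 'k::field) rep \<Rightarrow> ('v, 'e, 'k) rep \<Rightarrow>
   ('v \<Rightarrow> (nat \<Rightarrow> 'k) \<Rightarrow> nat \<Rightarrow> 'k) \<Rightarrow> bool" where
  "rep_mono Q M N f \<longleftrightarrow> rep_hom Q M N f \<and> (\<forall>x\<in>verts Q. inj_on (f x) (space M x))"

definition rep_epi ::
  "('v, 'e) pre_digraph \<Rightarrow> ('v, 'e, 'k::field) rep \<Rightarrow> ('v, 'e, 'k) rep \<Rightarrow>
   ('v \<Rightarrow> (nat \<Rightarrow> 'k) \<Rightarrow> nat \<Rightarrow> 'k) \<Rightarrow> bool" where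
  "rep_epi Q M N f \<longleftrightarrow> rep_hom Q M N f \<and> (\<forall>x\<in>verts Q. f x ` space M x = space N x)"

definition rep_iso ::
  "('v, 'e) pre_digraph \<Rightarrow> ('v, 'e, 'k::field) rep \<Rightarrow> ('v, 'e, 'k) rep \<Rightarrow> bool" where
  "rep_iso Q M N \<longleftrightarrow> (\<exists>f. rep_mono Q M N f \<and> rep_epi Q M N f)"

definition kernel_rep ::
  "('v, 'e, 'k::field) rep \<Rightarrow> ('v \<Rightarrow> (nat \<Rightarrow> 'k) \<Rightarrow> nat \<Rightarrow> 'k) \<Rightarrow> ('v, 'e, 'k) rep" where
  "kernel_rep M f = \<lparr>space = (\<lambda>x. {m \<in> space M x. f x m = 0}), act = act M\<rparr>"

text \<open>Exactness of \<open>0 \<rightarrow> M' \<rightarrow> M \<rightarrow> M'' \<rightarrow> 0\<close> with maps \<open>f\<close> and \<open>g\<close>.\<close>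

definition short_exact ::
  "('v, 'e) pre_digraph \<Rightarrow> ('v, 'e, 'k::field) rep \<Rightarrow> ('v, 'e, 'k) rep \<Rightarrow> ('v, 'e, 'k) rep \<Rightarrow>
   ('v \<Rightarrow> (nat \<Rightarrow> 'k) \<Rightarrow> nat \<Rightarrow> 'k) \<Rightarrow> ('v \<Rightarrow> (nat \<Rightarrow> 'k) \<Rightarrow> nat \<Rightarrow> 'k) \<Rightarrow> bool" where
  "short_exact Q M' M M'' f g \<longleftrightarrow> rep_mono Q M' M f \<and> rep_epi Q M M'' g \<and>
     (\<forall>x\<in>verts Q. f x ` space M' x = space (kernel_rep M g) x)"

definition zero_rep :: "('v, 'e, 'k::field) rep" where
  "zero_rep = \<lparr>space = (\<lambda>x. {0}), act = (\<lambda>a m. 0)\<rparr>"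

text \<open>External direct sums: a pair of sequences is encoded by interleaving.\<close>

definition interleave :: "(nat \<Rightarrow> 'k) \<Rightarrow> (nat \<Rightarrow> 'k) \<Rightarrow> nat \<Rightarrow> 'k" where
  "interleave x y = (\<lambda>i. if even i then x (i div 2) else y (i div 2))"

definition dsum ::
  "('v, 'e, 'k::field) rep \<Rightarrow> ('v, 'e, 'k) rep \<Rightarrow> ('v, 'e, 'k) rep" where
  "dsum M N = \<lparr>
     space = (\<lambda>x. {interleave m n | m n. m \<in> space M x \<and> n \<in> space N x}),
     act = (\<lambda>a z. interleave (act M a (\<lambda>i. z (2 * i))) (act N a (\<lambda>i. z (2 * i + 1))))\<rparr>"

definition dsum_list :: "('v, 'e, 'k::field) rep list \<Rightarrow> ('v, 'e, 'k) rep" where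
  "dsum_list Ms = foldr dsum Ms zero_rep"

definition direct_summand ::
  "('v, 'e) pre_digraph \<Rightarrow> (('v, 'e) path \<Rightarrow> 'k::field) set \<Rightarrow>
   ('v, 'e, 'k) rep \<Rightarrow> ('v, 'e, 'k) rep \<Rightarrow> bool" where
  "direct_summand Q I N M \<longleftrightarrow> N \<in> mod_of Q I \<and> (\<exists>N'\<in>mod_of Q I. rep_iso Q M (dsum N N'))"

definition add_class ::
  "('v, 'e) pre_digraph \<Rightarrow> (('v, 'e) path \<Rightarrow> 'k::field) set \<Rightarrow>
   ('v, 'e, 'k) rep set \<Rightarrow> ('v, 'e, 'k) rep set" where
  "add_class Q I Ms = {M \<in> mod_of Q I. \<exists>Ns.
     (\<forall>N\<in>set Ns. \<exists>V\<in>Ms. direct_summand Q I N V) \<and> rep_iso Q M (dsum_list Ns)}"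

section \<open>Subrepresentations, simple modules and syzygies\<close>

definition subrep ::
  "('v, 'e) pre_digraph \<Rightarrow> ('v, 'e, 'k::field) rep \<Rightarrow> ('v \<Rightarrow> (nat \<Rightarrow> 'k) set) \<Rightarrow> bool" where
  "subrep Q M U \<longleftrightarrow> (\<forall>x\<in>verts Q. seq.subspace (U x) \<and> U x \<subseteq> space M x) \<and>
     (\<forall>a\<in>arcs Q. \<forall>m\<in>U (tail Q a). act M a m \<in> U (head Q a))"

definition simple_rep ::
  "('v, 'e) pre_digraph \<Rightarrow> (('v, 'e) path \<Rightarrow> 'k::field) set \<Rightarrow> ('v, 'e, 'k) rep \<Rightarrow> bool" where
  "simple_rep Q I S \<longleftrightarrow> S \<in> mod_of Q I \<and> (\<exists>x\<in>verts Q. space S x \<noteq> {0}) \<and>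
     (\<forall>U. subrep Q S U \<longrightarrow>
        (\<forall>x\<in>verts Q. U x = {0}) \<or> (\<forall>x\<in>verts Q. U x = space S x))"

text \<open>The entries of \<open>Ss\<close> represent each isomorphism class of simple modules exactly once.\<close>

definition complete_simples ::
  "('v, 'e) pre_digraph \<Rightarrow> (('v, 'e) path \<Rightarrow> 'k::field) set \<Rightarrow> ('v, 'e, 'k) rep list \<Rightarrow> bool" where
  "complete_simples Q I Ss \<longleftrightarrow> (\<forall>S\<in>set Ss. simple_rep Q I S) \<and>
     (\<forall>i<length Ss. \<forall>j<length Ss. i \<noteq> j \<longrightarrow> \<not> rep_iso Q (Ss ! i) (Ss ! j)) \<and>
     (\<forall>S. simple_rep Q I S \<longrightarrow> (\<exists>T\<in>set Ss. rep_iso Q S T))"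

definition projective_rep ::
  "('v, 'e) pre_digraph \<Rightarrow> (('v, 'e) path \<Rightarrow> 'k::field) set \<Rightarrow> ('v, 'e, 'k) rep \<Rightarrow> bool" where
  "projective_rep Q I P \<longleftrightarrow> P \<in> mod_of Q I \<and>
     (\<forall>M\<in>mod_of Q I. \<forall>N\<in>mod_of Q I. \<forall>e f. rep_epi Q M N e \<and> rep_hom Q P N f \<longrightarrow>
        (\<exists>g. rep_hom Q P M g \<and> (\<forall>x\<in>verts Q. \<forall>z\<in>space P x. e x (g x z) = f x z)))"

definition superfluous ::
  "('v, 'e) pre_digraph \<Rightarrow> ('v, 'e, 'k::field) rep \<Rightarrow> ('v \<Rightarrow> (nat \<Rightarrow> 'k) set) \<Rightarrow> bool" where
  "superfluous Q M L \<longleftrightarrow> subrep Q M L \<and>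
     (\<forall>U. subrep Q M U \<and> (\<forall>x\<in>verts Q. {l + u | l u. l \<in> L x \<and> u \<in> U x} = space M x) \<longrightarrow>
        (\<forall>x\<in>verts Q. U x = space M x))"

definition projective_cover ::
  "('v, 'e) pre_digraph \<Rightarrow> (('v, 'e) path \<Rightarrow> 'k::field) set \<Rightarrow> ('v, 'e, 'k) rep \<Rightarrow>
   ('v, 'e, 'k) rep \<Rightarrow> ('v \<Rightarrow> (nat \<Rightarrow> 'k) \<Rightarrow> nat \<Rightarrow> 'k) \<Rightarrow> bool" where
  "projective_cover Q I M P f \<longleftrightarrow> projective_rep Q I P \<and> rep_epi Q P M f \<and>
     superfluous Q P (space (kernel_rep P f))"

text \<open>
  A projective cover is unique up to isomorphism; the kernel of an arbitrarily chosen one is taken.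
\<close>

definition syzygy ::
  "('v, 'e) pre_digraph \<Rightarrow> (('v, 'e) path \<Rightarrow> 'k::field) set \<Rightarrow>
   ('v, 'e, 'k) rep \<Rightarrow> ('v, 'e, 'k) rep" where
  "syzygy Q I M = (case SOME (P, f). projective_cover Q I M P f of (P, f) \<Rightarrow> kernel_rep P f)"

definition syzygy_orbit ::
  "('v, 'e) pre_digraph \<Rightarrow> (('v, 'e) path \<Rightarrow> 'k::field) set \<Rightarrow>
   ('v, 'e, 'k) rep \<Rightarrow> ('v, 'e, 'k) rep set" where
  "syzygy_orbit Q I M = {(syzygy Q I ^^ n) M | n. True}"

definition Igusa_Todorov ::
  "nat \<Rightarrow> ('v, 'e) pre_digraph \<Rightarrow> (('v, 'e) path \<Rightarrow> 'k::field) set \<Rightarrow> bool" where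
  "Igusa_Todorov n Q I \<longleftrightarrow> (\<exists>V\<in>mod_of Q I. \<forall>M\<in>mod_of Q I.
     \<exists>V1\<in>add_class Q I {V}. \<exists>V0\<in>add_class Q I {V}.
       \<exists>f g. short_exact Q V1 V0 ((syzygy Q I ^^ n) M) f g)"

section \<open>The Grothendieck-type group \<open>K0\<close>\<close>

text \<open>
  The generators are all modules rather than their isomorphism classes: the relations for
  \<open>M \<cong> M' \<oplus> 0\<close> identify isomorphic modules, the zero module being projective.
\<close>

definition K0_relations ::
  "('v, 'e) pre_digraph \<Rightarrow> (('v, 'e) path \<Rightarrow> 'k::field) set \<Rightarrow> (('v, 'e, 'k) rep \<Rightarrow>\<^sub>0 int) set" where
  "K0_relations Q I =
     {frag_of M - (frag_of M' + frag_of M'') | M M' M''.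
        M \<in> mod_of Q I \<and> M' \<in> mod_of Q I \<and> M'' \<in> mod_of Q I \<and> rep_iso Q M (dsum M' M'')} \<union>
     {frag_of P | P. projective_rep Q I P}"

definition K0 ::
  "('v, 'e) pre_digraph \<Rightarrow> (('v, 'e) path \<Rightarrow> 'k::field) set \<Rightarrow>
   (('v, 'e, 'k) rep \<Rightarrow>\<^sub>0 int) set monoid" where
  "K0 Q I = free_Abelian_group (mod_of Q I) Mod
     generate (free_Abelian_group (mod_of Q I)) (K0_relations Q I)"

definition K0_class ::
  "('v, 'e) pre_digraph \<Rightarrow> (('v, 'e) path \<Rightarrow> 'k::field) set \<Rightarrow>
   ('v, 'e, 'k) rep \<Rightarrow> (('v, 'e, 'k) rep \<Rightarrow>\<^sub>0 int) set" where
  "K0_class Q I M =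
     generate (free_Abelian_group (mod_of Q I)) (K0_relations Q I)
       #>\<^bsub>free_Abelian_group (mod_of Q I)\<^esub> frag_of M"

definition K0_span ::
  "('v, 'e) pre_digraph \<Rightarrow> (('v, 'e) path \<Rightarrow> 'k::field) set \<Rightarrow>
   ('v, 'e, 'k) rep set \<Rightarrow> (('v, 'e, 'k) rep \<Rightarrow>\<^sub>0 int) set set" where
  "K0_span Q I Ms = generate (K0 Q I)
     {K0_class Q I N | N. \<exists>M\<in>Ms. direct_summand Q I N M}"

definition finitely_generated_subgroup :: "('a, 'b) monoid_scheme \<Rightarrow> 'a set \<Rightarrow> bool" where
  "finitely_generated_subgroup G H \<longleftrightarrow> subgroup H G \<and>
     (\<exists>S. finite S \<and> S \<subseteq> carrier G \<and> H = generate G S)"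

section \<open>Gluing two bound quivers\<close>

text \<open>
  Restriction of a representation to the vertices and arrows of \<open>Q\<close>, extended by zero elsewhere.
  Read over \<open>Q\<close> this is the restriction functor to a subquiver; applied to a representation of
  the subquiver \<open>Q\<close> and read over the ambient quiver it is the extension by zero.
\<close>

definition restrict_rep ::
  "('v, 'e) pre_digraph \<Rightarrow> ('v, 'e, 'k::field) rep \<Rightarrow> ('v, 'e, 'k) rep" where
  "restrict_rep Q M = \<lparr>
     space = (\<lambda>x. if x \<in> verts Q then space M x else {0}),
     act = (\<lambda>a. if a \<in> arcs Q then act M a else (\<lambda>m. 0))\<rparr>"

text \<open>The product of a class of \<open>A\<close>-modules and a class of \<open>B\<close>-modules, as a class of \<open>C\<close>-modules.\<close>

definition pair_class ::
  "('v, 'e) pre_digraph \<Rightarrow> ('v, 'e) pre_digraph \<Rightarrow>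
   ('v, 'e, 'k::field) rep set \<Rightarrow> ('v, 'e, 'k) rep set \<Rightarrow> ('v, 'e, 'k) rep set" where
  "pair_class QA QB Ms Ns =
     {dsum (restrict_rep QA M) (restrict_rep QB N) | M N. M \<in> Ms \<and> N \<in> Ns}"

text \<open>
  The vertices and arrows of \<open>QC\<close> are those of \<open>QA\<close> and \<open>QB\<close> together with arrows \<open>\<alpha>s\<close> from \<open>QA\<close> to \<open>QB\<close>
  and \<open>\<beta>s\<close> from \<open>QB\<close> to \<open>QA\<close>, all unions being disjoint.
\<close>

definition glued_quiver ::
  "('v, 'e) pre_digraph \<Rightarrow> ('v, 'e) pre_digraph \<Rightarrow> 'e set \<Rightarrow> 'e set \<Rightarrow>
   ('v, 'e) pre_digraph \<Rightarrow> bool" where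
  "glued_quiver QA QB \<alpha>s \<beta>s QC \<longleftrightarrow>
     verts QC = verts QA \<union> verts QB \<and> verts QA \<inter> verts QB = {} \<and>
     arcs QC = arcs QA \<union> arcs QB \<union> \<alpha>s \<union> \<beta>s \<and>
     arcs QA \<inter> arcs QB = {} \<and> (arcs QA \<union> arcs QB) \<inter> (\<alpha>s \<union> \<beta>s) = {} \<and> \<alpha>s \<inter> \<beta>s = {} \<and>
     (\<forall>a\<in>arcs QA. tail QC a = tail QA a \<and> head QC a = head QA a) \<and>
     (\<forall>b\<in>arcs QB. tail QC b = tail QB b \<and> head QC b = head QB b) \<and>
     (\<forall>a\<in>\<alpha>s. tail QC a \<in> verts QA \<and> head QC a \<in> verts QB) \<and>
     (\<forall>b\<in>\<beta>s. tail QC b \<in> verts QB \<and> head QC b \<in> verts QA)"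

text \<open>
  The diagonal corner algebras of \<open>kQC/IC\<close> at the vertices of \<open>QA\<close> and \<open>QB\<close> are \<open>kQA/IA\<close> and \<open>kQB/IB\<close>.
\<close>

definition Morita_context_ideal ::
  "('v, 'e) pre_digraph \<Rightarrow> (('v, 'e) path \<Rightarrow> 'k::field) set \<Rightarrow>
   ('v, 'e) pre_digraph \<Rightarrow> (('v, 'e) path \<Rightarrow> 'k) set \<Rightarrow> (('v, 'e) path \<Rightarrow> 'k) set \<Rightarrow> bool" where
  "Morita_context_ideal QA IA QB IB IC \<longleftrightarrow>
     IC \<inter> carrier (path_algebra QA) = IA \<and> IC \<inter> carrier (path_algebra QB) = IB"

text \<open>Products of non-composable arrows are zero.\<close>

definition gluing_relations ::
  "('v, 'e) pre_digraph \<Rightarrow> (('v, 'e) path \<Rightarrow> 'k::field) set \<Rightarrow>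
   ('v, 'e) pre_digraph \<Rightarrow> (('v, 'e) path \<Rightarrow> 'k) set \<Rightarrow> 'e set \<Rightarrow> 'e set \<Rightarrow>
   ('v, 'e) pre_digraph \<Rightarrow> (('v, 'e) path \<Rightarrow> 'k) set" where
  "gluing_relations QA IA QB IB \<alpha>s \<beta>s QC =
     IA \<union> IB \<union>
     {arrow QC x \<otimes>\<^bsub>path_algebra QC\<^esub> arrow QC y | x y.
        x \<in> arcs QA \<and> y \<in> \<alpha>s \<or> x \<in> arcs QB \<and> y \<in> \<beta>s \<or>
        x \<in> \<alpha>s \<and> y \<in> \<beta>s \<or> x \<in> \<beta>s \<and> y \<in> \<alpha>s}"

end

(*
  In C the composites of an arrow of Q_A with an alpha_j, of an arrow of Q_B with a beta_k, and of
  the alpha_j with the beta_k vanish, so the connecting arrows kill the radical of every C-module.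
  A first syzygy lies in the radical of a projective and hence splits as the sum of an A-module X
  and a B-module Y. For an A-module X, the syzygy over C is Omega_A(X) plus a B-module that only
  depends on the top of X; as the top is semisimple, this B-module is in the additive closure of
  Pi_B(Omega_C(C_0)). Iterating, Omega_C^(n+1)(M) is the sum of Omega_A^n(X), Omega_B^n(Y) and a
  module W built from the syzygy orbits that span the subgroup O. The multiplicity of a
  non-projective indecomposable is a well-defined homomorphism on K_0, by Krull-Schmidt; so, O
  being finitely generated, every non-projective indecomposable summand of W is a summand of one of
  the finitely many modules that occur in the generators. Adding these and the projectives to the
  modules witnessing the Igusa-Todorov property of A and B gives a witness for C.
*)
theory Submission
  imports Defs
begin

section \<open>Krull--Schmidt multiplicities in additive categories\<close>

text \<open>Likewise a multiplicity is meaningful only once indecomposables cancel from direct sums,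
  which is proved in an abstract additive category subject to Fitting's lemma. The obstacle in the
  iteration is that the \<open>C\<close>-syzygy of an \<open>A\<close>-module throws off a
  \<open>B\<close>-module, whose syzygies throw off \<open>A\<close>-modules in turn, so that the
  error \<open>W\<close> depends on the module and on \<open>n\<close>. It is controlled only as a
  member of a class closed under sums and \<open>C\<close>-syzygies. Since projectives vanish in
  \<open>K0\<close>, finite generation says nothing about projective summands of \<open>W\<close>;
  this is why the \<open>free_rep u\<close> enter the witness. The step from \<open>n\<close> to
  \<open>n + 1\<close> pays for the first syzygy, the only point at which an arbitrary
  \<open>C\<close>-module has to be split, and \<open>W\<close> itself is resolved trivially by 0 ->
  0 -> W -> W -> 0.\<close>

locale additive_category =
  fixes Ob :: "'o set" and Hom :: "'o \<Rightarrow> 'o \<Rightarrow> 'm::ab_group_add set"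
    and cmp :: "'m \<Rightarrow> 'm \<Rightarrow> 'm" (infixl "\<star>" 70) and Id :: "'o \<Rightarrow> 'm"
  assumes Hom_Ob: "f \<in> Hom M N \<Longrightarrow> M \<in> Ob \<and> N \<in> Ob"
    and Id_Hom [simp]: "M \<in> Ob \<Longrightarrow> Id M \<in> Hom M M"
    and cmp_Hom [intro, simp]: "f \<in> Hom M N \<Longrightarrow> g \<in> Hom L M \<Longrightarrow> f \<star> g \<in> Hom L N"
    and cmp_assoc: "(f \<star> g) \<star> h = f \<star> (g \<star> h)"
    and Id_cmp: "f \<in> Hom L M \<Longrightarrow> Id M \<star> f = f"
    and cmp_Id: "f \<in> Hom L M \<Longrightarrow> f \<star> Id L = f"
    and Hom_zero [simp]: "M \<in> Ob \<Longrightarrow> N \<in> Ob \<Longrightarrow> 0 \<in> Hom M N"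
    and Hom_diff [simp]: "f \<in> Hom M N \<Longrightarrow> g \<in> Hom M N \<Longrightarrow> f - g \<in> Hom M N"
    and add_cmp: "(f + g) \<star> h = f \<star> h + g \<star> h"
    and cmp_add: "h \<in> Hom M N \<Longrightarrow> f \<in> Hom L M \<Longrightarrow> g \<in> Hom L M \<Longrightarrow> h \<star> (f + g) = h \<star> f + h \<star> g"
begin

lemma Hom_minus [simp]: "f \<in> Hom M N \<Longrightarrow> - f \<in> Hom M N"
  using Hom_diff[of 0 M N f] Hom_Ob by force

lemma Hom_add [simp]: "f \<in> Hom M N \<Longrightarrow> g \<in> Hom M N \<Longrightarrow> f + g \<in> Hom M N"
  using Hom_diff[of f M N "- g"] by simp

lemma zero_cmp [simp]: "0 \<star> f = 0"
  using add_cmp[of 0 0 f] by simp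

text \<open>Unlike \<open>add_cmp\<close>, additivity in the second argument is available only for
  morphisms, since it is to hold for maps that are linear on subspaces; this is where the premise on
  \<open>f\<close> comes from.\<close>

lemma cmp_zero [simp]:
  assumes "f \<in> Hom M N" shows "f \<star> 0 = 0"
  using cmp_add[of f M N 0 M 0] assms Hom_Ob[of f M N] by simp

lemma minus_cmp: "(- f) \<star> h = - (f \<star> h)"
  using add_cmp[of f "- f" h] by (simp add: eq_neg_iff_add_eq_0 add.commute)

lemma cmp_minus: "h \<in> Hom M N \<Longrightarrow> f \<in> Hom L M \<Longrightarrow> h \<star> (- f) = - (h \<star> f)"
  using cmp_add[of h M N f L "- f"] by (simp add: eq_neg_iff_add_eq_0 add.commute)

lemma diff_cmp: "(f - g) \<star> h = f \<star> h - g \<star> h"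
  using add_cmp[of f "- g" h] by (simp add: minus_cmp)

lemma cmp_diff: "h \<in> Hom M N \<Longrightarrow> f \<in> Hom L M \<Longrightarrow> g \<in> Hom L M \<Longrightarrow> h \<star> (f - g) = h \<star> f - h \<star> g"
  using cmp_add[of h M N f L "- g"] by (simp add: cmp_minus)

section \<open>Isomorphisms, retracts and direct sums in an additive category\<close>

definition inverse_pair :: "'o \<Rightarrow> 'o \<Rightarrow> 'm \<Rightarrow> 'm \<Rightarrow> bool" where
  "inverse_pair M N f g \<longleftrightarrow> f \<in> Hom M N \<and> g \<in> Hom N M \<and> g \<star> f = Id M \<and> f \<star> g = Id N"

definition isom :: "'o \<Rightarrow> 'o \<Rightarrow> bool" where
  "isom M N \<longleftrightarrow> (\<exists>f g. inverse_pair M N f g)"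

definition unit :: "'o \<Rightarrow> 'm \<Rightarrow> bool" where
  "unit M f \<longleftrightarrow> (\<exists>g. inverse_pair M M f g)"

definition null :: "'o \<Rightarrow> bool" where
  "null M \<longleftrightarrow> M \<in> Ob \<and> Id M = 0"

definition retract :: "'o \<Rightarrow> 'o \<Rightarrow> bool" where
  "retract L M \<longleftrightarrow> (\<exists>i\<in>Hom L M. \<exists>p\<in>Hom M L. p \<star> i = Id L)"

definition biproduct :: "'o \<Rightarrow> 'o \<Rightarrow> 'o \<Rightarrow> 'm \<Rightarrow> 'm \<Rightarrow> 'm \<Rightarrow> 'm \<Rightarrow> bool" where
  "biproduct M A B i p j q \<longleftrightarrow> i \<in> Hom A M \<and> p \<in> Hom M A \<and> j \<in> Hom B M \<and> q \<in> Hom M B \<and>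
     p \<star> i = Id A \<and> q \<star> j = Id B \<and> p \<star> j = 0 \<and> q \<star> i = 0 \<and> i \<star> p + j \<star> q = Id M"

text \<open>A relation and not a chosen sum: \<open>M\<close> is some direct sum of \<open>A\<close>
  and \<open>B\<close>, which makes the notion stable under isomorphism in all three places.\<close>

definition decomp :: "'o \<Rightarrow> 'o \<Rightarrow> 'o \<Rightarrow> bool" where
  "decomp M A B \<longleftrightarrow> (\<exists>i p j q. biproduct M A B i p j q)"

definition indecomposable :: "'o \<Rightarrow> bool" where
  "indecomposable M \<longleftrightarrow> M \<in> Ob \<and> \<not> null M \<and> (\<forall>A B. decomp M A B \<longrightarrow> null A \<or> null B)"

lemma isom_Ob: "isom M N \<Longrightarrow> M \<in> Ob \<and> N \<in> Ob"
  unfolding isom_def inverse_pair_def using Hom_Ob by blast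

lemma decomp_Ob: "decomp M A B \<Longrightarrow> M \<in> Ob \<and> A \<in> Ob \<and> B \<in> Ob"
  unfolding decomp_def biproduct_def using Hom_Ob by blast

lemma isom_refl: "M \<in> Ob \<Longrightarrow> isom M M"
  unfolding isom_def inverse_pair_def by (metis Id_Hom Id_cmp)

lemma isom_sym: "isom M N \<Longrightarrow> isom N M"
  unfolding isom_def inverse_pair_def by blast

text \<open>Composites are normalised to the right, where two adjacent factors form a subterm only
  at the very end; this rule and \<open>mid_zero\<close> apply the biproduct equations in the
  middle.\<close>

lemma mid_cancel: "g \<star> f = Id M \<Longrightarrow> f' \<in> Hom L M \<Longrightarrow> g \<star> (f \<star> f') = f'"
  by (metis cmp_assoc Id_cmp)

lemma mid_zero: "g \<star> f = 0 \<Longrightarrow> g \<star> (f \<star> f') = 0"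
  by (metis cmp_assoc zero_cmp)

lemma inverse_pair_trans:
  assumes "inverse_pair L M f g" "inverse_pair M N f' g'"
  shows "inverse_pair L N (f' \<star> f) (g \<star> g')"
  using assms unfolding inverse_pair_def by (auto simp: cmp_assoc mid_cancel)

lemma isom_trans: "isom L M \<Longrightarrow> isom M N \<Longrightarrow> isom L N"
  unfolding isom_def using inverse_pair_trans by blast

lemma retract_isom: "isom M N \<Longrightarrow> retract M N"
  unfolding isom_def inverse_pair_def retract_def by blast

lemma retract_trans:
  assumes "retract L M" "retract M N"
  shows "retract L N"
proof -
  obtain i p j q where "i \<in> Hom L M" "p \<in> Hom M L" "p \<star> i = Id L"
    "j \<in> Hom M N" "q \<in> Hom N M" "q \<star> j = Id M"
    using assms unfolding retract_def by blast
  then show ?thesis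
    unfolding retract_def by (intro bexI[of _ "j \<star> i"] bexI[of _ "p \<star> q"]) (auto simp: cmp_assoc mid_cancel)
qed

lemma retract_Ob: "retract L M \<Longrightarrow> L \<in> Ob \<and> M \<in> Ob"
  unfolding retract_def using Hom_Ob by blast

lemma decomp_sym:
  assumes "decomp M A B" shows "decomp M B A"
  using assms unfolding decomp_def biproduct_def by (metis add.commute)

lemma decomp_retract: "decomp M A B \<Longrightarrow> retract A M"
  unfolding decomp_def biproduct_def retract_def by blast

lemma decomp_isom:
  assumes "decomp M A B" "isom M' M"
  shows "decomp M' A B"
proof -
  obtain i p j q where b: "i \<in> Hom A M" "p \<in> Hom M A" "j \<in> Hom B M" "q \<in> Hom M B"
     "p \<star> i = Id A" "q \<star> j = Id B" "p \<star> j = 0" "q \<star> i = 0" "i \<star> p + j \<star> q = Id M"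
    using assms(1) unfolding decomp_def biproduct_def by blast
  obtain f g where f: "f \<in> Hom M' M" "g \<in> Hom M M'" "g \<star> f = Id M'" "f \<star> g = Id M"
    using assms(2) unfolding isom_def inverse_pair_def by blast
  have "g \<star> i \<star> (p \<star> f) + g \<star> j \<star> (q \<star> f) = g \<star> (i \<star> p + j \<star> q) \<star> f"
    using b(1-4) f(1,2) by (simp add: cmp_assoc add_cmp cmp_add[of _ M M' _ M'])
  also have "\<dots> = Id M'"
    using b f by (metis cmp_Id)
  finally have "biproduct M' A B (g \<star> i) (p \<star> f) (g \<star> j) (q \<star> f)"
    unfolding biproduct_def using b f by (auto simp: cmp_assoc mid_cancel mid_zero)
  then show ?thesis unfolding decomp_def by blast
qed

lemma decomp_unique:
  assumes "decomp M A B" "decomp M' A B"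
  shows "isom M M'"
proof -
  obtain i p j q where b: "i \<in> Hom A M" "p \<in> Hom M A" "j \<in> Hom B M" "q \<in> Hom M B"
     "p \<star> i = Id A" "q \<star> j = Id B" "p \<star> j = 0" "q \<star> i = 0" "i \<star> p + j \<star> q = Id M"
    using assms(1) unfolding decomp_def biproduct_def by blast
  obtain i' p' j' q' where c: "i' \<in> Hom A M'" "p' \<in> Hom M' A" "j' \<in> Hom B M'" "q' \<in> Hom M' B"
     "p' \<star> i' = Id A" "q' \<star> j' = Id B" "p' \<star> j' = 0" "q' \<star> i' = 0" "i' \<star> p' + j' \<star> q' = Id M'"
    using assms(2) unfolding decomp_def biproduct_def by blast
  have "inverse_pair M M' (i' \<star> p + j' \<star> q) (i \<star> p' + j \<star> q')"
    unfolding inverse_pair_def using b c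
    by (simp add: add_cmp cmp_add[of p M A _ M'] cmp_add[of q M B _ M'] cmp_add[of p' M' A _ M]
      cmp_add[of q' M' B _ M] cmp_assoc mid_cancel[of p i A] mid_cancel[of q j B]
      mid_cancel[of p' i' A] mid_cancel[of q' j' B] mid_zero)
  then show ?thesis unfolding isom_def by blast
qed

lemma decomp_cong:
  assumes "decomp M A B" "isom A A'" "isom B B'"
  shows "decomp M A' B'"
proof -
  obtain i p j q where b: "i \<in> Hom A M" "p \<in> Hom M A" "j \<in> Hom B M" "q \<in> Hom M B"
     "p \<star> i = Id A" "q \<star> j = Id B" "p \<star> j = 0" "q \<star> i = 0" "i \<star> p + j \<star> q = Id M"
    using assms(1) unfolding decomp_def biproduct_def by blast
  obtain f g where f: "f \<in> Hom A A'" "g \<in> Hom A' A" "g \<star> f = Id A" "f \<star> g = Id A'"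
    using assms(2) unfolding isom_def inverse_pair_def by blast
  obtain f' g' where f': "f' \<in> Hom B B'" "g' \<in> Hom B' B" "g' \<star> f' = Id B" "f' \<star> g' = Id B'"
    using assms(3) unfolding isom_def inverse_pair_def by blast
  have "biproduct M A' B' (i \<star> g) (f \<star> p) (j \<star> g') (f' \<star> q)"
    unfolding biproduct_def using b f f'
    by (auto simp: cmp_assoc mid_cancel mid_zero)
  then show ?thesis unfolding decomp_def by blast
qed

text \<open>The witness \<open>E\<close> is supplied from outside: biproducts are not yet assumed to exist.\<close>

lemma decomp_assoc:
  assumes "decomp M A B" "decomp B C D" "decomp E A C"
  shows "decomp M E D"
proof -
  obtain i p j q where b: "i \<in> Hom A M" "p \<in> Hom M A" "j \<in> Hom B M" "q \<in> Hom M B"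
     "p \<star> i = Id A" "q \<star> j = Id B" "p \<star> j = 0" "q \<star> i = 0" and bs: "i \<star> p + j \<star> q = Id M"
    using assms(1) unfolding decomp_def biproduct_def by blast
  obtain i' p' j' q' where c: "i' \<in> Hom C B" "p' \<in> Hom B C" "j' \<in> Hom D B" "q' \<in> Hom B D"
     "p' \<star> i' = Id C" "q' \<star> j' = Id D" "p' \<star> j' = 0" "q' \<star> i' = 0" and cs: "i' \<star> p' + j' \<star> q' = Id B"
    using assms(2) unfolding decomp_def biproduct_def by blast
  obtain k r l s where e: "k \<in> Hom A E" "r \<in> Hom E A" "l \<in> Hom C E" "s \<in> Hom E C"
     "r \<star> k = Id A" "s \<star> l = Id C" "r \<star> l = 0" "s \<star> k = 0" and es: "k \<star> r + l \<star> s = Id E"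
    using assms(3) unfolding decomp_def biproduct_def by blast
  \<comment> \<open>\<open>?f\<close> embeds the given sum \<open>E\<close> of \<open>A\<close> and
    \<open>C\<close> in \<open>M\<close> summand by summand, and \<open>?g\<close> projects back;
    the complement \<open>D\<close> is reached through \<open>B\<close>.\<close>
  let ?f = "i \<star> r + j \<star> i' \<star> s" and ?g = "k \<star> p + l \<star> p' \<star> q"
  have H: "?f \<in> Hom E M" "?g \<in> Hom M E" "j \<star> j' \<in> Hom D M" "q' \<star> q \<in> Hom M D"
    using b(1-4) c(1-4) e(1-4) by (blast intro: Hom_add cmp_Hom)+
  have 1: "?g \<star> ?f = Id E"
  proof -
    have "?g \<star> ?f = k \<star> (p \<star> ?f) + l \<star> (p' \<star> (q \<star> ?f))" by (simp add: add_cmp cmp_assoc)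
    moreover have "p \<star> ?f = r"
      using b c(1-4) e by (simp add: cmp_add[of p M A _ E] cmp_assoc mid_cancel mid_zero)
    moreover have "q \<star> ?f = i' \<star> s"
      using b c(1-4) e by (simp add: cmp_add[of q M B _ E] cmp_assoc mid_cancel[of q j B _ E] mid_zero)
    ultimately show ?thesis using es c e by (simp add: mid_cancel)
  qed
  have 2: "?g \<star> (j \<star> j') = 0"
    using b c e by (simp add: add_cmp cmp_assoc mid_cancel mid_zero)
  have 3: "q' \<star> q \<star> ?f = 0"
    using b c e by (simp add: cmp_add[of q M B _ E] cmp_assoc mid_cancel[of q j B _ E] mid_zero)
  have 4: "q' \<star> q \<star> (j \<star> j') = Id D"
    using b c by (simp add: cmp_assoc mid_cancel)
  have 5: "?f \<star> ?g + j \<star> j' \<star> (q' \<star> q) = Id M"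
  proof -
    have "r \<star> ?g = p" "s \<star> ?g = p' \<star> q"
      using b(1-4) c(1-4) e
      by (simp_all add: cmp_add[of r E A _ M] cmp_add[of s E C _ M] cmp_assoc mid_cancel[of r k A _ M] mid_cancel[of s l C _ M] mid_zero)
    then have "?f \<star> ?g + j \<star> j' \<star> (q' \<star> q) = i \<star> p + (j \<star> (i' \<star> p' \<star> q) + j \<star> (j' \<star> q' \<star> q))"
      by (simp add: add_cmp cmp_assoc add.assoc)
    also have "j \<star> (i' \<star> p' \<star> q) + j \<star> (j' \<star> q' \<star> q) = j \<star> ((i' \<star> p' + j' \<star> q') \<star> q)"
      using b(1-4) c(1-4) by (simp add: add_cmp cmp_add[of j B M _ M] cmp_assoc)
    finally show ?thesis using bs cs b by (simp add: Id_cmp)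
  qed
  show ?thesis
    unfolding decomp_def biproduct_def using H 1 2 3 4 5 by blast
qed

lemma null_unique':
  assumes "null M" "f \<in> Hom N M" shows "f = 0"
  using assms by (metis null_def Id_cmp zero_cmp)

lemma decomp_null:
  assumes "isom M A" "null B" shows "decomp M A B"
proof -
  obtain f g where "f \<in> Hom M A" "g \<in> Hom A M" "g \<star> f = Id M" "f \<star> g = Id A"
    using assms(1) unfolding isom_def inverse_pair_def by blast
  then have "biproduct M A B g f 0 0"
    unfolding biproduct_def using assms Hom_Ob[of f M A] by (auto simp: null_def)
  then show ?thesis unfolding decomp_def by blast
qed

lemma decomp_null_right:
  assumes "decomp M A B" "null B" shows "isom M A"
  using decomp_unique[OF assms(1) decomp_null[OF isom_refl assms(2)]] decomp_Ob[OF assms(1)] by blast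

lemma retract_null: "retract L M \<Longrightarrow> null M \<Longrightarrow> null L"
  unfolding retract_def null_def using null_unique'[unfolded null_def] Hom_Ob by (metis zero_cmp cmp_zero)

end

text \<open>In the instance \<open>sz\<close> is the total dimension. \<open>sz_less\<close> makes
  repeated splitting terminate, and \<open>fitting\<close>, where the \<open>n\<close>-th power of
  \<open>f\<close> is written as an iterate applied to the identity, makes the endomorphism rings of
  indecomposables local.\<close>

locale krull_schmidt_category = additive_category Ob Hom cmp Id
  for Ob :: "'o set" and Hom :: "'o \<Rightarrow> 'o \<Rightarrow> 'm::ab_group_add set"
    and cmp :: "'m \<Rightarrow> 'm \<Rightarrow> 'm" (infixl "\<star>" 70) and Id :: "'o \<Rightarrow> 'm" +
  fixes sz :: "'o \<Rightarrow> nat"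
  assumes biproduct_exists: "A \<in> Ob \<Longrightarrow> B \<in> Ob \<Longrightarrow> \<exists>M. decomp M A B"
    and sz_less: "decomp M A B \<Longrightarrow> \<not> null A \<Longrightarrow> sz B < sz M"
    and retract_split: "retract L M \<Longrightarrow> \<exists>R. decomp M L R"
    and fitting: "indecomposable M \<Longrightarrow> f \<in> Hom M M \<Longrightarrow> unit M f \<or> (\<exists>n. ((\<star>) f ^^ n) (Id M) = 0)"
begin

section \<open>Local endomorphism rings and cancellation\<close>

lemma unit_cmp: "unit M f \<Longrightarrow> unit M g \<Longrightarrow> unit M (f \<star> g)"
  unfolding unit_def using inverse_pair_trans by blast

lemma decomp_assoc_ex:
  assumes "decomp M A B" "decomp B C D"
  obtains E where "decomp M E D" "decomp E A C"
  using assms decomp_assoc biproduct_exists decomp_Ob by meson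

lemma decomp_swap:
  assumes "decomp M A B" "decomp B C D"
  obtains E where "decomp M C E" "decomp E A D"
  using assms decomp_assoc_ex[OF assms(1) decomp_sym[OF assms(2)]] decomp_sym by metis

text \<open>Geometric series: the sum \<open>s k\<close> of the first \<open>k\<close> powers of
  \<open>f\<close> multiplies with 1 - f, on either side, to the identity minus the
  \<open>k\<close>-th power, and the \<open>n\<close>-th power vanishes.\<close>

lemma unit_Id_minus:
  assumes f: "f \<in> Hom M M" and nil: "((\<star>) f ^^ n) (Id M) = 0"
  shows "unit M (Id M - f)"
proof -
  have M: "M \<in> Ob" using f Hom_Ob by blast
  define pw where "pw = (\<lambda>n. ((\<star>) f ^^ n) (Id M))"
  define s where "s = (\<lambda>n. \<Sum>k<n. pw k)"
  have pw: "pw k \<in> Hom M M \<and> f \<star> pw k = pw (Suc k) \<and> pw k \<star> f = pw (Suc k)" for k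
    by (induction k) (use f M in \<open>auto simp: pw_def cmp_Id Id_cmp cmp_assoc\<close>)
  have s: "s k \<in> Hom M M" for k
    by (induction k) (use pw M in \<open>auto simp: s_def\<close>)
  have "(Id M - f) \<star> s k = Id M - pw k \<and> s k \<star> (Id M - f) = Id M - pw k" for k
  proof (induction k)
    case 0
    then show ?case using f M cmp_zero[of "Id M - f" M M] by (auto simp: s_def pw_def)
  next
    case (Suc k)
    have "s (Suc k) = s k + pw k" by (simp add: s_def)
    moreover have "(Id M - f) \<star> (s k + pw k) = (Id M - f) \<star> s k + (Id M - f) \<star> pw k"
      using f M pw s by (intro cmp_add[of _ M M]) auto
    moreover have "(Id M - f) \<star> pw k = pw k - pw (Suc k)" "pw k \<star> (Id M - f) = pw k - pw (Suc k)"
      using f M pw[of k] by (simp_all add: diff_cmp cmp_diff[of "pw k" M M _ M] Id_cmp[of "pw k" M M] cmp_Id[of "pw k" M M])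
    ultimately show ?case using Suc by (simp add: add_cmp)
  qed
  from this[of n] have "inverse_pair M M (Id M - f) (s n)"
    unfolding inverse_pair_def using s f M nil by (auto simp: pw_def)
  then show ?thesis unfolding unit_def by blast
qed

text \<open>The endomorphism ring of an indecomposable is local. After multiplication by the inverse
  \<open>h\<close> of the sum, \<open>h f\<close> and \<open>h g\<close> add up to the identity; if
  \<open>h f\<close> is nilpotent, then \<open>h g\<close> is the unit provided by
  \<open>unit_Id_minus\<close>.\<close>

lemma unit_add:
  assumes L: "indecomposable L" and f: "f \<in> Hom L L" and g: "g \<in> Hom L L" and u: "unit L (f + g)"
  shows "unit L f \<or> unit L g"
proof -
  obtain h where h: "h \<in> Hom L L" "h \<star> (f + g) = Id L" "(f + g) \<star> h = Id L"
    using u unfolding unit_def inverse_pair_def by blast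
  have uh: "unit L (f + g)" "unit L h"
    using u h Hom_add[OF f g] unfolding unit_def inverse_pair_def by blast+
  have eq: "h \<star> f + h \<star> g = Id L" using h f g by (metis cmp_add)
  have cancel: "unit L k" if "k \<in> Hom L L" "unit L (h \<star> k)" for k
    using unit_cmp[OF uh(1) that(2)] that(1) h(3) by (simp add: mid_cancel)
  from fitting[OF L, of "h \<star> f"] f h(1)
  consider "unit L (h \<star> f)" | n where "((\<star>) (h \<star> f) ^^ n) (Id L) = 0" by auto
  then show ?thesis
  proof cases
    case 1
    then show ?thesis using cancel f by blast
  next
    case 2
    then have "unit L (Id L - h \<star> f)" using f h by (intro unit_Id_minus) auto
    then show ?thesis using cancel g eq by (metis add_diff_cancel_left')
  qed
qed

lemma retract_of_unit:
  assumes "f \<in> Hom L M" "g \<in> Hom M L" "unit L (g \<star> f)"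
  shows "retract L M"
proof -
  obtain h where "h \<in> Hom L L" "h \<star> (g \<star> f) = Id L"
    using assms unfolding unit_def inverse_pair_def by blast
  then show ?thesis unfolding retract_def using assms
    by (intro bexI[of _ f] bexI[of _ "h \<star> g"]) (auto simp: cmp_assoc)
qed

text \<open>Indecomposables behave like primes: the identity of \<open>L\<close> is the sum of an
  endomorphism through \<open>A\<close> and one through \<open>B\<close>, and by locality one of the
  two is a unit.\<close>

lemma retract_decomp:
  assumes L: "indecomposable L" and "decomp M A B" "retract L M"
  shows "retract L A \<or> retract L B"
proof -
  obtain i p j q where b: "i \<in> Hom A M" "p \<in> Hom M A" "j \<in> Hom B M" "q \<in> Hom M B"
     "i \<star> p + j \<star> q = Id M"
    using assms(2) unfolding decomp_def biproduct_def by blast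
  obtain k r where k: "k \<in> Hom L M" "r \<in> Hom M L" "r \<star> k = Id L"
    using assms(3) unfolding retract_def by blast
  have "(r \<star> i) \<star> (p \<star> k) + (r \<star> j) \<star> (q \<star> k) = r \<star> (i \<star> p + j \<star> q) \<star> k"
    using b(1-4) k by (simp add: add_cmp cmp_assoc cmp_add[of r M L _ L])
  also have "\<dots> = Id L" using b k by (simp add: cmp_Id)
  finally have "unit L ((r \<star> i) \<star> (p \<star> k) + (r \<star> j) \<star> (q \<star> k))"
    unfolding unit_def inverse_pair_def using Hom_Ob[OF k(1)] by (metis Id_Hom cmp_Id)
  then have "unit L ((r \<star> i) \<star> (p \<star> k)) \<or> unit L ((r \<star> j) \<star> (q \<star> k))"
    using b k by (intro unit_add[OF L]) auto
  then show ?thesis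
    using retract_of_unit[of "p \<star> k" L A "r \<star> i"] retract_of_unit[of "q \<star> k" L B "r \<star> j"] b k by auto
qed

text \<open>Gaussian elimination. The identity of \<open>M\<close> is read as a block matrix from
  \<open>L\<close> + \<open>A\<close> to \<open>L\<close> + \<open>B\<close>; when the pivot
  \<open>q1 i1\<close> is a unit, its Schur complement \<open>?d\<close> is an isomorphism from
  \<open>A\<close> to \<open>B\<close>, and its inverse is the corresponding block
  \<open>?d'\<close> of the inverse matrix.\<close>

lemma cancellation_unit:
  assumes "biproduct M L A i1 p1 i2 p2" "biproduct M L B j1 q1 j2 q2" "unit L (q1 \<star> i1)"
  shows "isom A B"
proof -
  have a: "i1 \<in> Hom L M" "p1 \<in> Hom M L" "i2 \<in> Hom A M" "p2 \<in> Hom M A"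
     "p1 \<star> i1 = Id L" "p2 \<star> i2 = Id A" "p1 \<star> i2 = 0" "p2 \<star> i1 = 0" and as: "i1 \<star> p1 + i2 \<star> p2 = Id M"
    using assms(1) unfolding biproduct_def by auto
  have b: "j1 \<in> Hom L M" "q1 \<in> Hom M L" "j2 \<in> Hom B M" "q2 \<in> Hom M B"
     "q1 \<star> j1 = Id L" "q2 \<star> j2 = Id B" "q1 \<star> j2 = 0" "q2 \<star> j1 = 0" and bs: "j1 \<star> q1 + j2 \<star> q2 = Id M"
    using assms(2) unfolding biproduct_def by auto
  obtain h where h: "h \<in> Hom L L" "h \<star> (q1 \<star> i1) = Id L" "(q1 \<star> i1) \<star> h = Id L"
    using assms(3) unfolding unit_def inverse_pair_def by blast
  let ?d = "q2 \<star> i2 - q2 \<star> i1 \<star> h \<star> q1 \<star> i2" and ?d' = "p2 \<star> j2"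
  \<comment> \<open>The resolution of the identity of \<open>M\<close> trades a passage through
    \<open>A\<close> for one through \<open>L\<close>; the next fact does the same for
    \<open>B\<close>.\<close>
  have *: "x \<star> i2 \<star> p2 \<star> y = x \<star> y - x \<star> i1 \<star> p1 \<star> y" if "x \<in> Hom M Vs" "y \<in> Hom Y M" for x y Vs Y
  proof -
    have "x \<star> i1 \<star> p1 \<star> y + x \<star> i2 \<star> p2 \<star> y = x \<star> (i1 \<star> p1 + i2 \<star> p2) \<star> y"
      using a that by (simp add: cmp_assoc add_cmp cmp_add[of x M Vs _ Y])
    then have "x \<star> i1 \<star> p1 \<star> y + x \<star> i2 \<star> p2 \<star> y = x \<star> y" using as that by (simp add: cmp_Id)
    then show ?thesis by (simp add: algebra_simps)
  qed
  have **: "x \<star> j2 \<star> q2 \<star> y = x \<star> y - x \<star> j1 \<star> q1 \<star> y" if "x \<in> Hom M Vs" "y \<in> Hom Y M" for x y Vs Y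
  proof -
    have "x \<star> j1 \<star> q1 \<star> y + x \<star> j2 \<star> q2 \<star> y = x \<star> (j1 \<star> q1 + j2 \<star> q2) \<star> y"
      using b that by (simp add: cmp_assoc add_cmp cmp_add[of x M Vs _ Y])
    then have "x \<star> j1 \<star> q1 \<star> y + x \<star> j2 \<star> q2 \<star> y = x \<star> y" using bs that by (simp add: cmp_Id)
    then show ?thesis by (simp add: algebra_simps)
  qed
  have hh: "q1 \<star> i1 \<star> h = Id L" "h \<star> q1 \<star> i1 = Id L" using h by (simp_all add: cmp_assoc)
  have H: "q2 \<star> i2 \<in> Hom A B" "q2 \<star> i1 \<star> h \<star> q1 \<star> i2 \<in> Hom A B" "?d' \<in> Hom B A" "?d \<in> Hom A B"
    using a(1-4) b(1-4) h(1) by (blast intro: cmp_Hom Hom_diff)+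
  have m: "q2 \<star> i1 \<star> h \<in> Hom L B" "q1 \<star> i1 \<star> p1 \<star> j2 \<in> Hom B L"
    using a(1-4) b(1-4) h(1) by (blast intro: cmp_Hom)+
  have "?d' \<star> ?d = p2 \<star> j2 \<star> q2 \<star> i2 - p2 \<star> j2 \<star> q2 \<star> i1 \<star> h \<star> q1 \<star> i2"
    using cmp_diff[OF H(3) H(1,2)] by (simp add: cmp_assoc)
  also have "\<dots> = p2 \<star> i2 - p2 \<star> j1 \<star> q1 \<star> i2 - (p2 \<star> i1 - p2 \<star> j1 \<star> q1 \<star> i1) \<star> h \<star> q1 \<star> i2"
    using **[OF a(4,1)] **[OF a(4,3)] by simp
  also have "\<dots> = Id A - p2 \<star> j1 \<star> q1 \<star> i2 + p2 \<star> j1 \<star> (q1 \<star> i1 \<star> h) \<star> q1 \<star> i2"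
    using a by (simp add: diff_cmp minus_cmp cmp_assoc)
  also have "\<dots> = Id A"
    unfolding hh using a b by (simp add: cmp_assoc Id_cmp)
  finally have 1: "?d' \<star> ?d = Id A" .
  have "?d \<star> ?d' = q2 \<star> i2 \<star> p2 \<star> j2 - q2 \<star> i1 \<star> h \<star> (q1 \<star> i2 \<star> p2 \<star> j2)"
    by (simp add: diff_cmp cmp_assoc)
  also have "\<dots> = q2 \<star> j2 - q2 \<star> i1 \<star> p1 \<star> j2 - q2 \<star> i1 \<star> h \<star> (- (q1 \<star> i1 \<star> p1 \<star> j2))"
    using *[OF b(4,3)] *[OF b(2,3)] b by simp
  also have "\<dots> = Id B - q2 \<star> i1 \<star> p1 \<star> j2 + q2 \<star> i1 \<star> (h \<star> q1 \<star> i1) \<star> p1 \<star> j2"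
    using b by (simp add: cmp_minus[OF m]) (simp add: cmp_assoc)
  also have "\<dots> = Id B"
    unfolding hh using a b by (simp add: cmp_Id[of "q2 \<star> i1" L B])
  finally have 2: "?d \<star> ?d' = Id B" .
  show ?thesis
    unfolding isom_def inverse_pair_def using 1 2 H by blast
qed

text \<open>If the pivot \<open>q1 i1\<close> is not a unit, the second decomposition is changed by
  a shear with \<open>?b = p1 j2\<close> so that it becomes one, and
  \<open>cancellation_unit\<close> applies to the same objects.\<close>

lemma cancellation:
  assumes L: "indecomposable L" and "decomp M L A" "decomp M L B"
  shows "isom A B"
proof -
  obtain i1 p1 i2 p2 where bA: "biproduct M L A i1 p1 i2 p2"
    using assms(2) unfolding decomp_def by blast
  obtain j1 q1 j2 q2 where bB: "biproduct M L B j1 q1 j2 q2"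
    using assms(3) unfolding decomp_def by blast
  have a: "i1 \<in> Hom L M" "p1 \<in> Hom M L" "p1 \<star> i1 = Id L"
    using bA unfolding biproduct_def by auto
  have b: "j1 \<in> Hom L M" "q1 \<in> Hom M L" "j2 \<in> Hom B M" "q2 \<in> Hom M B"
     "q1 \<star> j1 = Id L" "q2 \<star> j2 = Id B" "q1 \<star> j2 = 0" "q2 \<star> j1 = 0" and bs: "j1 \<star> q1 + j2 \<star> q2 = Id M"
    using bB unfolding biproduct_def by auto
  show ?thesis
  proof (cases "unit L (q1 \<star> i1)")
    case True
    then show ?thesis using cancellation_unit bA bB by blast
  next
    case False
    let ?b = "p1 \<star> j2"
    have "p1 \<star> j1 \<star> (q1 \<star> i1) + ?b \<star> (q2 \<star> i1) = p1 \<star> (j1 \<star> q1 + j2 \<star> q2) \<star> i1"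
      using a b(1-4) by (simp add: add_cmp cmp_assoc cmp_add[of p1 M L _ L])
    also have "\<dots> = Id L" using a bs by (simp add: cmp_Id)
    finally have s: "p1 \<star> j1 \<star> (q1 \<star> i1) + ?b \<star> (q2 \<star> i1) = Id L" .
    have m: "q1 \<star> i1 \<in> Hom L L" "?b \<star> (q2 \<star> i1) \<in> Hom L L"
      using a b by (blast intro: cmp_Hom)+
    have uI: "unit L (Id L)"
      unfolding unit_def inverse_pair_def using Hom_Ob[OF a(1)] by (metis Id_Hom cmp_Id)
    \<comment> \<open>Otherwise \<open>q1 i1\<close> would have a left inverse, and so would all its
      powers; but as a non-unit it is nilpotent by \<open>fitting\<close>, and the identity of
      \<open>L\<close> would vanish.\<close>
    have "\<not> unit L (p1 \<star> j1 \<star> (q1 \<star> i1))"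
    proof
      assume "unit L (p1 \<star> j1 \<star> (q1 \<star> i1))"
      then obtain h where h: "h \<in> Hom L L" "h \<star> (p1 \<star> j1 \<star> (q1 \<star> i1)) = Id L"
        unfolding unit_def inverse_pair_def by blast
      let ?x = "q1 \<star> i1" and ?y = "h \<star> (p1 \<star> j1)"
      have x: "?x \<in> Hom L L" "?y \<in> Hom L L" using h a b by auto
      have yx: "?y \<star> ?x = Id L" using h by (simp add: cmp_assoc)
      from fitting[OF L x(1)] False obtain n where n: "((\<star>) ?x ^^ n) (Id L) = 0" by blast
      have "((\<star>) ?y ^^ k) (((\<star>) ?x ^^ k) (Id L)) = Id L" for k
      proof (induction k)
        case (Suc k)
        have xk: "((\<star>) ?x ^^ k) (Id L) \<in> Hom L L"
          by (induction k) (use x Hom_Ob[OF a(1)] in auto)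
        have "((\<star>) ?y ^^ Suc k) (((\<star>) ?x ^^ Suc k) (Id L)) =
          ((\<star>) ?y ^^ k) (?y \<star> (?x \<star> (((\<star>) ?x ^^ k) (Id L))))"
          by (simp add: funpow_swap1)
        also have "\<dots> = Id L" using mid_cancel[OF yx xk] Suc by simp
        finally show ?case .
      qed auto
      from this[of n] n have "((\<star>) ?y ^^ n) 0 = Id L" by simp
      moreover have "((\<star>) ?y ^^ k) 0 = 0" for k
        by (induction k) (use x in auto)
      ultimately have "Id L = 0" by simp
      then show False using L unfolding indecomposable_def null_def by blast
    qed
    then have ub: "unit L (?b \<star> (q2 \<star> i1))"
      using unit_add[OF L, of "p1 \<star> j1 \<star> (q1 \<star> i1)" "?b \<star> (q2 \<star> i1)"] uI s a b by auto
    \<comment> \<open>The unit \<open>?b q2 i1\<close> is the sum of the new pivot and of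
      \<open>- (q1 i1)\<close>; the latter is no unit, so locality makes the new pivot one.\<close>
    have "unit L (q1 \<star> i1 + ?b \<star> (q2 \<star> i1)) \<or> unit L (- (q1 \<star> i1))"
      using unit_add[OF L, of "q1 \<star> i1 + ?b \<star> (q2 \<star> i1)" "- (q1 \<star> i1)"] ub m by auto
    moreover have "\<not> unit L (- (q1 \<star> i1))"
    proof
      assume "unit L (- (q1 \<star> i1))"
      then obtain h where "h \<in> Hom L L" "h \<star> (- (q1 \<star> i1)) = Id L" "(- (q1 \<star> i1)) \<star> h = Id L"
        unfolding unit_def inverse_pair_def by blast
      then have "inverse_pair L L (q1 \<star> i1) (- h)"
        unfolding inverse_pair_def using a b by (auto simp: minus_cmp cmp_minus[of _ L L _ L])
      then show False using False unfolding unit_def by blast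
    qed
    ultimately have u: "unit L ((q1 + ?b \<star> q2) \<star> i1)"
      by (simp add: add_cmp cmp_assoc)
    \<comment> \<open>The shear: the objects \<open>L\<close> and \<open>B\<close> stay, the
      projection to \<open>L\<close> gains \<open>?b q2\<close>, and the embedding of
      \<open>B\<close> is corrected to match.\<close>
    have "biproduct M L B j1 (q1 + ?b \<star> q2) (j2 - j1 \<star> ?b) q2"
    proof -
      have h: "?b \<in> Hom B L" using a b by auto
      have H: "q1 + ?b \<star> q2 \<in> Hom M L" "j2 - j1 \<star> ?b \<in> Hom B M"
        using h b(1-4) by (blast intro: Hom_add Hom_diff cmp_Hom)+
      have 1: "(q1 + ?b \<star> q2) \<star> j1 = Id L"
        using b h by (simp add: add_cmp cmp_assoc[of ?b] del: cmp_assoc)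
      have 2: "q2 \<star> (j2 - j1 \<star> ?b) = Id B"
        using b h by (simp add: cmp_diff[of q2 M B _ B] mid_zero)
      have 3: "(q1 + ?b \<star> q2) \<star> (j2 - j1 \<star> ?b) = 0"
        using b h by (simp add: add_cmp cmp_assoc[of ?b q2] cmp_diff[of q1 M L j2 B] cmp_diff[of q2 M B j2 B]
          mid_zero mid_cancel[of q1 j1 L _ B] cmp_Id)
      have 4: "j1 \<star> (q1 + ?b \<star> q2) + (j2 - j1 \<star> ?b) \<star> q2 = Id M"
        using cmp_add[of j1 L M q1 M "?b \<star> q2"] cmp_Hom[OF h b(4)] b(1,2) bs
        by (simp add: diff_cmp cmp_assoc)
      show ?thesis unfolding biproduct_def using H 1 2 3 4 b by auto
    qed
    then show ?thesis using cancellation_unit[OF bA _ u] by blast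
  qed
qed

text \<open>Copies of \<open>W\<close> are split off until none is left. This is first only a
  relation, because every step chooses a complement; that the count does not depend on the choices
  is the content of \<open>cancellation\<close>.\<close>

inductive multiplicity :: "'o \<Rightarrow> 'o \<Rightarrow> nat \<Rightarrow> bool" for W where
  none: "M \<in> Ob \<Longrightarrow> \<not> retract W M \<Longrightarrow> multiplicity W M 0"
| step: "decomp M W N \<Longrightarrow> multiplicity W N m \<Longrightarrow> multiplicity W M (Suc m)"

lemma multiplicity_exists:
  assumes W: "indecomposable W" and "M \<in> Ob"
  shows "\<exists>m. multiplicity W M m"
  using assms(2)
proof (induction "sz M" arbitrary: M rule: less_induct)
  case less
  show ?case
  proof (cases "retract W M")
    case True
    then obtain N where N: "decomp M W N" using retract_split by blast
    moreover have "sz N < sz M" using N sz_less W unfolding indecomposable_def by blast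
    ultimately show ?thesis using less decomp_Ob multiplicity.step by meson
  qed (use less none in blast)
qed

lemma multiplicity_isom:
  assumes "multiplicity W M m" "isom M' M"
  shows "multiplicity W M' m"
  using assms
proof (induction arbitrary: M')
  case (none M)
  then show ?case using isom_Ob retract_isom retract_trans by (meson isom_sym multiplicity.none)
next
  case (step M N m)
  then show ?case using decomp_isom multiplicity.step by blast
qed

text \<open>Two complements of \<open>W\<close> in the same object are isomorphic by
  \<open>cancellation\<close>, so different ways of splitting off copies cannot stop at different
  counts.\<close>

lemma multiplicity_unique:
  assumes W: "indecomposable W" and "multiplicity W M m" "multiplicity W M m'"
  shows "m = m'"
  using assms(2,3)
proof (induction arbitrary: m')
  case (none M)
  from none.prems show ?case by cases (use none.hyps decomp_retract in auto)
next
  case (step M N m)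
  from step.prems show ?case
  proof cases
    case none
    then show ?thesis using step decomp_retract by blast
  next
    case (step N' k)
    then show ?thesis
      using step.IH multiplicity_isom cancellation[OF W] \<open>decomp M W N\<close> by blast
  qed
qed

text \<open>Copies of \<open>W\<close> are peeled off \<open>A\<close> and then off
  \<open>B\<close>; once neither contains \<open>W\<close>, \<open>retract_decomp\<close> excludes
  it from the remaining sum as well.\<close>

lemma multiplicity_decomp:
  assumes W: "indecomposable W" and "multiplicity W A a" "multiplicity W B b" "decomp M A B"
  shows "multiplicity W M (a + b)"
  using assms(2,4)
proof (induction arbitrary: M)
  case (none A)
  show ?case using assms(3) none.prems
  proof (induction arbitrary: M)
    case (none B)
    then show ?case
      using retract_decomp[OF W] \<open>\<not> retract W A\<close> multiplicity.none decomp_Ob by (metis add_0)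
  next
    case (step B B' m)
    then show ?case using decomp_swap multiplicity.step by (metis add_0)
  qed
next
  case (step A A' m)
  obtain E where "decomp M W E" "decomp E B A'"
    using decomp_swap[OF decomp_sym[OF step.prems] step.hyps(1)] by blast
  then show ?case using step.IH decomp_sym multiplicity.step by (metis add_Suc)
qed

definition mult :: "'o \<Rightarrow> 'o \<Rightarrow> nat" where
  "mult W M = (THE m. multiplicity W M m)"

lemma mult_eqI: "indecomposable W \<Longrightarrow> multiplicity W M m \<Longrightarrow> mult W M = m"
  unfolding mult_def using multiplicity_unique by blast

lemma mult_decomp:
  assumes "indecomposable W" "decomp M A B"
  shows "mult W M = mult W A + mult W B"
  using assms multiplicity_exists multiplicity_decomp mult_eqI decomp_Ob by metis

lemma mult_eq_0:
  assumes "indecomposable W" "M \<in> Ob" "\<not> retract W M"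
  shows "mult W M = 0"
  using assms none mult_eqI by blast

text \<open>The value that clashes, in \<open>K0_finitely_generated\<close>, with a multiplicity
  vanishing on all generators.\<close>

lemma mult_self:
  assumes "indecomposable W"
  shows "mult W W \<noteq> 0"
proof -
  have W: "W \<in> Ob" "\<not> null W" using assms unfolding indecomposable_def by auto
  obtain N where "decomp W W N" using retract_split[OF retract_isom[OF isom_refl[OF W(1)]]] by blast
  then have "mult W W = Suc (mult W N)"
    using assms multiplicity_exists multiplicity.step mult_eqI decomp_Ob by metis
  then show ?thesis by simp
qed

lemma decomp_induct [consumes 1, case_names null indecomposable decomp]:
  assumes "M \<in> Ob"
    and "\<And>M. null M \<Longrightarrow> P M"
    and "\<And>M. indecomposable M \<Longrightarrow> P M"
    and "\<And>M A B. decomp M A B \<Longrightarrow> P A \<Longrightarrow> P B \<Longrightarrow> P M"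
  shows "P M"
  using assms(1)
proof (induction "sz M" arbitrary: M rule: less_induct)
  case less
  consider "null M" | "indecomposable M" | A B where "decomp M A B" "\<not> null A" "\<not> null B"
    using less.prems unfolding indecomposable_def by blast
  then show ?case
  proof cases
    case (3 A B)
    then show ?thesis using less.hyps[of A] less.hyps[of B] decomp_Ob sz_less decomp_sym assms(4) by meson
  qed (use assms in auto)
qed

text \<open>The inductive form of \<open>add_class\<close>, matched with it in
  \<open>add_class_iff\<close>; closure under functors that respect direct sums then follows by rule
  induction instead of through lists of summands.\<close>

inductive add_closure :: "'o set \<Rightarrow> 'o \<Rightarrow> bool" for Vs where
  zero: "null M \<Longrightarrow> add_closure Vs M"
| base: "V \<in> Vs \<Longrightarrow> retract M V \<Longrightarrow> add_closure Vs M"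
| sum: "decomp M A B \<Longrightarrow> add_closure Vs A \<Longrightarrow> add_closure Vs B \<Longrightarrow> add_closure Vs M"

lemma add_closure_isom:
  assumes "add_closure Vs M" "isom M' M"
  shows "add_closure Vs M'"
  using assms
proof (induction arbitrary: M')
  case (zero M)
  then show ?case using add_closure.zero retract_null retract_isom by blast
next
  case (base V M)
  then show ?case using add_closure.base retract_trans retract_isom by blast
next
  case (sum M A B)
  then show ?case using decomp_isom add_closure.sum by blast
qed

lemma add_closure_Ob: "add_closure Vs M \<Longrightarrow> M \<in> Ob"
  by (induction rule: add_closure.induct) (auto simp: null_def dest: retract_Ob decomp_Ob)

lemma add_closure_mono:
  assumes "add_closure Vs M" "\<And>V. V \<in> Vs \<Longrightarrow> V \<in> Ob \<Longrightarrow> \<exists>V'\<in>Y. retract V V'"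
  shows "add_closure Y M"
  using assms(1)
proof (induction)
  case (base V M)
  then obtain V' where "V' \<in> Y" "retract V V'" using assms(2) retract_Ob by blast
  then show ?case using add_closure.base retract_trans base by blast
qed (use add_closure.zero add_closure.sum in blast)+

end

section \<open>Finite dimensional spaces of sequences\<close>

global_interpretation seq: vector_space_pair scale scale ..

lemma linear_scaleI:
  assumes "\<And>x y. f (x + y) = f x + f y" "\<And>c x. f (scale c x) = scale c (f x)"
  shows "Vector_Spaces.linear scale scale f"
  using assms by (simp add: Vector_Spaces.linear_iff seq.vector_space_axioms)

lemma fd_subspace: "fd_space V \<Longrightarrow> seq.subspace V"
  unfolding fd_space_def by auto

lemma fd_zero [simp]: "fd_space {0}"
  unfolding fd_space_def by (rule exI[of _ "{}"]) auto

lemma fd_basis: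
  assumes "fd_space V" "seq.subspace U" "U \<subseteq> V"
  obtains B C where "finite C" "B \<subseteq> C" "B \<subseteq> U" "C \<subseteq> V" "seq.independent C"
    "seq.span B = U" "seq.span C = V"
proof -
  obtain F where F: "finite F" "V = seq.span F" using assms(1) unfolding fd_space_def by blast
  have V: "seq.subspace V" using F by simp
  obtain B where B: "B \<subseteq> U" "seq.independent B" "U \<subseteq> seq.span B"
    using seq.maximal_independent_subset[of U] by blast
  obtain C where C: "B \<subseteq> C" "C \<subseteq> V" "seq.independent C" "V \<subseteq> seq.span C"
    using seq.maximal_independent_subset_extend[of B V] B assms by blast
  have "finite C" using seq.independent_span_bound[OF F(1) C(3)] C(2) F(2) by blast
  moreover have "seq.span B = U" using B assms by (simp add: seq.span_subspace)
  moreover have "seq.span C = V" using C V by (simp add: seq.span_subspace)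
  ultimately show thesis using that B C by blast
qed

lemma fd_subset: "fd_space V \<Longrightarrow> seq.subspace U \<Longrightarrow> U \<subseteq> V \<Longrightarrow> fd_space U"
  by (metis fd_basis fd_space_def finite_subset)

lemma fd_dim_mono:
  assumes "fd_space V" "seq.subspace U" "U \<subseteq> V"
  shows "seq.dim U \<le> seq.dim V" and "seq.dim U = seq.dim V \<Longrightarrow> U = V"
proof -
  obtain B C where *: "finite C" "B \<subseteq> C" "seq.independent C" "seq.span B = U" "seq.span C = V"
    using fd_basis[OF assms] by metis
  have "seq.dim U = card B" "seq.dim V = card C"
    using * seq.dim_span_eq_card_independent seq.independent_mono by metis+
  then show "seq.dim U \<le> seq.dim V" and "seq.dim U = seq.dim V \<Longrightarrow> U = V"
    using * card_mono card_subset_eq by (metis, metis)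
qed

text \<open>The bridge from maps that are linear only on \<open>V\<close> to globally linear ones,
  for which span, kernel and dimension arguments are available.\<close>

lemma linear_map_extend:
  assumes "seq.subspace V" "linear_map V W f"
  obtains g where "Vector_Spaces.linear scale scale g" "\<And>x. x \<in> V \<Longrightarrow> g x = f x"
proof -
  obtain B where B: "B \<subseteq> V" "seq.independent B" "V \<subseteq> seq.span B"
    using seq.maximal_independent_subset[of V] by blast
  obtain g where g: "Vector_Spaces.linear scale scale g" "\<forall>x\<in>B. g x = f x"
    using seq.linear_independent_extend[OF B(2)] by blast
  have "g x = f x" if "x \<in> V" for x
  proof -
    have "x \<in> seq.span B" using that B by blast
    then have "x \<in> V \<and> g x = f x"
    proof (induction rule: seq.span_induct_alt)
      case base
      have "f 0 = 0"
        using assms seq.subspace_0[OF assms(1)] unfolding linear_map_def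
        by (metis seq.scale_zero_left)
      then show ?case using seq.subspace_0[OF assms(1)] seq.linear_0[OF g(1)] by metis
    next
      case (step c x y)
      then have xV: "x \<in> V" "y \<in> V" using B by auto
      then have "scale c x \<in> V" using seq.subspace_scale[OF assms(1)] by blast
      then have "scale c x + y \<in> V" using seq.subspace_add[OF assms(1)] xV by blast
      moreover have "g (scale c x + y) = f (scale c x + y)"
        using step xV g(2) assms(2) seq.linear_add[OF g(1)] seq.linear_scale[OF g(1)]
          \<open>scale c x \<in> V\<close> unfolding linear_map_def by metis
      ultimately show ?case by (simp add: plus_fun_def)
    qed
    then show ?thesis by blast
  qed
  with g that show thesis by blast
qed

lemma linear_map_0: "seq.subspace V \<Longrightarrow> linear_map V W f \<Longrightarrow> f 0 = 0"
  using linear_map_extend seq.linear_0 seq.subspace_0 by metis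

lemma linear_map_image:
  assumes "seq.subspace V" "linear_map V W f" "seq.subspace U" "U \<subseteq> V"
  shows "seq.subspace (f ` U)"
proof -
  obtain g where "Vector_Spaces.linear scale scale g" "\<And>x. x \<in> V \<Longrightarrow> g x = f x"
    using linear_map_extend assms by blast
  moreover then have "f ` U = g ` U" using assms by force
  ultimately show ?thesis using seq.linear_subspace_image assms by metis
qed

lemma linear_map_fd_image:
  assumes "fd_space V" "linear_map V W f"
  shows "fd_space (f ` V)"
proof -
  obtain g where g: "Vector_Spaces.linear scale scale g" "\<And>x. x \<in> V \<Longrightarrow> g x = f x"
    using linear_map_extend fd_subspace assms by blast
  obtain B where B: "finite B" "V = seq.span B" using assms(1) unfolding fd_space_def by blast
  have "f ` V = g ` V" using g by force
  also have "\<dots> = seq.span (g ` B)" using seq.linear_span_image[OF g(1)] B by auto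
  finally show ?thesis unfolding fd_space_def using B by blast
qed

lemma linear_map_inj_dim:
  assumes "fd_space V" "linear_map V W f" "inj_on f V"
  shows "seq.dim (f ` V) = seq.dim V"
proof -
  obtain g where g: "Vector_Spaces.linear scale scale g" "\<And>x. x \<in> V \<Longrightarrow> g x = f x"
    using linear_map_extend fd_subspace assms by blast
  obtain C where C: "seq.independent C" "seq.span C = V"
    using fd_basis[OF assms(1) fd_subspace[OF assms(1)] order.refl] by metis
  have eq: "f ` V = g ` V" and inj: "inj_on g V"
    using g(2) assms(3) by (auto simp: inj_on_def)
  have ind: "seq.independent (g ` C)"
    using seq.linear_independent_injective_image[OF g(1) C(1)] inj C(2) by simp
  have "seq.dim (f ` V) = card (g ` C)"
    using seq.dim_span_eq_card_independent[OF ind] seq.linear_span_image[OF g(1)] eq C(2) by metis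
  also have "\<dots> = card C"
    using inj C(2) seq.span_superset[of C] by (intro card_image inj_on_subset[OF inj]) auto
  also have "\<dots> = seq.dim V"
    using seq.dim_span_eq_card_independent[OF C(1)] C(2) by simp
  finally show ?thesis .
qed

text \<open>A linear section \<open>h\<close> of \<open>f\<close> is injective, hence onto
  \<open>V\<close> by dimension, so that \<open>h\<close> is a two-sided inverse on
  \<open>V\<close>.\<close>

lemma surj_endo_inj:
  assumes V: "fd_space V" and f: "linear_map V V f" and surj: "f ` V = V"
  shows "inj_on f V"
proof -
  have sV: "seq.subspace V" using V fd_subspace by blast
  obtain g where g: "Vector_Spaces.linear scale scale g" "\<And>x. x \<in> V \<Longrightarrow> g x = f x"
    using linear_map_extend sV f by blast
  obtain h where h: "range h \<subseteq> V" "Vector_Spaces.linear scale scale h" "\<forall>v\<in>g ` V. g (h v) = v"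
    using seq.linear_exists_right_inverse_on[OF g(1) sV] by blast
  have gV: "g ` V = V" using g(2) surj by force
  have gh: "f (h v) = v" if "v \<in> V" for v
    using h gV g(2)[of "h v"] that by (metis rangeI subsetD)
  have inj: "inj_on h V" by (metis gh inj_onI)
  have hm: "linear_map V V h"
    unfolding linear_map_def using h seq.linear_add[OF h(2)] seq.linear_scale[OF h(2)] by auto
  have "h ` V = V"
    using fd_dim_mono(2)[OF V linear_map_image[OF sV hm sV order.refl]] linear_map_inj_dim[OF V hm inj] h(1)
    by blast
  then show ?thesis using gh by (metis (no_types, lifting) image_iff inj_onI)
qed

lemma subspace_projector:
  assumes "seq.subspace S"
  obtains r where "Vector_Spaces.linear scale scale r" "\<And>x. r x \<in> S" "\<And>x. x \<in> S \<Longrightarrow> r x = x"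
proof -
  have "Vector_Spaces.linear scale scale (\<lambda>x :: nat \<Rightarrow> 'a. x)" by (intro linear_scaleI) auto
  from seq.linear_exists_left_inverse_on[OF this assms] obtain r where
    "range r \<subseteq> S" "Vector_Spaces.linear scale scale r" "\<forall>v\<in>S. r v = v" by auto
  then show thesis using that by blast
qed

lemma linear_map_linear: "Vector_Spaces.linear scale scale g \<Longrightarrow> (\<And>x. x \<in> V \<Longrightarrow> g x \<in> W) \<Longrightarrow> linear_map V W g"
  unfolding linear_map_def by (auto simp: seq.linear_add seq.linear_scale)

lemma linear_map_comp: "linear_map U V f \<Longrightarrow> linear_map V W g \<Longrightarrow> linear_map U W (\<lambda>x. g (f x))"
  unfolding linear_map_def by auto

subsection \<open>Interleaving\<close>

definition deint0 :: "(nat \<Rightarrow> 'k) \<Rightarrow> nat \<Rightarrow> 'k" where "deint0 z = (\<lambda>i. z (2 * i))"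
definition deint1 :: "(nat \<Rightarrow> 'k) \<Rightarrow> nat \<Rightarrow> 'k" where "deint1 z = (\<lambda>i. z (2 * i + 1))"

lemma deint_interleave [simp]: "deint0 (interleave x y) = x" "deint1 (interleave x y) = y"
  by (auto simp: deint0_def deint1_def interleave_def fun_eq_iff)

lemma interleave_deint [simp]: "interleave (deint0 z) (deint1 z) = z"
  by (auto simp: deint0_def deint1_def interleave_def fun_eq_iff)

lemma interleave_eq_iff [simp]: "interleave x y = interleave x' y' \<longleftrightarrow> x = x' \<and> y = y'"
  by (metis deint_interleave)

lemma interleave_add: "interleave x y + interleave x' y' = interleave (x + x') (y + y')"
  by (auto simp: interleave_def fun_eq_iff)

lemma interleave_scale: "scale c (interleave x y) = interleave (scale c x) (scale c y)"
  by (auto simp: interleave_def scale_def fun_eq_iff)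

lemma interleave_zero [simp]: "interleave 0 0 = 0"
  by (auto simp: interleave_def fun_eq_iff)

lemma deint_linear [simp]: "deint0 (x + y) = deint0 x + deint0 y" "deint1 (x + y) = deint1 x + deint1 y"
  "deint0 (scale c x) = scale c (deint0 x)" "deint1 (scale c x) = scale c (deint1 x)"
  "deint0 0 = 0" "deint1 0 = 0"
  by (auto simp: deint0_def deint1_def scale_def fun_eq_iff)

lemma dsum_space: "space (dsum M N) x = {z. deint0 z \<in> space M x \<and> deint1 z \<in> space N x}"
  unfolding dsum_def by (auto intro: interleave_deint[symmetric])

lemma dsum_act: "act (dsum M N) a z = interleave (act M a (deint0 z)) (act N a (deint1 z))"
  unfolding dsum_def by (simp add: deint0_def deint1_def)

lemma interleave_mem_dsum [simp]:
  "interleave m n \<in> space (dsum M N) x \<longleftrightarrow> m \<in> space M x \<and> n \<in> space N x"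
  by (simp add: dsum_space)

lemma fd_interleave:
  assumes "fd_space V" "fd_space W"
  shows "fd_space {z. deint0 z \<in> V \<and> deint1 z \<in> W}"
proof -
  obtain B where B: "finite B" "V = seq.span B" using assms(1) unfolding fd_space_def by blast
  obtain C where C: "finite C" "W = seq.span C" using assms(2) unfolding fd_space_def by blast
  have l0: "Vector_Spaces.linear scale scale (\<lambda>x. interleave x 0)"
    by (intro linear_scaleI) (auto simp: interleave_add interleave_scale)
  have l1: "Vector_Spaces.linear scale scale (\<lambda>x. interleave 0 x)"
    by (intro linear_scaleI) (auto simp: interleave_add interleave_scale)
  let ?D = "(\<lambda>x. interleave x 0) ` B \<union> (\<lambda>x. interleave 0 x) ` C"
  have "seq.span ?D = {x + y |x y. x \<in> (\<lambda>x. interleave x 0) ` V \<and> y \<in> (\<lambda>x. interleave 0 x) ` W}"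
    unfolding seq.span_Un seq.linear_span_image[OF l0] seq.linear_span_image[OF l1] B C by simp
  also have "\<dots> = {z. deint0 z \<in> V \<and> deint1 z \<in> W}"
  proof (safe, goal_cases)
    case (3 z)
    have "z = interleave (deint0 z) 0 + interleave 0 (deint1 z)" by (simp add: interleave_add)
    with 3 show ?case by blast
  qed (auto simp: interleave_add)
  finally show ?thesis unfolding fd_space_def using B C by (metis finite_UnI finite_imageI)
qed

section \<open>The category of representations\<close>

definition normalize_map ::
  "('v, 'e) pre_digraph \<Rightarrow> ('v, 'e, 'k::field) rep \<Rightarrow> ('v \<Rightarrow> (nat \<Rightarrow> 'k) \<Rightarrow> nat \<Rightarrow> 'k) \<Rightarrow>
   'v \<Rightarrow> (nat \<Rightarrow> 'k) \<Rightarrow> nat \<Rightarrow> 'k" where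
  "normalize_map Q M f = (\<lambda>x m. if x \<in> verts Q \<and> m \<in> space M x then f x m else 0)"

text \<open>Vanishing outside the domain makes equality of homomorphisms literal equality.\<close>

definition mod_hom ::
  "('v, 'e) pre_digraph \<Rightarrow> (('v, 'e) path \<Rightarrow> 'k::field) set \<Rightarrow> ('v, 'e, 'k) rep \<Rightarrow>
   ('v, 'e, 'k) rep \<Rightarrow> ('v \<Rightarrow> (nat \<Rightarrow> 'k) \<Rightarrow> nat \<Rightarrow> 'k) set" where
  "mod_hom Q I M N = {f. M \<in> mod_of Q I \<and> N \<in> mod_of Q I \<and> rep_hom Q M N f \<and>
     (\<forall>x m. x \<notin> verts Q \<or> m \<notin> space M x \<longrightarrow> f x m = 0)}"

definition mod_cmp ::
  "('v \<Rightarrow> (nat \<Rightarrow> 'k) \<Rightarrow> nat \<Rightarrow> 'k) \<Rightarrow> ('v \<Rightarrow> (nat \<Rightarrow> 'k) \<Rightarrow> nat \<Rightarrow> 'k) \<Rightarrow>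
   'v \<Rightarrow> (nat \<Rightarrow> 'k) \<Rightarrow> nat \<Rightarrow> 'k" where
  "mod_cmp f g = (\<lambda>x m. f x (g x m))"

definition mod_id ::
  "('v, 'e) pre_digraph \<Rightarrow> ('v, 'e, 'k::field) rep \<Rightarrow> 'v \<Rightarrow> (nat \<Rightarrow> 'k) \<Rightarrow> nat \<Rightarrow> 'k" where
  "mod_id Q M = normalize_map Q M (\<lambda>x m. m)"

definition total_dim :: "('v, 'e) pre_digraph \<Rightarrow> ('v, 'e, 'k::field) rep \<Rightarrow> nat" where
  "total_dim Q M = (\<Sum>x\<in>verts Q. seq.dim (space M x))"

definition sub_rep :: "('v, 'e, 'k::field) rep \<Rightarrow> ('v \<Rightarrow> (nat \<Rightarrow> 'k) set) \<Rightarrow> ('v, 'e, 'k) rep" where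
  "sub_rep M U = \<lparr>space = U, act = act M\<rparr>"

lemma sub_rep_simps [simp]: "space (sub_rep M U) = U" "act (sub_rep M U) = act M"
  by (simp_all add: sub_rep_def)

lemma kernel_rep_simps [simp]:
  "space (kernel_rep M f) x = {m \<in> space M x. f x m = 0}" "act (kernel_rep M f) = act M"
  by (simp_all add: kernel_rep_def)

lemma kernel_rep_sub: "kernel_rep M f = sub_rep M (space (kernel_rep M f))"
  by (simp add: kernel_rep_def)

context fin_digraph
begin

lemma mod_subspace: "M \<in> mod_of G I \<Longrightarrow> x \<in> verts G \<Longrightarrow> seq.subspace (space M x)"
  unfolding mod_of_def using fd_subspace by blast

lemma mod_fd: "M \<in> mod_of G I \<Longrightarrow> x \<in> verts G \<Longrightarrow> fd_space (space M x)"
  unfolding mod_of_def by blast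

lemma mod_0 [simp]: "M \<in> mod_of G I \<Longrightarrow> x \<in> verts G \<Longrightarrow> 0 \<in> space M x"
  using mod_subspace seq.subspace_0 by blast

lemma mod_act: "M \<in> mod_of G I \<Longrightarrow> a \<in> arcs G \<Longrightarrow> linear_map (space M (tail G a)) (space M (head G a)) (act M a)"
  unfolding mod_of_def by blast

lemma mod_act_mem: "M \<in> mod_of G I \<Longrightarrow> a \<in> arcs G \<Longrightarrow> m \<in> space M (tail G a) \<Longrightarrow> act M a m \<in> space M (head G a)"
  using mod_act[of M I a] unfolding linear_map_def by blast

lemma mod_act_0: "M \<in> mod_of G I \<Longrightarrow> a \<in> arcs G \<Longrightarrow> act M a 0 = 0"
  using mod_act mod_subspace linear_map_0 wellformed(1) by meson

lemma sub_rep_mod: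
  assumes "M \<in> mod_of G I" "subrep G M U"
  shows "sub_rep M U \<in> mod_of G I"
  unfolding mod_of_def mem_Collect_eq sub_rep_simps
proof (intro conjI ballI)
  fix x assume "x \<in> verts G"
  then show "fd_space (U x)" using assms fd_subset mod_fd unfolding subrep_def by meson
next
  fix a assume a: "a \<in> arcs G"
  have "U (tail G a) \<subseteq> space M (tail G a)" using assms(2) a unfolding subrep_def by auto
  then show "linear_map (U (tail G a)) (U (head G a)) (act M a)"
    using mod_act[OF assms(1) a] assms(2) a unfolding linear_map_def subrep_def by blast
next
  fix \<rho> u v x assume "\<rho> \<in> I" "u \<in> verts G" "v \<in> verts G" "x \<in> U u"
  then show "(\<Sum>p | \<rho> (u, p, v) \<noteq> 0. scale (\<rho> (u, p, v)) (fold (act M) p x)) = 0"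
    using assms unfolding mod_of_def subrep_def by blast
qed

lemma rep_hom_0:
  assumes "M \<in> mod_of G I" "rep_hom G M N f" "x \<in> verts G" shows "f x 0 = 0"
  using assms linear_map_0[OF mod_subspace[OF assms(1,3)]] unfolding rep_hom_def by blast

lemma rep_hom_mem: "rep_hom G M N f \<Longrightarrow> x \<in> verts G \<Longrightarrow> m \<in> space M x \<Longrightarrow> f x m \<in> space N x"
  unfolding rep_hom_def linear_map_def by blast

lemma rep_hom_linear: "rep_hom G M N f \<Longrightarrow> x \<in> verts G \<Longrightarrow> linear_map (space M x) (space N x) (f x)"
  unfolding rep_hom_def by blast

lemma rep_hom_act:
  "rep_hom G M N f \<Longrightarrow> a \<in> arcs G \<Longrightarrow> m \<in> space M (tail G a) \<Longrightarrow>
   f (head G a) (act M a m) = act N a (f (tail G a) m)"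
  unfolding rep_hom_def by blast

lemma linear_map_diff_eq:
  assumes "seq.subspace V" "linear_map V W f" "x \<in> V" "y \<in> V"
  shows "f (x - y) = f x - f y"
proof -
  have "x - y \<in> V" using assms seq.subspace_diff by blast
  then have "f (x - y + y) = f (x - y) + f y" using assms unfolding linear_map_def by blast
  then show ?thesis by (simp add: algebra_simps)
qed

lemma rep_hom_diff_eq:
  "M \<in> mod_of G I \<Longrightarrow> rep_hom G M N f \<Longrightarrow> x \<in> verts G \<Longrightarrow> m \<in> space M x \<Longrightarrow> m' \<in> space M x \<Longrightarrow>
   f x (m - m') = f x m - f x m'"
  using linear_map_diff_eq mod_subspace rep_hom_linear by metis

lemma rep_hom_comp:
  "rep_hom G L M f \<Longrightarrow> rep_hom G M N g \<Longrightarrow> rep_hom G L N (\<lambda>x m. g x (f x m))"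
  unfolding rep_hom_def linear_map_def by (auto simp: wellformed)

lemma rep_hom_diff:
  assumes "M \<in> mod_of G I" "N \<in> mod_of G I" "rep_hom G M N f" "rep_hom G M N g"
  shows "rep_hom G M N (\<lambda>x m. f x m - g x m)"
  unfolding rep_hom_def
proof (intro conjI ballI)
  fix x assume x: "x \<in> verts G"
  show "linear_map (space M x) (space N x) (\<lambda>m. f x m - g x m)"
    using mod_subspace[OF assms(2) x] rep_hom_linear[OF assms(3) x] rep_hom_linear[OF assms(4) x]
    unfolding linear_map_def by (auto intro: seq.subspace_diff simp: seq.scale_right_diff_distrib)
next
  fix a m assume a: "a \<in> arcs G" and m: "m \<in> space M (tail G a)"
  then have t: "tail G a \<in> verts G" by simp
  show "f (head G a) (act M a m) - g (head G a) (act M a m) = act N a (f (tail G a) m - g (tail G a) m)"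
    using linear_map_diff_eq[OF mod_subspace[OF assms(2) t] mod_act[OF assms(2) a]]
      rep_hom_mem[OF assms(3) t m] rep_hom_mem[OF assms(4) t m]
      rep_hom_act[OF assms(3) a m] rep_hom_act[OF assms(4) a m] by simp
qed

lemma normalize_hom:
  assumes "M \<in> mod_of G I" "N \<in> mod_of G I" "rep_hom G M N f"
  shows "normalize_map G M f \<in> mod_hom G I M N"
proof -
  have "rep_hom G M N (normalize_map G M f)"
    unfolding rep_hom_def
  proof (intro conjI ballI)
    fix x assume x: "x \<in> verts G"
    show "linear_map (space M x) (space N x) (normalize_map G M f x)"
      using rep_hom_linear[OF assms(3) x] mod_subspace[OF assms(1) x] x
      unfolding linear_map_def normalize_map_def by (auto simp: seq.subspace_add seq.subspace_scale)
  next
    fix a m assume a: "a \<in> arcs G" and m: "m \<in> space M (tail G a)"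
    show "normalize_map G M f (head G a) (act M a m) = act N a (normalize_map G M f (tail G a) m)"
      using a m mod_act_mem[OF assms(1) a m] rep_hom_act[OF assms(3) a m]
      unfolding normalize_map_def by simp
  qed
  then show ?thesis using assms unfolding mod_hom_def normalize_map_def by auto
qed

lemma normalize_map_simp [simp]: "x \<in> verts G \<Longrightarrow> m \<in> space M x \<Longrightarrow> normalize_map G M f x m = f x m"
  by (simp add: normalize_map_def)

lemma mod_hom_rep_hom: "f \<in> mod_hom G I M N \<Longrightarrow> rep_hom G M N f"
  unfolding mod_hom_def by blast

lemma mod_hom_mod: "f \<in> mod_hom G I M N \<Longrightarrow> M \<in> mod_of G I \<and> N \<in> mod_of G I"
  unfolding mod_hom_def by blast

lemma mod_hom_eqI:
  assumes "f \<in> mod_hom G I M N" "g \<in> mod_hom G I M N'"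
    and "\<And>x m. x \<in> verts G \<Longrightarrow> m \<in> space M x \<Longrightarrow> f x m = g x m"
  shows "f = g"
proof (rule ext, rule ext)
  fix x m
  show "f x m = g x m"
    using assms unfolding mod_hom_def by (cases "x \<in> verts G \<and> m \<in> space M x") auto
qed

lemma rep_hom_id: "rep_hom G M M (\<lambda>x m. m)"
  unfolding rep_hom_def linear_map_def by auto

lemma rep_hom_zero:
  assumes "M \<in> mod_of G I" "N \<in> mod_of G I" shows "rep_hom G M N (\<lambda>x m. 0)"
  unfolding rep_hom_def linear_map_def using assms mod_act_0 by auto

lemma mod_id_hom: "M \<in> mod_of G I \<Longrightarrow> mod_id G M \<in> mod_hom G I M M"
  unfolding mod_id_def using normalize_hom rep_hom_id by blast

lemma mod_id_simp [simp]: "x \<in> verts G \<Longrightarrow> m \<in> space M x \<Longrightarrow> mod_id G M x m = m"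
  unfolding mod_id_def by simp

lemma mod_cmp_hom:
  assumes "f \<in> mod_hom G I M N" "g \<in> mod_hom G I L M"
  shows "mod_cmp f g \<in> mod_hom G I L N"
proof -
  have "f x 0 = 0" for x
    using assms(1) mod_0[of M I x] rep_hom_0[of M I N f x] unfolding mod_hom_def by (cases "x \<in> verts G") auto
  then show ?thesis
    using assms rep_hom_comp[of L M g N f] unfolding mod_hom_def mod_cmp_def by auto
qed

lemma mod_hom_diff:
  assumes "f \<in> mod_hom G I M N" "g \<in> mod_hom G I M N"
  shows "f - g \<in> mod_hom G I M N"
  using assms rep_hom_diff[of M I N f g] unfolding mod_hom_def by (auto simp: fun_diff_def)

lemma additive_category_mod:
  "additive_category (mod_of G I) (mod_hom G I) mod_cmp (mod_id G)"
proof (unfold_locales, goal_cases)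
  case (5 f L M)
  have "M \<in> mod_of G I" using mod_hom_mod[OF 5] by blast
  from mod_hom_eqI[OF mod_cmp_hom[OF mod_id_hom[OF this] 5] 5] show ?case
    using rep_hom_mem[OF mod_hom_rep_hom[OF 5]] by (simp add: mod_cmp_def)
next
  case (6 f L M)
  have "L \<in> mod_of G I" using mod_hom_mod[OF 6] by blast
  from mod_hom_eqI[OF mod_cmp_hom[OF 6 mod_id_hom[OF this]] 6] show ?case
    by (simp add: mod_cmp_def)
next
  case (7 M N)
  then show ?case using rep_hom_zero[OF 7] unfolding mod_hom_def by (auto simp: zero_fun_def)
next
  case (10 h M N f L g)
  show ?case
  proof (intro ext)
    fix x m i
    show "mod_cmp h (f + g) x m i = (mod_cmp h f + mod_cmp h g) x m i"
    proof (cases "x \<in> verts G \<and> m \<in> space L x")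
      case True
      then have "f x m \<in> space M x" "g x m \<in> space M x"
        using 10 mod_hom_rep_hom rep_hom_mem by metis+
      then have "h x (f x m + g x m) = h x (f x m) + h x (g x m)"
        using rep_hom_linear[OF mod_hom_rep_hom[OF 10(1)]] True unfolding linear_map_def by blast
      then show ?thesis unfolding mod_cmp_def by simp
    next
      case False
      have "h x 0 = 0"
        using 10(1) mod_0[of M I x] rep_hom_0[of M I N h x] unfolding mod_hom_def by (cases "x \<in> verts G") auto
      moreover have "f x m = 0" "g x m = 0" using 10 False unfolding mod_hom_def by auto
      ultimately show ?thesis unfolding mod_cmp_def by simp
    qed
  qed
qed (auto simp: mod_hom_mod mod_id_hom mod_cmp_hom mod_hom_diff, auto simp: mod_cmp_def fun_eq_iff)

end

sublocale fin_digraph \<subseteq> additive: additive_category "mod_of G I" "mod_hom G I" mod_cmp "mod_id G" for I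
  by (rule additive_category_mod)

context fin_digraph
begin

section \<open>Kernels, images, direct sums and isomorphisms of representations\<close>

lemma subrep_kernel:
  assumes "M \<in> mod_of G I" "rep_hom G M N f" "N \<in> mod_of G I"
  shows "subrep G M (space (kernel_rep M f))"
  unfolding subrep_def
proof (intro conjI ballI)
  fix x assume x: "x \<in> verts G"
  show "seq.subspace (space (kernel_rep M f) x)"
    using mod_subspace[OF assms(1) x] rep_hom_linear[OF assms(2) x] rep_hom_0[OF assms(1,2) x]
    unfolding linear_map_def
    by (intro seq.subspaceI) (auto simp: seq.subspace_add seq.subspace_scale seq.subspace_0)
next
  fix a m assume a: "a \<in> arcs G" and m: "m \<in> space (kernel_rep M f) (tail G a)"
  show "act M a m \<in> space (kernel_rep M f) (head G a)"
    using m mod_act_mem[OF assms(1) a] rep_hom_act[OF assms(2) a] mod_act_0[OF assms(3) a] by auto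
qed auto

lemma subrep_image:
  assumes "M \<in> mod_of G I" "rep_hom G M N f" "subrep G M U"
  shows "subrep G N (\<lambda>x. f x ` U x)"
  unfolding subrep_def
proof (intro conjI ballI)
  fix x assume x: "x \<in> verts G"
  show "seq.subspace (f x ` U x)"
    using linear_map_image[OF mod_subspace[OF assms(1) x] rep_hom_linear[OF assms(2) x]] assms(3) x
    unfolding subrep_def by blast
  show "f x ` U x \<subseteq> space N x" using rep_hom_mem[OF assms(2) x] assms(3) x unfolding subrep_def by blast
next
  fix a m assume a: "a \<in> arcs G" and "m \<in> f (tail G a) ` U (tail G a)"
  then obtain u where u: "u \<in> U (tail G a)" "m = f (tail G a) u" by blast
  then have "u \<in> space M (tail G a)" using assms(3) a unfolding subrep_def by auto
  then have "act N a m = f (head G a) (act M a u)" using rep_hom_act[OF assms(2) a] u by simp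
  then show "act N a m \<in> f (head G a) ` U (head G a)" using assms(3) a u unfolding subrep_def by auto
qed

lemma subrep_UNIV: "M \<in> mod_of G I \<Longrightarrow> subrep G M (space M)"
  unfolding subrep_def using mod_subspace mod_act_mem by blast

lemma kernel_mod:
  "M \<in> mod_of G I \<Longrightarrow> N \<in> mod_of G I \<Longrightarrow> rep_hom G M N f \<Longrightarrow> kernel_rep M f \<in> mod_of G I"
  using sub_rep_mod subrep_kernel kernel_rep_sub by metis

lemma rep_hom_inclusion: "rep_hom G (sub_rep M U) M (\<lambda>x m. m)"
  if "M \<in> mod_of G I" "subrep G M U"
  using that unfolding rep_hom_def linear_map_def subrep_def by auto

lemma rep_hom_restrict_sub:
  assumes "rep_hom G M N f" "subrep G M U" shows "rep_hom G (sub_rep M U) N f"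
proof -
  have U: "m \<in> space M x" if "x \<in> verts G" "m \<in> U x" for x m
    using assms(2) that unfolding subrep_def by blast
  show ?thesis using assms(1) U unfolding rep_hom_def linear_map_def by simp
qed

lemma rep_hom_into_sub:
  assumes "rep_hom G M N f" "\<And>x m. x \<in> verts G \<Longrightarrow> m \<in> space M x \<Longrightarrow> f x m \<in> U x"
  shows "rep_hom G M (sub_rep N U) f"
  using assms unfolding rep_hom_def linear_map_def by auto

lemma fold_dsum_act:
  "fold (act (dsum M N)) p (interleave m n) = interleave (fold (act M) p m) (fold (act N) p n)"
  by (induction p arbitrary: m n) (auto simp: dsum_act)

lemma dsum_mod:
  assumes "M \<in> mod_of G I" "N \<in> mod_of G I"
  shows "dsum M N \<in> mod_of G I"
  unfolding mod_of_def mem_Collect_eq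
proof (intro conjI ballI)
  fix x assume "x \<in> verts G"
  then show "fd_space (space (dsum M N) x)"
    using fd_interleave[of "space M x" "space N x"] assms mod_fd unfolding dsum_space by blast
next
  fix a assume a: "a \<in> arcs G"
  show "linear_map (space (dsum M N) (tail G a)) (space (dsum M N) (head G a)) (act (dsum M N) a)"
    using mod_act[OF assms(1) a] mod_act[OF assms(2) a]
    unfolding linear_map_def dsum_act by (auto simp: dsum_space interleave_add interleave_scale)
next
  fix \<rho> u v z assume r: "\<rho> \<in> I" "u \<in> verts G" "v \<in> verts G" and z: "z \<in> space (dsum M N) u"
  have *: "(\<Sum>p\<in>S. scale (c p) (fold (act (dsum M N)) p z)) =
    interleave (\<Sum>p\<in>S. scale (c p) (fold (act M) p (deint0 z)))
      (\<Sum>p\<in>S. scale (c p) (fold (act N) p (deint1 z)))" for S c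
    using fold_dsum_act[of M N _ "deint0 z" "deint1 z"]
    by (induction S rule: infinite_finite_induct) (simp_all add: interleave_scale interleave_add)
  show "(\<Sum>p | \<rho> (u, p, v) \<noteq> 0. scale (\<rho> (u, p, v)) (fold (act (dsum M N)) p z)) = 0"
    unfolding * using assms r z unfolding mod_of_def dsum_space by auto
qed

lemma rep_hom_deint:
  assumes "M \<in> mod_of G I" "N \<in> mod_of G I"
  shows "rep_hom G (dsum M N) M (\<lambda>x. deint0)" "rep_hom G (dsum M N) N (\<lambda>x. deint1)"
  using assms unfolding rep_hom_def linear_map_def by (auto simp: dsum_space dsum_act)

lemma rep_hom_inj:
  assumes "M \<in> mod_of G I" "N \<in> mod_of G I"
  shows "rep_hom G M (dsum M N) (\<lambda>x m. interleave m 0)" "rep_hom G N (dsum M N) (\<lambda>x n. interleave 0 n)"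
  using assms mod_act_0[OF assms(1)] mod_act_0[OF assms(2)] unfolding rep_hom_def linear_map_def
  by (auto simp: dsum_space dsum_act interleave_add interleave_scale)

lemma decomp_dsum:
  assumes M: "M \<in> mod_of G I" and N: "N \<in> mod_of G I"
  shows "additive.decomp I (dsum M N) M N"
proof -
  let ?i = "normalize_map G M (\<lambda>x m. interleave m 0)" and ?j = "normalize_map G N (\<lambda>x m. interleave 0 m)"
  let ?p = "normalize_map G (dsum M N) (\<lambda>x. deint0)" and ?q = "normalize_map G (dsum M N) (\<lambda>x. deint1)"
  note D = dsum_mod[OF M N]
  note H = normalize_hom[OF M D rep_hom_inj(1)[OF M N]] normalize_hom[OF D M rep_hom_deint(1)[OF M N]]
    normalize_hom[OF N D rep_hom_inj(2)[OF M N]] normalize_hom[OF D N rep_hom_deint(2)[OF M N]]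
  have "additive.biproduct I (dsum M N) M N ?i ?p ?j ?q"
    unfolding additive.biproduct_def using H M N
    by (auto simp: mod_cmp_def normalize_map_def mod_id_def dsum_space fun_eq_iff interleave_add
      simp flip: plus_fun_apply) (auto simp: fun_eq_iff interleave_def deint0_def deint1_def)
  then show ?thesis unfolding additive.decomp_def by blast
qed

lemma bij_inverse_pair:
  assumes "M \<in> mod_of G I" "N \<in> mod_of G I" "rep_hom G M N f"
    and bij: "\<And>x. x \<in> verts G \<Longrightarrow> bij_betw (f x) (space M x) (space N x)"
  shows "\<exists>g. additive.inverse_pair I M N (normalize_map G M f) g"
proof -
  define g where "g = (\<lambda>x. inv_into (space M x) (f x))"
  have g: "g x n \<in> space M x" "f x (g x n) = n" if "x \<in> verts G" "n \<in> space N x" for x n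
    using bij[OF that(1)] that(2) unfolding g_def by (auto simp: bij_betw_def inv_into_into f_inv_into_f)
  have gf: "g x (f x m) = m" if "x \<in> verts G" "m \<in> space M x" for x m
    using bij[OF that(1)] that(2) unfolding g_def by (auto simp: bij_betw_def)
  have inj: "m = m'" if "x \<in> verts G" "m \<in> space M x" "m' \<in> space M x" "f x m = f x m'" for x m m'
    using arg_cong[OF that(4), of "g x"] unfolding gf[OF that(1,2)] gf[OF that(1,3)] .
  have "rep_hom G N M g"
    unfolding rep_hom_def
  proof (intro conjI ballI)
    fix x assume x: "x \<in> verts G"
    note lin = rep_hom_linear[OF assms(3) x, unfolded linear_map_def]
    note sM = mod_subspace[OF assms(1) x] and sN = mod_subspace[OF assms(2) x]
    have "g x (m + n) = g x m + g x n" if mn: "m \<in> space N x" "n \<in> space N x" for m n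
    proof (rule inj[OF x])
      have s: "m + n \<in> space N x" using mn sN seq.subspace_add by blast
      show "g x (m + n) \<in> space M x" using g(1)[OF x s] .
      show "g x m + g x n \<in> space M x" using g(1)[OF x] mn sM seq.subspace_add by blast
      have "f x (g x m + g x n) = f x (g x m) + f x (g x n)" using lin g(1)[OF x] mn by blast
      then show "f x (g x (m + n)) = f x (g x m + g x n)"
        using g(2)[OF x s] g(2)[OF x mn(1)] g(2)[OF x mn(2)] by simp
    qed
    moreover have "g x (scale c n) = scale c (g x n)" if n: "n \<in> space N x" for n c
    proof (rule inj[OF x])
      have s: "scale c n \<in> space N x" using n sN seq.subspace_scale by blast
      show "g x (scale c n) \<in> space M x" using g(1)[OF x s] .
      show "scale c (g x n) \<in> space M x" using g(1)[OF x n] sM seq.subspace_scale by blast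
      have "f x (scale c (g x n)) = scale c (f x (g x n))" using lin g(1)[OF x n] by blast
      then show "f x (g x (scale c n)) = f x (scale c (g x n))"
        using g(2)[OF x s] g(2)[OF x n] by simp
    qed
    ultimately show "linear_map (space N x) (space M x) (g x)"
      unfolding linear_map_def using g x by blast
  next
    fix a n assume a: "a \<in> arcs G" and n: "n \<in> space N (tail G a)"
    then have v: "tail G a \<in> verts G" "head G a \<in> verts G" by auto
    show "g (head G a) (act N a n) = act M a (g (tail G a) n)"
    proof (rule inj[OF v(2)])
      note s = mod_act_mem[OF assms(2) a n]
      show "g (head G a) (act N a n) \<in> space M (head G a)" using g(1)[OF v(2) s] .
      show "act M a (g (tail G a) n) \<in> space M (head G a)"
        using mod_act_mem[OF assms(1) a g(1)[OF v(1) n]] .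
      show "f (head G a) (g (head G a) (act N a n)) = f (head G a) (act M a (g (tail G a) n))"
        using g(2)[OF v(2) s] rep_hom_act[OF assms(3) a g(1)[OF v(1) n]] g(2)[OF v(1) n] by simp
    qed
  qed
  note H = normalize_hom[OF assms(1-3)] normalize_hom[OF assms(2,1) this]
  have "additive.inverse_pair I M N (normalize_map G M f) (normalize_map G N g)"
    unfolding additive.inverse_pair_def
    using H g gf rep_hom_mem[OF assms(3)] rep_hom_0[OF assms(1,3)] rep_hom_0[OF assms(2) \<open>rep_hom G N M g\<close>]
    by (auto simp: mod_cmp_def normalize_map_def mod_id_def fun_eq_iff)
  then show ?thesis by blast
qed

lemma isom_imp_bij:
  assumes "additive.isom I M N"
  shows "\<exists>f. rep_hom G M N f \<and> (\<forall>x\<in>verts G. bij_betw (f x) (space M x) (space N x))"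
proof -
  obtain f g where f: "f \<in> mod_hom G I M N" "g \<in> mod_hom G I N M"
    "mod_cmp g f = mod_id G M" "mod_cmp f g = mod_id G N"
    using assms unfolding additive.isom_def additive.inverse_pair_def by blast
  have "bij_betw (f x) (space M x) (space N x)" if x: "x \<in> verts G" for x
  proof (rule bij_betw_byWitness[where f' = "g x"])
    show "\<forall>m\<in>space M x. g x (f x m) = m" "\<forall>m\<in>space N x. f x (g x m) = m"
      using fun_cong[OF fun_cong[OF f(3), of x]] fun_cong[OF fun_cong[OF f(4), of x]] x
      by (auto simp: mod_cmp_def mod_id_def normalize_map_def split: if_splits)
    show "f x ` space M x \<subseteq> space N x" "g x ` space N x \<subseteq> space M x"
      using rep_hom_mem mod_hom_rep_hom f x by blast+
  qed
  then show ?thesis using mod_hom_rep_hom[OF f(1)] by blast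
qed

lemma isom_iff: "additive.isom I M N \<longleftrightarrow> M \<in> mod_of G I \<and> N \<in> mod_of G I \<and> rep_iso G M N"
proof -
  have "rep_iso G M N \<longleftrightarrow> (\<exists>f. rep_hom G M N f \<and> (\<forall>x\<in>verts G. bij_betw (f x) (space M x) (space N x)))"
    unfolding rep_iso_def rep_mono_def rep_epi_def bij_betw_def by blast
  moreover have "additive.isom I M N"
    if "M \<in> mod_of G I" "N \<in> mod_of G I" "rep_hom G M N f" "\<forall>x\<in>verts G. bij_betw (f x) (space M x) (space N x)" for f
    using bij_inverse_pair[of M I N f] that unfolding additive.isom_def by blast
  ultimately show ?thesis using isom_imp_bij[of I M N] additive.isom_Ob[of I M N] by blast
qed

text \<open>Together with \<open>isom_iff\<close> this carries the abstract Krull-Schmidt results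
  over to the conditions phrased with \<open>rep_iso\<close> and \<open>dsum\<close>, in particular
  to the relations of \<open>K0\<close>.\<close>

lemma decomp_iff:
  "additive.decomp I M A B \<longleftrightarrow>
     M \<in> mod_of G I \<and> A \<in> mod_of G I \<and> B \<in> mod_of G I \<and> rep_iso G M (dsum A B)"
  using additive.decomp_unique[of I M A B, OF _ decomp_dsum[of A I B]] additive.decomp_isom[OF decomp_dsum[of A I B], of M]
    additive.decomp_Ob[of I M A B] isom_iff[of I M "dsum A B"] dsum_mod[of A I B] by blast

lemma null_iff: "additive.null I M \<longleftrightarrow> M \<in> mod_of G I \<and> (\<forall>x\<in>verts G. space M x = {0})"
proof (cases "M \<in> mod_of G I")
  case True
  have "mod_id G M = 0 \<longleftrightarrow> (\<forall>x\<in>verts G. \<forall>m\<in>space M x. m = 0)"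
    unfolding mod_id_def normalize_map_def fun_eq_iff by auto
  then show ?thesis unfolding additive.null_def using True mod_0[OF True] by blast
qed (simp add: additive.null_def)

section \<open>Total dimension, splitting of retracts and Fitting's lemma\<close>

lemma total_dim_mono:
  assumes "M \<in> mod_of G I" "N \<in> mod_of G I" "rep_hom G M N f" "\<And>x. x \<in> verts G \<Longrightarrow> inj_on (f x) (space M x)"
  shows "total_dim G M \<le> total_dim G N"
    and "total_dim G M = total_dim G N \<Longrightarrow> x \<in> verts G \<Longrightarrow> f x ` space M x = space N x"
proof -
  have *: "seq.dim (space M x) \<le> seq.dim (space N x)"
    "seq.dim (space M x) = seq.dim (space N x) \<Longrightarrow> f x ` space M x = space N x" if x: "x \<in> verts G" for x
  proof -
    have "seq.dim (f x ` space M x) = seq.dim (space M x)"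
      using linear_map_inj_dim mod_fd[OF assms(1) x] rep_hom_linear[OF assms(3) x] assms(4)[OF x] by blast
    moreover have "seq.subspace (f x ` space M x)" "f x ` space M x \<subseteq> space N x"
      using subrep_image[OF assms(1,3) subrep_UNIV[OF assms(1)]] x unfolding subrep_def by auto
    ultimately show "seq.dim (space M x) \<le> seq.dim (space N x)"
      "seq.dim (space M x) = seq.dim (space N x) \<Longrightarrow> f x ` space M x = space N x"
      using fd_dim_mono[OF mod_fd[OF assms(2) x]] by metis+
  qed
  then show "total_dim G M \<le> total_dim G N" unfolding total_dim_def by (intro sum_mono)
  assume eq: "total_dim G M = total_dim G N" and x: "x \<in> verts G"
  have "seq.dim (space M x) = seq.dim (space N x)"
  proof (rule ccontr)
    assume "seq.dim (space M x) \<noteq> seq.dim (space N x)"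
    then have "seq.dim (space M x) < seq.dim (space N x)" using *(1)[OF x] by linarith
    then have "total_dim G M < total_dim G N"
      unfolding total_dim_def using *(1) x by (intro sum_strict_mono_ex1) auto
    then show False using eq by simp
  qed
  then show "f x ` space M x = space N x" using * x by blast
qed

lemma mod_cmp_eq_id:
  assumes "mod_cmp g f = mod_id G M" "x \<in> verts G" "m \<in> space M x" shows "g x (f x m) = m"
  using fun_cong[OF fun_cong[OF assms(1), of x], of m] assms(2,3) by (simp add: mod_cmp_def)

text \<open>If the dimensions agreed, the embedding \<open>j\<close> of \<open>B\<close> would be
  onto, and as \<open>p j\<close> is zero, so would be \<open>p i\<close>, the identity of
  \<open>A\<close>.\<close>

lemma total_dim_less:
  assumes "additive.decomp I M A B" "\<not> additive.null I A"
  shows "total_dim G B < total_dim G M"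
proof -
  obtain i p j q where b: "i \<in> mod_hom G I A M" "p \<in> mod_hom G I M A" "j \<in> mod_hom G I B M" "q \<in> mod_hom G I M B"
     "mod_cmp p i = mod_id G A" "mod_cmp q j = mod_id G B" "mod_cmp p j = 0"
    using assms(1) unfolding additive.decomp_def additive.biproduct_def by blast
  note BM = mod_hom_mod[OF b(3)]
  have inj: "inj_on (j x) (space B x)" if "x \<in> verts G" for x
    using mod_cmp_eq_id[OF b(6) that] by (metis inj_onI)
  have le: "total_dim G B \<le> total_dim G M"
    using total_dim_mono(1) BM mod_hom_rep_hom[OF b(3)] inj by blast
  have "total_dim G B \<noteq> total_dim G M"
  proof
    assume eq: "total_dim G B = total_dim G M"
    have "space A x = {0}" if x: "x \<in> verts G" for x
    proof -
      have "m = 0" if m: "m \<in> space A x" for m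
      proof -
        have "i x m \<in> space M x" using rep_hom_mem[OF mod_hom_rep_hom[OF b(1)] x m] .
        then obtain n where "i x m = j x n"
          using total_dim_mono(2)[OF _ _ mod_hom_rep_hom[OF b(3)] inj eq x] BM by blast
        then show ?thesis
          using mod_cmp_eq_id[OF b(5) x m] fun_cong[OF fun_cong[OF b(7), of x], of n] by (simp add: mod_cmp_def)
      qed
      then show ?thesis using mod_0 mod_hom_mod[OF b(2)] x by blast
    qed
    then show False using assms(2) null_iff mod_hom_mod[OF b(2)] by blast
  qed
  with le show ?thesis by simp
qed

lemma retract_decomp_kernel:
  assumes i: "i \<in> mod_hom G I L M" and p: "p \<in> mod_hom G I M L" and pi: "mod_cmp p i = mod_id G L"
  shows "additive.decomp I M L (kernel_rep M p)"
proof -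
  have M: "M \<in> mod_of G I" and L: "L \<in> mod_of G I" using mod_hom_mod i by blast+
  note hi = mod_hom_rep_hom[OF i] and hp = mod_hom_rep_hom[OF p]
  have K: "kernel_rep M p \<in> mod_of G I" using kernel_mod M L hp by blast
  \<comment> \<open>The idempotent complementary to \<open>i p\<close>; it projects \<open>M\<close>
    onto the kernel of \<open>p\<close>.\<close>
  let ?s = "\<lambda>x m. m - i x (p x m)"
  have s: "rep_hom G M M ?s"
    using rep_hom_diff[OF M M rep_hom_id rep_hom_comp[OF hp hi]] .
  have pip: "p x (i x m) = m" if "x \<in> verts G" "m \<in> space L x" for x m
    using mod_cmp_eq_id[OF pi that] .
  have ps: "p x (?s x m) = 0" if "x \<in> verts G" "m \<in> space M x" for x m
    using rep_hom_diff_eq[OF M hp that(1) that(2)] pip[OF that(1)] rep_hom_mem[OF hp that]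
      rep_hom_mem[OF hi that(1)] by simp
  have "rep_hom G M (sub_rep M (space (kernel_rep M p))) ?s"
    using ps rep_hom_mem[OF s] by (intro rep_hom_into_sub[OF s]) auto
  then have q: "normalize_map G M ?s \<in> mod_hom G I M (kernel_rep M p)"
    using normalize_hom[OF M K] kernel_rep_sub[of M p] by simp
  have j: "normalize_map G (kernel_rep M p) (\<lambda>x m. m) \<in> mod_hom G I (kernel_rep M p) M"
    using normalize_hom[OF K M] rep_hom_inclusion[OF M subrep_kernel[OF M hp L]] kernel_rep_sub[of M p] by simp
  have i0: "i x 0 = 0" for x
    using rep_hom_0[OF L hi, of x] mod_0[OF L, of x] i unfolding mod_hom_def by (cases "x \<in> verts G") auto
  have iout: "i x m = 0" if "x \<notin> verts G \<or> m \<notin> space L x" for x m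
    using i that unfolding mod_hom_def by blast
  have pout: "p x m = 0" if "x \<notin> verts G \<or> m \<notin> space M x" for x m
    using p that unfolding mod_hom_def by blast
  have p0: "p x 0 = 0" for x
    using rep_hom_0[OF M hp, of x] pout[of x 0] by (cases "x \<in> verts G") auto
  have 1: "mod_cmp (normalize_map G M ?s) i = 0"
  proof (rule ext, rule ext)
    fix x m
    show "mod_cmp (normalize_map G M ?s) i x m = 0 x m"
      using pip[of x m] iout[of x m] i0 rep_hom_0[OF M hp, of x]
      by (cases "x \<in> verts G \<and> m \<in> space L x") (auto simp: mod_cmp_def normalize_map_def)
  qed
  have 2: "mod_cmp p (normalize_map G (kernel_rep M p) (\<lambda>x m. m)) = 0"
    using pout p0
    by (intro ext) (auto simp: mod_cmp_def normalize_map_def)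
  have 3: "mod_cmp (normalize_map G M ?s) (normalize_map G (kernel_rep M p) (\<lambda>x m. m)) = mod_id G (kernel_rep M p)"
    using i0 p0 by (intro ext) (auto simp: mod_cmp_def normalize_map_def mod_id_def)
  have 4: "mod_cmp i p + mod_cmp (normalize_map G (kernel_rep M p) (\<lambda>x m. m)) (normalize_map G M ?s) = mod_id G M"
    using ps rep_hom_mem[OF s] pout i0 p0
    by (intro ext) (auto simp: mod_cmp_def normalize_map_def mod_id_def)
  show ?thesis
    unfolding additive.decomp_def additive.biproduct_def
    using i p q j pi 1 2 3 4 by blast
qed

lemma retract_split: "additive.retract I L M \<Longrightarrow> \<exists>R. additive.decomp I M L R"
  unfolding additive.retract_def using retract_decomp_kernel by blast

text \<open>The hypotheses give only an abstract isomorphism of \<open>M\<close> with its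
  subrepresentation; comparing total dimensions turns it into equality of the spaces.\<close>

lemma sub_rep_full:
  assumes "M \<in> mod_of G I" "subrep G M U" "additive.decomp I M (sub_rep M U) R" "additive.null I R" "x \<in> verts G"
  shows "U x = space M x"
proof -
  have U: "sub_rep M U \<in> mod_of G I" using sub_rep_mod assms by blast
  have "additive.isom I M (sub_rep M U)" using additive.decomp_null_right assms by blast
  then obtain f where f: "rep_hom G M (sub_rep M U) f"
    "\<forall>x\<in>verts G. bij_betw (f x) (space M x) (space (sub_rep M U) x)"
    using isom_imp_bij by blast
  have "total_dim G M \<le> total_dim G (sub_rep M U)"
    using total_dim_mono(1)[OF assms(1) U f(1)] f(2) unfolding bij_betw_def by blast
  moreover have "total_dim G (sub_rep M U) \<le> total_dim G M"
    using total_dim_mono(1)[OF U assms(1) rep_hom_inclusion[OF assms(1,2)]] by (simp add: inj_on_def)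
  ultimately have "(\<lambda>m. m) ` space (sub_rep M U) x = space M x"
    using total_dim_mono(2)[OF U assms(1) rep_hom_inclusion[OF assms(1,2)] _ _ assms(5)] by (simp add: inj_on_def)
  then show ?thesis by simp
qed

text \<open>Fitting's decomposition. On the stable image \<open>U\<close> of the powers of
  \<open>f\<close> the chosen power is bijective, and following that power by the inverse of its
  restriction to \<open>U\<close> gives a projection of \<open>M\<close> onto \<open>U\<close>. The
  image is kept explicit because \<open>projective_cover_exists\<close> needs to know which elements
  it contains.\<close>

lemma fitting_decomp:
  assumes f: "f \<in> mod_hom G I M M"
  obtains n U R where "subrep G M U" "additive.decomp I M (sub_rep M U) R"
    "\<And>x. U x = (mod_cmp f ^^ n) (mod_id G M) x ` space M x"
    "\<And>x. additive.null I R \<Longrightarrow> x \<in> verts G \<Longrightarrow> f x ` space M x = space M x"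
proof -
  have M: "M \<in> mod_of G I" using f mod_hom_mod by blast
  define pw where "pw = (\<lambda>n. (mod_cmp f ^^ n) (mod_id G M))"
  have pw: "pw n \<in> mod_hom G I M M" for n
    unfolding pw_def by (induction n) (auto intro: mod_cmp_hom mod_id_hom f M)
  note hpw = mod_hom_rep_hom[OF pw]
  have pw_add: "mod_cmp (pw m) (pw n) = pw (m + n)" for m n
  proof (induction m)
    case 0
    then show ?case using additive.Id_cmp[OF pw] by (simp add: pw_def)
  next
    case (Suc m)
    then show ?case by (simp add: pw_def additive.cmp_assoc)
  qed
  define im where "im = (\<lambda>n x. pw n x ` space M x)"
  have sub: "subrep G M (im n)" for n
    unfolding im_def using subrep_image[OF M hpw subrep_UNIV[OF M]] .
  \<comment> \<open>A power of least rank has an image that does not shrink under further powers.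
    Positivity of \<open>n\<close> allows a factor \<open>f\<close> to be split off at the end,
    which gives surjectivity of \<open>f\<close> itself.\<close>
  obtain n where n: "n \<ge> 1" "\<And>m. m \<ge> 1 \<Longrightarrow> total_dim G (sub_rep M (im n)) \<le> total_dim G (sub_rep M (im m))"
    using ex_has_least_nat[of "\<lambda>n. n \<ge> 1" 1 "\<lambda>n. total_dim G (sub_rep M (im n))"] by auto
  let ?U = "sub_rep M (im n)" and ?g = "pw n"
  have U: "?U \<in> mod_of G I" using sub_rep_mod[OF M sub] .
  have im2: "?g x ` im n x = im (n + n) x" for x
    unfolding im_def pw_add[symmetric] by (simp add: mod_cmp_def image_image)
  have gU: "rep_hom G M ?U ?g" by (rule rep_hom_into_sub[OF hpw]) (auto simp: im_def)
  then have gUU: "rep_hom G ?U ?U ?g" using rep_hom_restrict_sub sub by blast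
  have incl: "rep_hom G (sub_rep M (im (n + n))) ?U (\<lambda>x m. m)"
    using rep_hom_inclusion[OF M sub] rep_hom_mem[OF gUU]
    by (intro rep_hom_into_sub) (auto simp flip: im2)
  have surj: "im (n + n) x = im n x" if "x \<in> verts G" for x
    using total_dim_mono[OF sub_rep_mod[OF M sub] U incl] n(2)[of "n + n"] n(1) that by (simp add: inj_on_def)
  have "bij_betw (?g x) (space ?U x) (space ?U x)" if x: "x \<in> verts G" for x
    unfolding bij_betw_def
    using surj_endo_inj[OF mod_fd[OF U x] rep_hom_linear[OF gUU x]] surj[OF x] im2[of x] by simp
  then obtain h where h: "additive.inverse_pair I ?U ?U (normalize_map G ?U ?g) h"
    using bij_inverse_pair[OF U U gUU] by blast
  let ?i = "normalize_map G ?U (\<lambda>x m. m)" and ?p = "mod_cmp h (normalize_map G M ?g)"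
  have i: "?i \<in> mod_hom G I ?U M" using normalize_hom[OF U M rep_hom_inclusion[OF M sub]] .
  have g': "normalize_map G M ?g \<in> mod_hom G I M ?U" using normalize_hom[OF M U gU] .
  have hh: "h \<in> mod_hom G I ?U ?U" "mod_cmp h (normalize_map G ?U ?g) = mod_id G ?U"
    using h unfolding additive.inverse_pair_def by blast+
  have p: "?p \<in> mod_hom G I M ?U" using mod_cmp_hom g' hh by blast
  have "mod_cmp (normalize_map G M ?g) ?i = normalize_map G ?U ?g"
  proof (rule mod_hom_eqI[OF mod_cmp_hom[OF g' i] normalize_hom[OF U U gUU]])
    fix x m assume "x \<in> verts G" "m \<in> space ?U x"
    moreover from this have "m \<in> space M x" using sub[of n] unfolding subrep_def by auto
    ultimately show "mod_cmp (normalize_map G M ?g) ?i x m = normalize_map G ?U ?g x m"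
      by (simp add: mod_cmp_def)
  qed
  then have pi: "mod_cmp ?p ?i = mod_id G ?U"
    using hh by (simp add: additive.cmp_assoc)
  note D = retract_decomp_kernel[OF i p pi]
  show thesis
  proof (rule that[OF sub D])
    show "im n x = (mod_cmp f ^^ n) (mod_id G M) x ` space M x" for x
      unfolding im_def pw_def ..
    fix x assume R: "additive.null I (kernel_rep M ?p)" and x: "x \<in> verts G"
    have "space M x = pw n x ` space M x"
      using sub_rep_full[OF M sub D R x] unfolding im_def by simp
    also have "pw n = mod_cmp f (pw (n - 1))"
      using n(1) unfolding pw_def by (cases n) auto
    finally have "space M x = f x ` (pw (n - 1) x ` space M x)" by (simp add: mod_cmp_def image_image)
    moreover have "pw (n - 1) x ` space M x \<subseteq> space M x" using rep_hom_mem[OF hpw x] by blast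
    moreover have "f x ` space M x \<subseteq> space M x" using rep_hom_mem[OF mod_hom_rep_hom[OF f] x] by blast
    ultimately show "f x ` space M x = space M x" by blast
  qed
qed

lemma fitting:
  assumes M: "additive.indecomposable I M" and f: "f \<in> mod_hom G I M M"
  shows "additive.unit I M f \<or> (\<exists>n. (mod_cmp f ^^ n) (mod_id G M) = 0)"
proof -
  obtain n U R where U: "subrep G M U" "additive.decomp I M (sub_rep M U) R"
    "\<And>x. U x = (mod_cmp f ^^ n) (mod_id G M) x ` space M x"
    "\<And>x. additive.null I R \<Longrightarrow> x \<in> verts G \<Longrightarrow> f x ` space M x = space M x"
    using fitting_decomp[OF f] by metis
  have Mod: "M \<in> mod_of G I" using f mod_hom_mod by blast
  consider "additive.null I (sub_rep M U)" | "additive.null I R"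
    using M U(2) unfolding additive.indecomposable_def by blast
  then show ?thesis
  proof cases
    case 1
    have pw: "(mod_cmp f ^^ n) (mod_id G M) \<in> mod_hom G I M M"
      by (induction n) (auto intro: mod_cmp_hom mod_id_hom f Mod)
    have "(mod_cmp f ^^ n) (mod_id G M) = 0"
    proof (rule mod_hom_eqI[OF pw additive.Hom_zero[OF Mod Mod]])
      fix x m assume "x \<in> verts G" "m \<in> space M x"
      then have "(mod_cmp f ^^ n) (mod_id G M) x m \<in> U x" "U x = {0}"
        using U(3)[of x] 1 by (auto simp: null_iff)
      then show "(mod_cmp f ^^ n) (mod_id G M) x m = 0 x m" by simp
    qed
    then show ?thesis by blast
  next
    case 2
    have hf: "rep_hom G M M f" using f mod_hom_rep_hom by blast
    have "bij_betw (f x) (space M x) (space M x)" if x: "x \<in> verts G" for x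
      unfolding bij_betw_def
      using surj_endo_inj[OF mod_fd[OF Mod x] rep_hom_linear[OF hf x]] U(4)[OF 2 x] by blast
    then have "\<exists>g. additive.inverse_pair I M M (normalize_map G M f) g"
      using bij_inverse_pair[OF Mod Mod hf] by blast
    moreover have "normalize_map G M f = f"
      by (rule mod_hom_eqI[OF normalize_hom[OF Mod Mod hf] f]) simp
    ultimately show ?thesis unfolding additive.unit_def by simp
  qed
qed

end

sublocale fin_digraph \<subseteq> cat: krull_schmidt_category "mod_of G I" "mod_hom G I" mod_cmp "mod_id G" "total_dim G" for I
  by unfold_locales (use decomp_dsum total_dim_less retract_split fitting in \<open>blast+\<close>)

section \<open>Summands of direct sums\<close>

lemma (in additive_category) null_isom: "null M \<Longrightarrow> null N \<Longrightarrow> isom M N"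
  unfolding isom_def inverse_pair_def null_def by (intro exI[of _ 0]) simp

context fin_digraph
begin

lemma zero_rep_mod: "zero_rep \<in> mod_of G I"
  unfolding mod_of_def zero_rep_def mem_Collect_eq rep.select_convs
proof (intro conjI ballI)
  show "linear_map {0 :: nat \<Rightarrow> 'c} {0} (\<lambda>m. 0)" by (simp add: linear_map_def)
  fix \<rho> u v and x :: "nat \<Rightarrow> 'c" assume "\<rho> \<in> I" and x: "x \<in> {0}"
  have "fold (\<lambda>a m. 0) p x = 0" for p :: "'b list"
    using x by (induction p) auto
  then show "(\<Sum>p | \<rho> (u, p, v) \<noteq> 0. scale (\<rho> (u, p, v)) (fold (\<lambda>a m. 0) p x)) = 0"
    by (intro sum.neutral) (simp only: seq.scale_zero_right, blast)
qed simp

lemma zero_rep_null: "additive.null I zero_rep"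
  using zero_rep_mod by (auto simp: null_iff zero_rep_def)

lemma dsum_list_simps [simp]: "dsum_list [] = zero_rep" "dsum_list (N # Ns) = dsum N (dsum_list Ns)"
  by (simp_all add: dsum_list_def)

lemma dsum_list_mod: "set Ns \<subseteq> mod_of G I \<Longrightarrow> dsum_list Ns \<in> mod_of G I"
  by (induction Ns) (auto intro: zero_rep_mod dsum_mod)

lemma dsum_list_append:
  "set Ns \<subseteq> mod_of G I \<Longrightarrow> set Ns' \<subseteq> mod_of G I \<Longrightarrow>
   additive.decomp I (dsum_list (Ns @ Ns')) (dsum_list Ns) (dsum_list Ns')"
proof (induction Ns)
  case Nil
  then show ?case
    using additive.decomp_sym[OF additive.decomp_null[OF additive.isom_refl[OF dsum_list_mod] zero_rep_null]] by simp
next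
  case (Cons N Ns)
  then show ?case
    using additive.decomp_assoc[of I "dsum N (dsum_list (Ns @ Ns'))" N "dsum_list (Ns @ Ns')" "dsum_list Ns" "dsum_list Ns'"]
      decomp_dsum[of N I "dsum_list (Ns @ Ns')"] decomp_dsum[of N I "dsum_list Ns"]
      dsum_list_mod[of "Ns @ Ns'" I] dsum_list_mod[of Ns I] by simp
qed

lemma direct_summand_iff: "M \<in> mod_of G I \<Longrightarrow> direct_summand G I N M \<longleftrightarrow> additive.retract I N M"
  unfolding direct_summand_def
  using decomp_iff[of I M N] additive.decomp_retract[of I M N] retract_split[of I N M]
    additive.retract_Ob[of I N M]
  by metis

lemma dsum_list_retract: "set Ns \<subseteq> mod_of G I \<Longrightarrow> N \<in> set Ns \<Longrightarrow> additive.retract I N (dsum_list Ns)"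
proof (induction Ns)
  case (Cons N' Ns)
  then have D: "additive.decomp I (dsum_list (N' # Ns)) N' (dsum_list Ns)"
    using decomp_dsum[of N' I "dsum_list Ns"] dsum_list_mod[of Ns I] by simp
  show ?case
  proof (cases "N = N'")
    case True
    then show ?thesis using additive.decomp_retract[OF D] by simp
  next
    case False
    then show ?thesis
      using Cons additive.decomp_retract[OF additive.decomp_sym[OF D]] additive.retract_trans by simp blast
  qed
qed simp

lemma add_class_iff:
  assumes "Vs \<subseteq> mod_of G I"
  shows "M \<in> add_class G I Vs \<longleftrightarrow> cat.add_closure I Vs M"
proof
  assume "M \<in> add_class G I Vs"
  then obtain Ns where Ns: "M \<in> mod_of G I" "\<forall>N\<in>set Ns. \<exists>V\<in>Vs. direct_summand G I N V"
    "rep_iso G M (dsum_list Ns)"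
    unfolding add_class_def by blast
  have "set Ns \<subseteq> mod_of G I" using Ns(2) unfolding direct_summand_def by blast
  moreover have "cat.add_closure I Vs (dsum_list Ns)"
    using Ns(2)
  proof (induction Ns)
    case Nil
    then show ?case using cat.add_closure.zero[OF zero_rep_null] by simp
  next
    case (Cons N Ns)
    then obtain V where V: "V \<in> Vs" "direct_summand G I N V" by auto
    have "additive.retract I N V" using V assms direct_summand_iff by blast
    then have "cat.add_closure I Vs N" using cat.add_closure.base V(1) by blast
    moreover have "N \<in> mod_of G I" using V(2) unfolding direct_summand_def by blast
    ultimately show ?case
      using Cons cat.add_closure.sum[OF decomp_dsum[of N I "dsum_list Ns"], of Vs]
        cat.add_closure_Ob[of I Vs "dsum_list Ns"] by simp
  qed
  ultimately show "cat.add_closure I Vs M"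
    using cat.add_closure_isom isom_iff Ns dsum_list_mod by blast
next
  assume "cat.add_closure I Vs M"
  then have "\<exists>Ns. (\<forall>N\<in>set Ns. \<exists>V\<in>Vs. additive.retract I N V) \<and> additive.isom I M (dsum_list Ns)"
  proof induction
    case (zero M)
    then show ?case
      using additive.null_isom[OF _ zero_rep_null] by (intro exI[of _ "[]"]) simp
  next
    case (base V M)
    then have "M \<in> mod_of G I" using additive.retract_Ob by blast
    then have "additive.isom I M (dsum_list [M])"
      using additive.isom_sym[OF additive.decomp_null_right[OF decomp_dsum[OF _ zero_rep_mod] zero_rep_null]] by simp
    then show ?case using base by (intro exI[of _ "[M]"]) auto
  next
    case (sum M A B)
    then obtain Ns Ns' where N: "\<forall>N\<in>set Ns. \<exists>V\<in>Vs. additive.retract I N V" "additive.isom I A (dsum_list Ns)"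
      "\<forall>N\<in>set Ns'. \<exists>V\<in>Vs. additive.retract I N V" "additive.isom I B (dsum_list Ns')" by blast
    then have "set Ns \<subseteq> mod_of G I" "set Ns' \<subseteq> mod_of G I" using additive.retract_Ob by blast+
    then have "additive.isom I M (dsum_list (Ns @ Ns'))"
      using additive.decomp_unique[OF additive.decomp_cong[OF sum.hyps(1) N(2,4)] dsum_list_append] by blast
    then show ?case using N by (intro exI[of _ "Ns @ Ns'"]) auto
  qed
  then obtain Ns where Ns: "\<forall>N\<in>set Ns. \<exists>V\<in>Vs. additive.retract I N V" "additive.isom I M (dsum_list Ns)" by blast
  have "\<forall>N\<in>set Ns. \<exists>V\<in>Vs. direct_summand G I N V"
    using Ns(1) direct_summand_iff assms by (meson subsetD)
  moreover have "M \<in> mod_of G I" "rep_iso G M (dsum_list Ns)" using Ns(2) isom_iff[of I M "dsum_list Ns"] by simp_all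
  ultimately show "M \<in> add_class G I Vs" unfolding add_class_def by blast
qed

end

section \<open>Nilpotency and the radical\<close>

definition basis_path :: "('v, 'e) path \<Rightarrow> ('v, 'e) path \<Rightarrow> 'k::field" where
  "basis_path r = (\<lambda>s. if s = r then 1 else 0)"

lemma arrow_basis: "arrow Q a = basis_path (tail Q a, [a], head Q a)"
  by (simp add: arrow_def basis_path_def)

lemma basis_path_carrier: "r \<in> paths Q \<Longrightarrow> basis_path r \<in> carrier (path_algebra Q)"
  by (auto simp: path_algebra_def basis_path_def)

lemma mult_path_algebra:
  "(f \<otimes>\<^bsub>path_algebra Q\<^esub> g) (u, p, v) = (\<Sum>i\<le>length p.
     f (u, take i p, walk_end Q u (take i p)) * g (walk_end Q u (take i p), drop i p, v))"
  by (simp add: path_algebra_def)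

text \<open>Of all factorisations in the convolution only the cut after \<open>p\<close>
  contributes. That \<open>p\<close> is a path is needed so that the cut vertex computed by
  \<open>walk_end\<close> is \<open>w\<close>.\<close>

lemma basis_path_mult:
  assumes "(u, p, w) \<in> paths Q"
  shows "basis_path (u, p, w) \<otimes>\<^bsub>path_algebra Q\<^esub> basis_path (w, q, v) = (basis_path (u, p @ q, v) :: _ \<Rightarrow> 'k::field)"
proof (rule ext)
  fix r :: "'a \<times> 'b list \<times> 'a"
  obtain u' p' v' where r: "r = (u', p', v')" by (cases r)
  let ?t = "\<lambda>i. (basis_path (u, p, w) (u', take i p', walk_end Q u' (take i p')) *
    basis_path (w, q, v) (walk_end Q u' (take i p'), drop i p', v') :: 'k)"
  show "(basis_path (u, p, w) \<otimes>\<^bsub>path_algebra Q\<^esub> basis_path (w, q, v)) r = (basis_path (u, p @ q, v) r :: 'k)"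
  proof (cases "r = (u, p @ q, v)")
    case True
    have "?t i = (if i = length p then 1 else 0)" if "i \<le> length p'" for i
      using that True r paths_walk_end[OF assms]
      by (cases "i \<le> length p") (auto simp: basis_path_def dest: arg_cong[of _ _ length])
    then have "(\<Sum>i\<in>{..length p'}. ?t i) = (\<Sum>i\<in>{..length p'}. if i = length p then 1 else 0)"
      by (intro sum.cong) auto
    also have "\<dots> = 1" using True r by simp
    finally show ?thesis using True unfolding r mult_path_algebra basis_path_def by simp
  next
    case False
    have "?t i = 0" for i
      using False r append_take_drop_id[of i p'] by (auto simp: basis_path_def)
    then have "(\<Sum>i\<le>length p'. ?t i) = 0" by (intro sum.neutral) blast
    moreover have "basis_path (u, p @ q, v) r = (0 :: 'k)" using False by (simp add: basis_path_def)
    ultimately show ?thesis unfolding r mult_path_algebra by metis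
  qed
qed

lemma path_Cons_iff:
  assumes "wf_digraph Q"
  shows "(u, a # p, v) \<in> paths Q \<longleftrightarrow> a \<in> arcs Q \<and> u = tail Q a \<and> (head Q a, p, v) \<in> paths Q"
  using wf_digraph.awalk_Cons_iff[OF assms, of u a p v] by (auto simp: paths_def)

lemma path_Nil_iff:
  assumes "wf_digraph Q"
  shows "(u, [], v) \<in> paths Q \<longleftrightarrow> u = v \<and> u \<in> verts Q"
  using wf_digraph.awalk_Nil_iff[OF assms, of u v] by (auto simp: paths_def)

lemma path_append_iff:
  assumes "wf_digraph Q"
  shows "(u, p @ q, v) \<in> paths Q \<longleftrightarrow> (\<exists>w. (u, p, w) \<in> paths Q \<and> (w, q, v) \<in> paths Q)"
  by (induction p arbitrary: u)
    (auto simp: path_Cons_iff[OF assms] path_Nil_iff[OF assms], auto simp: paths_def pre_digraph.awalk_def)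

context fin_digraph
begin

lemma fold_act_linear:
  assumes M: "M \<in> mod_of G I" and "(u, p, v) \<in> paths G"
  shows "linear_map (space M u) (space M v) (fold (act M) p)"
  using assms(2)
proof (induction p arbitrary: u)
  case Nil
  then show ?case by (simp add: path_Nil_iff[OF wf_digraph_axioms] linear_map_def)
next
  case (Cons a p)
  then show ?case
    using linear_map_comp[OF mod_act[OF M]] by (auto simp: path_Cons_iff[OF wf_digraph_axioms] comp_def)
qed

lemma basis_in_ideal_act:
  assumes M: "M \<in> mod_of G I" and p: "(u, p, v) \<in> paths G" and "basis_path (u, p, v) \<in> I" and "m \<in> space M u"
  shows "fold (act M) p m = 0"
proof -
  have uv: "u \<in> verts G" "v \<in> verts G" using p by (auto simp: paths_def)
  have "(\<Sum>q | basis_path (u, p, v) (u, q, v) \<noteq> (0 :: 'c). scale (basis_path (u, p, v) (u, q, v)) (fold (act M) q m)) = 0"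
    using assms uv unfolding mod_of_def by blast
  moreover have "{q. basis_path (u, p, v) (u, q, v) \<noteq> (0 :: 'c)} = {p}" by (auto simp: basis_path_def)
  ultimately show ?thesis by (simp add: basis_path_def)
qed

definition rad :: "('a, 'b, 'k::field) rep \<Rightarrow> 'a \<Rightarrow> (nat \<Rightarrow> 'k) set" where
  "rad M x = seq.span {act M a m | a m. a \<in> arcs G \<and> head G a = x \<and> m \<in> space M (tail G a)}"

lemma rad_act: "a \<in> arcs G \<Longrightarrow> m \<in> space M (tail G a) \<Longrightarrow> act M a m \<in> rad M (head G a)"
  unfolding rad_def by (intro seq.span_base) blast

lemma rad_subspace: "seq.subspace (rad M x)"
  unfolding rad_def by simp

lemma rad_least:
  assumes "seq.subspace S" "\<And>a m. a \<in> arcs G \<Longrightarrow> head G a = x \<Longrightarrow> m \<in> space M (tail G a) \<Longrightarrow> act M a m \<in> S"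
  shows "rad M x \<subseteq> S"
  unfolding rad_def using assms by (intro seq.span_minimal) auto

lemma rad_subset: "M \<in> mod_of G I \<Longrightarrow> x \<in> verts G \<Longrightarrow> rad M x \<subseteq> space M x"
  by (intro rad_least) (auto simp: mod_subspace mod_act_mem)

lemma rad_hom:
  assumes "M \<in> mod_of G I" "rep_hom G M N f" "x \<in> verts G" "m \<in> rad M x"
  shows "f x m \<in> rad N x"
proof -
  have lin: "linear_map (rad M x) (space N x) (f x)"
    using rep_hom_linear[OF assms(2,3)] rad_subset[OF assms(1,3)] unfolding linear_map_def by blast
  obtain g where g: "Vector_Spaces.linear scale scale g" "\<And>y. y \<in> rad M x \<Longrightarrow> g y = f x y"
    using linear_map_extend[OF rad_subspace lin] by blast
  have "rad M x \<subseteq> {y. g y \<in> rad N x}"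
  proof (rule rad_least)
    show "seq.subspace {y. g y \<in> rad N x}"
      using seq.linear_subspace_linear_preimage[OF g(1) rad_subspace] .
    fix a m assume a: "a \<in> arcs G" "head G a = x" "m \<in> space M (tail G a)"
    then have "g (act M a m) = act N a (f (tail G a) m)"
      using g(2) rad_act[OF a(1,3)] rep_hom_act[OF assms(2) a(1,3)] by simp
    then show "act M a m \<in> {y. g y \<in> rad N x}"
      using rad_act[OF a(1), of "f (tail G a) m" N] rep_hom_mem[OF assms(2) _ a(3)] a by simp
  qed
  then show ?thesis using assms(4) g(2) by auto
qed

lemma rad_dsum:
  assumes "M \<in> mod_of G I" "N \<in> mod_of G I" "x \<in> verts G" "deint0 z \<in> rad M x" "deint1 z \<in> rad N x"
  shows "z \<in> rad (dsum M N) x"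
proof -
  have "interleave (deint0 z) 0 \<in> rad (dsum M N) x" "interleave 0 (deint1 z) \<in> rad (dsum M N) x"
    using rad_hom[OF assms(1) rep_hom_inj(1)[OF assms(1,2)] assms(3,4)]
      rad_hom[OF assms(2) rep_hom_inj(2)[OF assms(1,2)] assms(3,5)] by auto
  then have "interleave (deint0 z) 0 + interleave 0 (deint1 z) \<in> rad (dsum M N) x"
    using seq.subspace_add[OF rad_subspace] by blast
  then show ?thesis by (simp add: interleave_add)
qed

lemma subrep_fold:
  assumes "subrep G M U" "(u, p, v) \<in> paths G" "m \<in> U u"
  shows "fold (act M) p m \<in> U v"
  using assms(2,3)
proof (induction p arbitrary: u m)
  case (Cons a p)
  then show ?case using assms(1) unfolding subrep_def by (auto simp: path_Cons_iff[OF wf_digraph_axioms])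
qed (auto simp: path_Nil_iff[OF wf_digraph_axioms])

text \<open>An element \<open>l\<close> of \<open>L\<close> outside the radical can be avoided by a
  hyperplane at \<open>x\<close> containing the radical; this gives a proper subrepresentation whose
  sum with \<open>L\<close> is \<open>M\<close>.\<close>

lemma superfluous_rad:
  assumes M: "M \<in> mod_of G I" and L: "superfluous G M L" and x: "x \<in> verts G"
  shows "L x \<subseteq> rad M x"
proof (rule ccontr)
  assume "\<not> L x \<subseteq> rad M x"
  then obtain l where l: "l \<in> L x" "l \<notin> rad M x" by blast
  have lM: "l \<in> space M x" using l L x unfolding superfluous_def subrep_def by blast
  obtain B where B: "B \<subseteq> rad M x" "seq.independent B" "rad M x \<subseteq> seq.span B"
    using seq.maximal_independent_subset[of "rad M x"] by blast
  have "seq.span B \<subseteq> rad M x" using B rad_subspace seq.span_minimal by blast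
  then have "seq.independent (insert l B)" using l B seq.independent_insertI by blast
  moreover have "insert l B \<subseteq> space M x" using lM B rad_subset[OF M x] by blast
  ultimately obtain C where C: "insert l B \<subseteq> C" "C \<subseteq> space M x" "seq.independent C" "space M x \<subseteq> seq.span C"
    using seq.maximal_independent_subset_extend by metis
  \<comment> \<open>A hyperplane of the space at \<open>x\<close> that contains the radical but not
    \<open>l\<close>.\<close>
  let ?H = "seq.span (C - {l})"
  have lB: "l \<notin> B" using l B by blast
  have lH: "l \<notin> ?H" using C(1,3) unfolding seq.dependent_def by blast
  have radH: "rad M x \<subseteq> ?H" using B(3) C(1) lB seq.span_mono[of B "C - {l}"] by blast
  have HM: "?H \<subseteq> space M x" using C(2) mod_subspace[OF M x] by (intro seq.span_minimal) auto
  \<comment> \<open>Shrinking a single vertex space keeps a subrepresentation, since every arrow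
    ending in \<open>x\<close> lands in the radical and thus in \<open>?H\<close>.\<close>
  let ?U = "\<lambda>y. if y = x then ?H else space M y"
  have U: "subrep G M ?U"
    unfolding subrep_def
  proof (intro conjI ballI)
    fix y assume y: "y \<in> verts G"
    show "seq.subspace (?U y)" using mod_subspace[OF M y] by auto
    show "?U y \<subseteq> space M y" using HM by auto
  next
    fix a m assume a: "a \<in> arcs G" and m: "m \<in> ?U (tail G a)"
    have "m \<in> space M (tail G a)" using m HM by (auto split: if_splits)
    then show "act M a m \<in> ?U (head G a)"
      using rad_act[OF a] radH mod_act_mem[OF M a] by auto
  qed
  have "{l + u |l u. l \<in> L y \<and> u \<in> ?U y} = space M y" if y: "y \<in> verts G" for y
  proof
    have "subrep G M L" using L unfolding superfluous_def by blast
    then have Ly: "L y \<subseteq> space M y" "seq.subspace (L y)" using y unfolding subrep_def by blast+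
    show "{l + u |l u. l \<in> L y \<and> u \<in> ?U y} \<subseteq> space M y"
    proof safe
      fix l u assume "l \<in> L y" "u \<in> ?U y"
      then have "l \<in> space M y" "u \<in> space M y" using Ly HM by (auto split: if_splits)
      then show "l + u \<in> space M y" using seq.subspace_add[OF mod_subspace[OF M y]] by blast
    qed
    show "space M y \<subseteq> {l + u |l u. l \<in> L y \<and> u \<in> ?U y}"
    proof (cases "y = x")
      case True
      show ?thesis
      proof
        fix m assume "m \<in> space M y"
        then have "m \<in> seq.span (insert l (C - {l}))" using C(1,4) True by (simp add: insert_absorb) blast
        then obtain k where k: "m - scale k l \<in> ?H" unfolding seq.span_insert by blast
        have "scale k l \<in> L y" using l(1) Ly(2) True seq.subspace_scale by blast
        moreover have "m = scale k l + (m - scale k l)" by simp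
        ultimately show "m \<in> {l + u |l u. l \<in> L y \<and> u \<in> ?U y}" using k True by (smt (verit) mem_Collect_eq)
      qed
    next
      case False
      have "0 \<in> L y" using Ly seq.subspace_0 by blast
      moreover have "m = 0 + m" for m :: "nat \<Rightarrow> 'c" by (rule add_0[symmetric])
      ultimately show ?thesis using False by (smt (verit, best) mem_Collect_eq subsetI)
    qed
  qed
  then have "?U x = space M x" using L U x unfolding superfluous_def by blast
  then show False using lH lM by simp
qed

end

section \<open>Admissible ideals: nilpotency and Nakayama's lemma\<close>

locale bound_quiver_algebra = fin_digraph G for G :: "('a, 'b) pre_digraph" +
  fixes I :: "(('a, 'b) path \<Rightarrow> 'k::field) set"
  assumes admissible: "admissible G I"
begin

lemma ring_pa: "ring (path_algebra G :: (('a, 'b) path \<Rightarrow> 'k) ring)"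
  using ring_path_algebra fin_digraph_axioms by blast

lemma ideal_I: "ideal I (path_algebra G)"
  using admissible unfolding admissible_def by blast

lemma arrow_carrier: "a \<in> arcs G \<Longrightarrow> (arrow G a :: _ \<Rightarrow> 'k) \<in> carrier (path_algebra G)"
  unfolding arrow_basis
  by (intro basis_path_carrier) (auto simp: path_Cons_iff[OF wf_digraph_axioms] path_Nil_iff[OF wf_digraph_axioms])

lemma ideal_arrow_ideal: "ideal (arrow_ideal G) (path_algebra G :: (('a, 'b) path \<Rightarrow> 'k) ring)"
  unfolding arrow_ideal_def using ring.genideal_ideal[OF ring_pa] arrow_carrier by blast

lemma arrow_in_arrow_ideal: "a \<in> arcs G \<Longrightarrow> (arrow G a :: _ \<Rightarrow> 'k) \<in> arrow_ideal G"
  unfolding arrow_ideal_def using ring.genideal_self[OF ring_pa, of "arrow G ` arcs G"] arrow_carrier by blast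

text \<open>Powers of an ideal grow by a factor on the right, which is why the induction removes the
  last arrow of the path.\<close>

lemma basis_path_power:
  assumes "(u, p, v) \<in> paths G"
  shows "(basis_path (u, p, v) :: _ \<Rightarrow> 'k) \<in> arrow_ideal G [^]\<^bsub>ideals_set (path_algebra G)\<^esub> length p"
  using assms
proof (induction p arbitrary: v rule: rev_induct)
  case Nil
  then show ?case using basis_path_carrier by (simp add: ideals_set_def nat_pow_def)
next
  case (snoc a p)
  then obtain w where w: "(u, p, w) \<in> paths G" "(w, [a], v) \<in> paths G"
    using path_append_iff[OF wf_digraph_axioms] by blast
  then have a: "a \<in> arcs G" "w = tail G a" "v = head G a"
    by (auto simp: path_Cons_iff[OF wf_digraph_axioms] path_Nil_iff[OF wf_digraph_axioms])
  have "(basis_path (u, p, w) :: _ \<Rightarrow> 'k) \<otimes>\<^bsub>path_algebra G\<^esub> arrow G a \<in>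
      ideal_prod (path_algebra G) (arrow_ideal G [^]\<^bsub>ideals_set (path_algebra G)\<^esub> length p) (arrow_ideal G)"
    using snoc.IH[OF w(1)] arrow_in_arrow_ideal[OF a(1)] ideal_prod.prod by metis
  moreover have "(basis_path (u, p, w) :: _ \<Rightarrow> 'k) \<otimes>\<^bsub>path_algebra G\<^esub> arrow G a = basis_path (u, p @ [a], v)"
    using basis_path_mult[OF w(1), of "[a]" v] a by (simp add: arrow_basis)
  ultimately show ?case by (simp add: ideals_set_def nat_pow_def)
qed

definition nil_bound :: nat where
  "nil_bound = (SOME m. arrow_ideal G [^]\<^bsub>ideals_set (path_algebra G)\<^esub> m \<subseteq> I)"

text \<open>The prefix of length \<open>nil_bound\<close> already lies in a power of the arrow ideal
  contained in \<open>I\<close>, and \<open>I\<close> absorbs the rest of the path.\<close>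

lemma long_path_in_ideal:
  assumes "(u, p, v) \<in> paths G" "length p \<ge> nil_bound"
  shows "basis_path (u, p, v) \<in> I"
proof -
  have nb: "arrow_ideal G [^]\<^bsub>ideals_set (path_algebra G)\<^esub> nil_bound \<subseteq> I"
    unfolding nil_bound_def using admissible unfolding admissible_def by (metis (mono_tags, lifting) someI_ex)
  let ?p = "take nil_bound p" and ?q = "drop nil_bound p"
  obtain w where w: "(u, ?p, w) \<in> paths G" "(w, ?q, v) \<in> paths G"
    using path_append_iff[OF wf_digraph_axioms, of u ?p ?q v] assms by auto
  have "basis_path (u, ?p, w) \<in> I" using basis_path_power[OF w(1)] nb assms(2) by auto
  then have "basis_path (u, ?p, w) \<otimes>\<^bsub>path_algebra G\<^esub> basis_path (w, ?q, v) \<in> I"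
    using ideal.I_r_closed[OF ideal_I] basis_path_carrier[OF w(2)] by blast
  moreover have "(basis_path (u, ?p, w) :: _ \<Rightarrow> 'k) \<otimes>\<^bsub>path_algebra G\<^esub> basis_path (w, ?q, v) = basis_path (u, p, v)"
    using basis_path_mult[OF w(1), of ?q v] by simp
  ultimately show ?thesis by simp
qed

text \<open>The elements without stationary coefficients form an ideal that contains the arrows,
  hence the arrow ideal, its square and \<open>I\<close>. This is what makes representations with
  vanishing arrows bound by \<open>I\<close>.\<close>

lemma ideal_I_no_stationary:
  assumes "\<rho> \<in> I" shows "\<rho> (u, [], v) = 0"
proof -
  let ?Z = "{f \<in> carrier (path_algebra G). \<forall>u v. f (u, [], v) = (0 :: 'k)}"
  interpret R: ring "path_algebra G :: (('a, 'b) path \<Rightarrow> 'k) ring" by (rule ring_pa)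
  have inv: "\<ominus>\<^bsub>path_algebra G\<^esub> f = (\<lambda>r. - f r)" if "f \<in> carrier (path_algebra G)" for f :: "('a, 'b) path \<Rightarrow> 'k"
  proof -
    have "(\<lambda>r. - f r) \<in> carrier (path_algebra G)" using that by (auto simp: path_algebra_def)
    moreover have "(\<lambda>r. - f r) \<oplus>\<^bsub>path_algebra G\<^esub> f = \<zero>\<^bsub>path_algebra G\<^esub>" by (simp add: path_algebra_def)
    ultimately show ?thesis using R.minus_equality[of _ f] that by blast
  qed
  have "ideal ?Z (path_algebra G)"
  proof (rule idealI[OF ring_pa])
    show "subgroup ?Z (add_monoid (path_algebra G))"
    proof (rule R.add.subgroupI)
      show "?Z \<noteq> {}" using R.zero_closed by (auto simp: path_algebra_def)
    next
      fix f assume f: "f \<in> ?Z"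
      then have "\<ominus>\<^bsub>path_algebra G\<^esub> f \<in> carrier (path_algebra G)" using R.a_inv_closed by blast
      then show "\<ominus>\<^bsub>path_algebra G\<^esub> f \<in> ?Z" using inv f by auto
    next
      fix f g assume "f \<in> ?Z" "g \<in> ?Z"
      then show "f \<oplus>\<^bsub>path_algebra G\<^esub> g \<in> ?Z"
        using R.a_closed[of f g] by (auto simp: path_algebra_def)
    qed auto
  qed (auto simp: path_algebra_mult_closed mult_path_algebra)
  moreover have "(arrow G ` arcs G) \<subseteq> ?Z"
    using arrow_carrier by (auto simp: arrow_def)
  ultimately have J: "arrow_ideal G \<subseteq> ?Z"
    unfolding arrow_ideal_def using R.genideal_minimal by blast
  have "arrow_ideal G [^]\<^bsub>ideals_set (path_algebra G)\<^esub> (2::nat) \<subseteq> (arrow_ideal G :: (_ \<Rightarrow> 'k) set)"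
    using R.ideal_prod_inter[of "ideal_prod (path_algebra G) (carrier (path_algebra G)) (arrow_ideal G)" "arrow_ideal G"]
      R.ideal_prod_is_ideal[OF R.oneideal ideal_arrow_ideal] ideal_arrow_ideal
    by (auto simp: ideals_set_def nat_pow_def numeral_2_eq_2)
  then show ?thesis using assms admissible J unfolding admissible_def by blast
qed

lemma fold_long_path:
  assumes "M \<in> mod_of G I" "(u, p, v) \<in> paths G" "length p \<ge> nil_bound" "m \<in> space M u"
  shows "fold (act M) p m = 0"
  using basis_in_ideal_act[OF assms(1,2) long_path_in_ideal[OF assms(2,3)] assms(4)] .

text \<open>Nakayama's lemma. If \<open>L\<close> lies in the radical and L + U = M, then modulo
  \<open>U\<close> every element is a combination of images of arrows; iterating expresses it by
  ever longer paths, and paths of length \<open>nil_bound\<close> act as zero.\<close>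

lemma superfluous_iff:
  assumes M: "M \<in> mod_of G I"
  shows "superfluous G M L \<longleftrightarrow> subrep G M L \<and> (\<forall>x\<in>verts G. L x \<subseteq> rad M x)"
proof
  assume "superfluous G M L"
  then show "subrep G M L \<and> (\<forall>x\<in>verts G. L x \<subseteq> rad M x)"
    using superfluous_rad[OF M] unfolding superfluous_def by blast
next
  assume L: "subrep G M L \<and> (\<forall>x\<in>verts G. L x \<subseteq> rad M x)"
  have full: "U v = space M v"
    if U: "subrep G M U" and LU: "\<And>x. x \<in> verts G \<Longrightarrow> {l + u | l u. l \<in> L x \<and> u \<in> U x} = space M x"
      and v: "v \<in> verts G" for U v
  proof -
    have sU: "seq.subspace (U x)" if "x \<in> verts G" for x using U that unfolding subrep_def by blast
    \<comment> \<open>Descending induction on the length of \<open>p\<close>, with \<open>k\<close>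
      bounding what is missing to \<open>nil_bound\<close>: writing \<open>m\<close> as l + n, the
      radical part \<open>l\<close> is handled by prefixing one more arrow to \<open>p\<close>. The
      empty path then gives the claim.\<close>
    have "fold (act M) p m \<in> U w" if "(u, p, w) \<in> paths G" "length p + k \<ge> nil_bound" "m \<in> space M u" for u p w k m
      using that
    proof (induction k arbitrary: u p m)
      case 0
      then have "fold (act M) p m = 0" using fold_long_path[OF M] by simp
      moreover have "w \<in> verts G" using 0(1) by (auto simp: paths_def)
      ultimately show ?case using sU seq.subspace_0 by metis
    next
      case (Suc k)
      have uw: "u \<in> verts G" "w \<in> verts G" using Suc.prems(1) by (auto simp: paths_def)
      note lin = fold_act_linear[OF M Suc.prems(1)]
      obtain l n where m: "m = l + n" "l \<in> L u" "n \<in> U u" using LU[OF uw(1)] Suc.prems(3) by blast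
      have ln: "l \<in> rad M u" "l \<in> space M u" "n \<in> space M u"
        using m L U uw rad_subset[OF M] unfolding subrep_def by blast+
      obtain g where g: "Vector_Spaces.linear scale scale g" "\<And>y. y \<in> space M u \<Longrightarrow> g y = fold (act M) p y"
        using linear_map_extend[OF mod_subspace[OF M uw(1)] lin] by blast
      have "rad M u \<subseteq> {y. g y \<in> U w}"
      proof (rule rad_least)
        show "seq.subspace {y. g y \<in> U w}" using seq.linear_subspace_linear_preimage[OF g(1) sU[OF uw(2)]] .
        fix a y assume a: "a \<in> arcs G" "head G a = u" "y \<in> space M (tail G a)"
        have "(tail G a, a # p, w) \<in> paths G"
          using a Suc.prems(1) by (simp add: path_Cons_iff[OF wf_digraph_axioms])
        then have "fold (act M) (a # p) y \<in> U w" using Suc.IH[of "tail G a" "a # p" y] Suc.prems a by simp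
        then show "act M a y \<in> {y. g y \<in> U w}" using g(2) mod_act_mem[OF M a(1,3)] a(2) by simp
      qed
      then have "fold (act M) p l \<in> U w" using ln g(2) by auto
      moreover have "fold (act M) p n \<in> U w" using subrep_fold[OF U Suc.prems(1) m(3)] .
      moreover have "fold (act M) p m = fold (act M) p l + fold (act M) p n"
        using lin ln m(1) unfolding linear_map_def by blast
      ultimately show ?case using seq.subspace_add[OF sU[OF uw(2)]] by metis
    qed
    from this[of v "[]" v nil_bound] have "space M v \<subseteq> U v"
      using v path_Nil_iff[OF wf_digraph_axioms] by auto
    then show ?thesis using U v unfolding subrep_def by blast
  qed
  show "superfluous G M L"
    unfolding superfluous_def
  proof (intro conjI allI impI ballI)
    fix U x
    assume U: "subrep G M U \<and> (\<forall>x\<in>verts G. {l + u | l u. l \<in> L x \<and> u \<in> U x} = space M x)"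
      and x: "x \<in> verts G"
    show "U x = space M x" by (rule full[OF conjunct1[OF U] bspec[OF conjunct2[OF U]] x])
  qed (use L in simp)
qed

end

section \<open>Projective modules at the vertices\<close>

text \<open>The counterpart of \<open>scale\<close> for functions on an arbitrary index type:
  elements of the path algebra are functions on paths, not sequences.\<close>

definition fscale :: "'k::field \<Rightarrow> ('i \<Rightarrow> 'k) \<Rightarrow> 'i \<Rightarrow> 'k" where
  "fscale c f = (\<lambda>i. c * f i)"

global_interpretation fs: vector_space fscale
  by unfold_locales (auto simp: fscale_def fun_eq_iff algebra_simps)

global_interpretation fsp: vector_space_pair fscale fscale ..

global_interpretation fss: vector_space_pair fscale scale ..

lemma scale_eq_fscale: "scale = fscale"
  by (simp add: fun_eq_iff scale_def fscale_def)

definition delta :: "'i \<Rightarrow> 'i \<Rightarrow> 'k::field" where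
  "delta i = (\<lambda>j. if j = i then 1 else 0)"

lemma sum_fun_apply: "(\<Sum>x\<in>S. F x) i = (\<Sum>x\<in>S. F x i)" for F :: "'a \<Rightarrow> 'i \<Rightarrow> 'k::field"
  by (induction S rule: infinite_finite_induct) auto

lemma delta_inj: "inj (delta :: 'i \<Rightarrow> 'i \<Rightarrow> 'k::field)"
  by (auto simp: inj_def delta_def fun_eq_iff split: if_splits)

lemma independent_delta: "fs.independent (range (delta :: 'i \<Rightarrow> 'i \<Rightarrow> 'k::field))"
  unfolding fs.independent_explicit_finite_subsets
proof (intro allI impI ballI)
  fix S :: "('i \<Rightarrow> 'k) set" and u v
  assume S: "S \<subseteq> range delta" "finite S" and 0: "(\<Sum>v\<in>S. fscale (u v) v) = 0" and v: "v \<in> S"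
  obtain i where i: "v = delta i" using S v by blast
  have "0 = (\<Sum>w\<in>S. fscale (u w) w i)" using fun_cong[OF 0, of i] by (simp add: sum_fun_apply)
  also have "\<dots> = (\<Sum>w\<in>S. if w = v then u v else 0)"
  proof (intro sum.cong refl)
    fix w assume "w \<in> S"
    then obtain j where j: "w = delta j" using S by blast
    show "fscale (u w) w i = (if w = v then u v else 0)"
    proof (cases "j = i")
      case True
      then show ?thesis using i j by (simp add: fscale_def delta_def)
    next
      case False
      then have "w \<noteq> v" using i j injD[OF delta_inj] by metis
      then show ?thesis using False j by (simp add: fscale_def delta_def)
    qed
  qed
  also have "\<dots> = u v" using S v by simp
  finally show "u v = 0" by simp
qed

lemma basis_path_delta: "basis_path = delta"
  by (auto simp: basis_path_def delta_def fun_eq_iff)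

text \<open>Spaces of representations consist of sequences, so a finite dimensional space of
  functions on paths has to be moved there: basis elements go to distinct unit sequences.\<close>

lemma embed_finite_span:
  fixes B :: "('i \<Rightarrow> 'k::field) set"
  assumes "finite B"
  obtains \<tau> :: "('i \<Rightarrow> 'k) \<Rightarrow> nat \<Rightarrow> 'k"
  where "Vector_Spaces.linear fscale scale \<tau>" "inj_on \<tau> (fs.span B)"
proof -
  obtain C where C: "C \<subseteq> B" "fs.independent C" "B \<subseteq> fs.span C"
    using fs.maximal_independent_subset[of B] by blast
  obtain e :: "('i \<Rightarrow> 'k) \<Rightarrow> nat" where e: "inj_on e C"
    using finite_imp_inj_to_nat_seg[of C] C(1) assms finite_subset by metis
  obtain \<tau> where t: "Vector_Spaces.linear fscale scale \<tau>" "\<forall>c\<in>C. \<tau> c = delta (e c)"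
    using fss.linear_independent_extend[OF C(2), of "\<lambda>c. delta (e c)"] by blast
  have "\<tau> ` C \<subseteq> range delta" using t by auto
  then have "seq.independent (\<tau> ` C)"
    using fs.independent_mono[OF independent_delta] unfolding scale_eq_fscale by blast
  moreover have "inj_on \<tau> C"
  proof (rule inj_onI)
    fix x y assume xy: "x \<in> C" "y \<in> C" "\<tau> x = \<tau> y"
    then have "delta (e x) = (delta (e y) :: nat \<Rightarrow> 'k)" using t(2) by metis
    then have "e x = e y" by (rule injD[OF delta_inj])
    then show "x = y" using inj_onD[OF e] xy by blast
  qed
  ultimately have "inj_on \<tau> (fs.span C)"
    using fss.linear_inj_on_span_iff_independent_image[OF t(1)] by blast
  moreover have "fs.span B \<subseteq> fs.span C" using C(3) fs.span_minimal fs.subspace_span by blast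
  ultimately show thesis using that t(1) inj_on_subset by blast
qed

lemma linear_mult_left: "Vector_Spaces.linear fscale fscale (\<lambda>f. f \<otimes>\<^bsub>path_algebra Q\<^esub> g)"
  unfolding Vector_Spaces.linear_iff
  by (auto simp: fs.vector_space_axioms mult_path_algebra fun_eq_iff fscale_def sum.distrib algebra_simps sum_distrib_left)

lemma linear_mult_right: "Vector_Spaces.linear fscale fscale (\<lambda>g. f \<otimes>\<^bsub>path_algebra Q\<^esub> g)"
  unfolding Vector_Spaces.linear_iff
  by (auto simp: fs.vector_space_axioms mult_path_algebra fun_eq_iff fscale_def sum.distrib algebra_simps sum_distrib_left)

section \<open>The right modules \<open>e_u (kQ/I)\<close> and their universal property\<close>

context bound_quiver_algebra
begin

text \<open>The corner \<open>e_u kQ e_v\<close> of the path algebra, where \<open>e_u\<close> is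
  the stationary path at \<open>u\<close>.\<close>

definition pspace :: "'a \<Rightarrow> 'a \<Rightarrow> (('a, 'b) path \<Rightarrow> 'k) set" where
  "pspace u v = {f \<in> carrier (path_algebra G). \<forall>r. f r \<noteq> 0 \<longrightarrow> (\<exists>p. r = (u, p, v))}"

lemma subspace_carrier: "fs.subspace (carrier (path_algebra G :: (('a, 'b) path \<Rightarrow> 'k) ring))"
proof -
  interpret R: ring "path_algebra G :: (('a, 'b) path \<Rightarrow> 'k) ring" by (rule ring_pa)
  show ?thesis
  proof (rule fs.subspaceI)
    show "0 \<in> carrier (path_algebra G :: (('a, 'b) path \<Rightarrow> 'k) ring)"
      using R.zero_closed by (simp add: path_algebra_def)
    fix f g :: "('a, 'b) path \<Rightarrow> 'k" and c
    assume f: "f \<in> carrier (path_algebra G)"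
    have "{r. fscale c f r \<noteq> 0} \<subseteq> {r. f r \<noteq> 0}" by (auto simp: fscale_def)
    then show "fscale c f \<in> carrier (path_algebra G)"
      using f unfolding path_algebra_def by (auto intro: finite_subset)
    assume "g \<in> carrier (path_algebra G)"
    then have "f \<oplus>\<^bsub>path_algebra G\<^esub> g \<in> carrier (path_algebra G)" using f by blast
    moreover have "f \<oplus>\<^bsub>path_algebra G\<^esub> g = f + g" by (simp add: path_algebra_def fun_eq_iff)
    ultimately show "f + g \<in> carrier (path_algebra G)" by metis
  qed
qed

lemma subspace_pspace: "fs.subspace (pspace u v)"
proof (rule fs.subspaceI)
  show "0 \<in> pspace u v" using fs.subspace_0[OF subspace_carrier] by (simp add: pspace_def)
  fix f g and c :: 'k assume f: "f \<in> pspace u v"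
  then show "fscale c f \<in> pspace u v"
    using fs.subspace_scale[OF subspace_carrier, of f c] by (auto simp: pspace_def fscale_def)
  assume g: "g \<in> pspace u v"
  have "f r \<noteq> 0 \<or> g r \<noteq> 0" if "(f + g) r \<noteq> 0" for r using that by auto
  then show "f + g \<in> pspace u v"
    using f g fs.subspace_add[OF subspace_carrier, of f g] unfolding pspace_def by blast
qed

lemma subspace_I: "fs.subspace I"
proof -
  interpret R: ring "path_algebra G :: (('a, 'b) path \<Rightarrow> 'k) ring" by (rule ring_pa)
  interpret I: ideal I "path_algebra G" by (rule ideal_I)
  show ?thesis
  proof (rule fs.subspaceI)
    show "0 \<in> I" using I.zero_closed by (simp add: path_algebra_def zero_fun_def)
    fix f g and c :: 'k assume f: "f \<in> I"
    have fc: "f \<in> carrier (path_algebra G)" using f I.Icarr by blast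
    \<comment> \<open>Stability of a ring ideal under scalars: scaling by \<open>c\<close> is
      multiplication by \<open>c\<close> times the unit of the path algebra.\<close>
    have "fscale c (\<one>\<^bsub>path_algebra G\<^esub>) \<in> carrier (path_algebra G)"
      using fs.subspace_scale[OF subspace_carrier] R.one_closed by blast
    then have "fscale c (\<one>\<^bsub>path_algebra G\<^esub>) \<otimes>\<^bsub>path_algebra G\<^esub> f \<in> I"
      using I.I_l_closed f by blast
    moreover have "fscale c (\<one>\<^bsub>path_algebra G\<^esub>) \<otimes>\<^bsub>path_algebra G\<^esub> f = fscale c f"
      using fsp.linear_scale[OF linear_mult_left[of G f], of c "\<one>\<^bsub>path_algebra G\<^esub>"] path_algebra_one_mult[OF fc] by simp
    ultimately show "fscale c f \<in> I" by simp
    assume "g \<in> I"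
    then have "f \<oplus>\<^bsub>path_algebra G\<^esub> g \<in> I" using f I.a_closed by blast
    moreover have "f \<oplus>\<^bsub>path_algebra G\<^esub> g = f + g" by (simp add: path_algebra_def fun_eq_iff)
    ultimately show "f + g \<in> I" by metis
  qed
qed

lemma basis_path_pspace: "(u, p, v) \<in> paths G \<Longrightarrow> basis_path (u, p, v) \<in> pspace u v"
  using basis_path_carrier by (auto simp: pspace_def basis_path_def split: if_splits)

lemma pspace_expand:
  assumes "f \<in> pspace u v"
  shows "finite {p. f (u, p, v) \<noteq> 0}" "\<And>p. f (u, p, v) \<noteq> 0 \<Longrightarrow> (u, p, v) \<in> paths G"
    "f = (\<Sum>p | f (u, p, v) \<noteq> 0. fscale (f (u, p, v)) (basis_path (u, p, v)))"
proof -
  have f: "finite {r. f r \<noteq> 0}" "{r. f r \<noteq> 0} \<subseteq> paths G" "\<And>r. f r \<noteq> 0 \<Longrightarrow> \<exists>p. r = (u, p, v)"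
    using assms by (auto simp: pspace_def path_algebra_def)
  show fin: "finite {p. f (u, p, v) \<noteq> 0}"
    using finite_vimageI[OF f(1), of "\<lambda>p. (u, p, v)"] by (simp add: vimage_def inj_def)
  show "\<And>p. f (u, p, v) \<noteq> 0 \<Longrightarrow> (u, p, v) \<in> paths G" using f(2) by blast
  show "f = (\<Sum>p | f (u, p, v) \<noteq> 0. fscale (f (u, p, v)) (basis_path (u, p, v)))"
  proof (rule ext)
    fix r
    show "f r = (\<Sum>p | f (u, p, v) \<noteq> 0. fscale (f (u, p, v)) (basis_path (u, p, v))) r"
    proof (cases "\<exists>p. r = (u, p, v)")
      case True
      then obtain q where q: "r = (u, q, v)" by blast
      have "(\<Sum>p | f (u, p, v) \<noteq> 0. fscale (f (u, p, v)) (basis_path (u, p, v)) r) =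
        (\<Sum>p | f (u, p, v) \<noteq> 0. if p = q then f (u, q, v) else 0)"
        using q by (intro sum.cong) (auto simp: fscale_def basis_path_def)
      also have "\<dots> = f r" using fin q by simp
      finally show ?thesis by (simp add: sum_fun_apply)
    next
      case False
      then have "fscale (f (u, p, v)) (basis_path (u, p, v)) r = 0" for p
        by (auto simp: fscale_def basis_path_def)
      moreover have "f r = 0" using f(3) False by blast
      ultimately show ?thesis by (simp add: sum_fun_apply)
    qed
  qed
qed

lemma pspace_linear:
  assumes "f \<in> pspace u v" "Vector_Spaces.linear fscale scale L"
  shows "L f = (\<Sum>p | f (u, p, v) \<noteq> 0. scale (f (u, p, v)) (L (basis_path (u, p, v))))"
proof -
  have "L f = L (\<Sum>p | f (u, p, v) \<noteq> 0. fscale (f (u, p, v)) (basis_path (u, p, v)))"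
    by (rule arg_cong[OF pspace_expand(3)[OF assms(1)]])
  also have "\<dots> = (\<Sum>p | f (u, p, v) \<noteq> 0. scale (f (u, p, v)) (L (basis_path (u, p, v))))"
    by (simp add: fss.linear_sum[OF assms(2)] fss.linear_scale[OF assms(2)])
  finally show ?thesis .
qed

lemma pspace_mult:
  assumes "f \<in> pspace u w" "g \<in> pspace w v"
  shows "f \<otimes>\<^bsub>path_algebra G\<^esub> g \<in> pspace u v"
proof -
  have fg: "f \<in> carrier (path_algebra G)" "g \<in> carrier (path_algebra G)"
    using assms by (auto simp: pspace_def)
  have "\<exists>p. r = (u, p, v)" if "(f \<otimes>\<^bsub>path_algebra G\<^esub> g) r \<noteq> 0" for r
  proof -
    obtain u' p v' where r: "r = (u', p, v')" by (cases r)
    from that obtain i where "f (u', take i p, walk_end G u' (take i p)) *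
      g (walk_end G u' (take i p), drop i p, v') \<noteq> 0"
      unfolding r mult_path_algebra by (auto elim: sum.not_neutral_contains_not_neutral)
    then have "f (u', take i p, walk_end G u' (take i p)) \<noteq> 0"
      "g (walk_end G u' (take i p), drop i p, v') \<noteq> 0" by auto
    then have "u' = u" "v' = v" using assms unfolding pspace_def by blast+
    then show ?thesis using r by blast
  qed
  then show ?thesis using path_algebra_mult_closed[OF fg] unfolding pspace_def by blast
qed

lemma stationary_mult:
  "basis_path (w, [], w) \<otimes>\<^bsub>path_algebra G\<^esub> f = (\<lambda>(u, p, v). if u = w then f (u, p, v) else 0)"
proof (rule ext)
  fix r :: "('a, 'b) path"
  obtain u p v where r: "r = (u, p, v)" by (cases r)
  have "basis_path (w, [], w) (u, take i p, walk_end G u (take i p)) * f (walk_end G u (take i p), drop i p, v)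
    = (if i = 0 then if u = w then f r else 0 else 0)" if "i \<le> length p" for i
    using that r by (auto simp: basis_path_def)
  then have "(basis_path (w, [], w) \<otimes>\<^bsub>path_algebra G\<^esub> f) r = (\<Sum>i\<in>{..length p}. if i = 0 then if u = w then f r else 0 else 0)"
    unfolding r mult_path_algebra by (intro sum.cong) auto
  then show "(basis_path (w, [], w) \<otimes>\<^bsub>path_algebra G\<^esub> f) r = (case r of (u, p, v) \<Rightarrow> if u = w then f (u, p, v) else 0)"
    using r by simp
qed

lemma mult_stationary_right:
  assumes "f \<in> carrier (path_algebra G)"
  shows "f \<otimes>\<^bsub>path_algebra G\<^esub> basis_path (w, [], w) = (\<lambda>(u, p, v). if v = w then f (u, p, v) else 0)"
proof (rule ext)
  fix r :: "('a, 'b) path"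
  obtain u p v where r: "r = (u, p, v)" by (cases r)
  have E: "walk_end G u p = v'" if "f (u, p, v') \<noteq> 0" for v'
    using that assms paths_walk_end[of u p v' G] by (auto simp: path_algebra_def)
  have "f (u, take i p, walk_end G u (take i p)) * basis_path (w, [], w) (walk_end G u (take i p), drop i p, v)
    = (if i = length p then if v = w then f r else 0 else 0)" if "i \<le> length p" for i
    using that r E[of v] E[of "walk_end G u p"] by (auto simp: basis_path_def)
  then have "(f \<otimes>\<^bsub>path_algebra G\<^esub> basis_path (w, [], w)) r = (\<Sum>i\<in>{..length p}. if i = length p then if v = w then f r else 0 else 0)"
    unfolding r mult_path_algebra by (intro sum.cong) auto
  then show "(f \<otimes>\<^bsub>path_algebra G\<^esub> basis_path (w, [], w)) r = (case r of (u, p, v) \<Rightarrow> if v = w then f (u, p, v) else 0)"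
    using r by simp
qed

lemma mult_stationary:
  assumes "f \<in> pspace u w"
  shows "f \<otimes>\<^bsub>path_algebra G\<^esub> basis_path (w, [], w) = f"
proof -
  have f: "f \<in> carrier (path_algebra G)" "\<And>r. f r \<noteq> 0 \<Longrightarrow> \<exists>p. r = (u, p, w)"
    using assms unfolding pspace_def by blast+
  have "f (u', p, v) = 0" if "v \<noteq> w" for u' p v using f(2) that by blast
  then show ?thesis unfolding mult_stationary_right[OF f(1)] by (auto simp: fun_eq_iff)
qed

lemma stationary_carrier: "w \<in> verts G \<Longrightarrow> (basis_path (w, [], w) :: _ \<Rightarrow> 'k) \<in> carrier (path_algebra G)"
  by (intro basis_path_carrier) (simp add: path_Nil_iff[OF wf_digraph_axioms])

text \<open>The two-sided product \<open>e_w \<rho> e_v\<close>, written out on coefficients; this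
  is why it stays in any ideal that contains \<open>\<rho>\<close>.\<close>

definition corner :: "'a \<Rightarrow> 'a \<Rightarrow> (('a, 'b) path \<Rightarrow> 'k) \<Rightarrow> ('a, 'b) path \<Rightarrow> 'k" where
  "corner w v \<rho> = (\<lambda>(u', p, v'). if u' = w \<and> v' = v then \<rho> (u', p, v') else 0)"

lemma corner_in_ideal:
  assumes "ideal J (path_algebra G)" "\<rho> \<in> J" "w \<in> verts G" "v \<in> verts G"
  shows "corner w v \<rho> \<in> J \<inter> pspace w v"
proof -
  interpret J: ideal J "path_algebra G" by fact
  have "basis_path (w, [], w) \<otimes>\<^bsub>path_algebra G\<^esub> \<rho> \<otimes>\<^bsub>path_algebra G\<^esub> basis_path (v, [], v) \<in> J"
    using assms stationary_carrier J.I_l_closed J.I_r_closed by blast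
  moreover have "basis_path (w, [], w) \<otimes>\<^bsub>path_algebra G\<^esub> \<rho> \<in> carrier (path_algebra G)"
    using path_algebra_mult_closed[OF stationary_carrier[OF assms(3)] J.Icarr[OF assms(2)]] .
  from mult_stationary_right[OF this, of v]
  have "basis_path (w, [], w) \<otimes>\<^bsub>path_algebra G\<^esub> \<rho> \<otimes>\<^bsub>path_algebra G\<^esub> basis_path (v, [], v) = corner w v \<rho>"
    by (simp add: stationary_mult corner_def fun_eq_iff)
  ultimately have "corner w v \<rho> \<in> J" by simp
  then show ?thesis using J.Icarr by (auto simp: pspace_def corner_def split: if_splits)
qed

text \<open>The coordinates of \<open>e\<^sub>u (kQ/I) e\<^sub>v\<close> as a finite dimensional space of sequences.\<close>

lemma coordinates_exist:
  "\<exists>\<theta>. Vector_Spaces.linear fscale scale \<theta> \<and> fd_space (\<theta> ` pspace u v) \<and> (\<forall>f\<in>pspace u v. \<theta> f = 0 \<longleftrightarrow> f \<in> I)"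
proof -
  have S: "fs.subspace (I \<inter> pspace u v)" using subspace_I subspace_pspace fs.subspace_inter by blast
  have "Vector_Spaces.linear fscale fscale (\<lambda>f :: ('a, 'b) path \<Rightarrow> 'k. f)"
    by (simp add: Vector_Spaces.linear_iff fs.vector_space_axioms)
  from fsp.linear_exists_left_inverse_on[OF this S] obtain r where
    r: "range r \<subseteq> I \<inter> pspace u v" "Vector_Spaces.linear fscale fscale r" "\<forall>f\<in>I \<inter> pspace u v. r f = f" by auto
  \<comment> \<open>As \<open>r\<close> is a linear projector onto the relations in
    \<open>pspace u v\<close>, the map \<open>\<psi>\<close> vanishes there exactly on the elements
    of \<open>I\<close>, and so its image realises the quotient without cosets.\<close>
  define \<psi> where "\<psi> = (\<lambda>f. f - r f)"
  have psi: "Vector_Spaces.linear fscale fscale \<psi>"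
    unfolding \<psi>_def Vector_Spaces.linear_iff
    by (simp add: fs.vector_space_axioms fsp.linear_add[OF r(2)] fsp.linear_scale[OF r(2)] fs.scale_right_diff_distrib
      algebra_simps)
  \<comment> \<open>Long paths lie in \<open>I\<close> and are killed by \<open>\<psi>\<close>, so
    finitely many paths span the image; finiteness is what permits the embedding into
    sequences.\<close>
  define B where "B = (\<lambda>p. \<psi> (basis_path (u, p, v))) ` {p. set p \<subseteq> arcs G \<and> length p \<le> nil_bound}"
  have "finite B" unfolding B_def using finite_lists_length_le[OF finite_arcs] by blast
  then obtain \<tau> :: "(('a, 'b) path \<Rightarrow> 'k) \<Rightarrow> nat \<Rightarrow> 'k"
    where t: "Vector_Spaces.linear fscale scale \<tau>" "inj_on \<tau> (fs.span B)"
    using embed_finite_span by metis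
  have \<theta>: "Vector_Spaces.linear fscale scale (\<tau> \<circ> \<psi>)"
    using Vector_Spaces.linear_compose[OF psi t(1)] .
  have "\<psi> (basis_path (u, p, v)) \<in> fs.span B" if p: "(u, p, v) \<in> paths G" for p
  proof (cases "length p \<ge> nil_bound")
    case True
    then have "\<psi> (basis_path (u, p, v)) = 0"
      using r(3) long_path_in_ideal[OF p] basis_path_pspace[OF p] by (auto simp: \<psi>_def)
    then show ?thesis using fs.span_zero by metis
  next
    case False
    have "set p \<subseteq> arcs G" using p by (auto simp: paths_def)
    then show ?thesis using False by (intro fs.span_base) (auto simp: B_def)
  qed
  then have span: "\<psi> f \<in> fs.span B" if "f \<in> pspace u v" for f
  proof -
    have "\<psi> f = \<psi> (\<Sum>p | f (u, p, v) \<noteq> 0. fscale (f (u, p, v)) (basis_path (u, p, v)))"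
      by (rule arg_cong[OF pspace_expand(3)[OF that]])
    also have "\<dots> = (\<Sum>p | f (u, p, v) \<noteq> 0. fscale (f (u, p, v)) (\<psi> (basis_path (u, p, v))))"
      by (simp add: fsp.linear_sum[OF psi] fsp.linear_scale[OF psi])
    also have "\<dots> \<in> fs.span B"
      using pspace_expand(2)[OF that] \<open>\<And>p. (u, p, v) \<in> paths G \<Longrightarrow> \<psi> (basis_path (u, p, v)) \<in> fs.span B\<close>
      by (intro fs.span_sum fs.span_scale) blast
    finally show ?thesis .
  qed
  have "(\<tau> \<circ> \<psi>) ` pspace u v \<subseteq> seq.span (\<tau> ` B)"
    using span fss.linear_span_image[OF t(1), of B] by auto
  moreover have "fd_space (seq.span (\<tau> ` B))"
    using \<open>finite B\<close> unfolding fd_space_def by blast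
  ultimately have "fd_space ((\<tau> \<circ> \<psi>) ` pspace u v)"
    using fd_subset fss.linear_subspace_image[OF \<theta> subspace_pspace] by blast
  moreover have "(\<tau> \<circ> \<psi>) f = 0 \<longleftrightarrow> f \<in> I" if f: "f \<in> pspace u v" for f
  proof -
    have "\<tau> (\<psi> f) = 0 \<longleftrightarrow> \<psi> f = 0"
      using inj_onD[OF t(2), of "\<psi> f" 0] span[OF f] fs.span_zero fss.linear_0[OF t(1)] by metis
    also have "\<dots> \<longleftrightarrow> r f = f" unfolding \<psi>_def by (simp only: right_minus_eq) metis
    also have "\<dots> \<longleftrightarrow> f \<in> I" using r(1,3) f by (metis IntD1 IntI rangeI subsetD)
    finally show ?thesis by simp
  qed
  ultimately show ?thesis using \<theta> by blast
qed

definition coords :: "'a \<Rightarrow> 'a \<Rightarrow> (('a, 'b) path \<Rightarrow> 'k) \<Rightarrow> nat \<Rightarrow> 'k" where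
  "coords u v = (SOME \<theta>. Vector_Spaces.linear fscale scale \<theta> \<and> fd_space (\<theta> ` pspace u v) \<and>
     (\<forall>f\<in>pspace u v. \<theta> f = 0 \<longleftrightarrow> f \<in> I))"

lemma coords: "Vector_Spaces.linear fscale scale (coords u v)" "fd_space (coords u v ` pspace u v)"
  "f \<in> pspace u v \<Longrightarrow> coords u v f = 0 \<longleftrightarrow> f \<in> I"
  using someI_ex[OF coordinates_exist[of u v]] unfolding coords_def by blast+

lemma coords_eq_iff:
  assumes "f \<in> pspace u v" "g \<in> pspace u v"
  shows "coords u v f = coords u v g \<longleftrightarrow> f - g \<in> I"
proof -
  have "f - g \<in> pspace u v" using assms fs.subspace_diff[OF subspace_pspace] by blast
  then show ?thesis using coords(3) fss.linear_diff[OF coords(1), of u v f g] by (metis right_minus_eq)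
qed

text \<open>The right module \<open>e_u (kQ/I)\<close>, with coordinate vectors in place of cosets.
  An arrow multiplies a chosen representative; by \<open>free_rep_act\<close> the choice does not
  matter.\<close>

definition free_rep :: "'a \<Rightarrow> ('a, 'b, 'k) rep" where
  "free_rep u = \<lparr>space = (\<lambda>v. coords u v ` pspace u v),
     act = (\<lambda>a y. coords u (head G a)
       (inv_into (pspace u (tail G a)) (coords u (tail G a)) y \<otimes>\<^bsub>path_algebra G\<^esub> arrow G a))\<rparr>"

definition free_gen :: "'a \<Rightarrow> nat \<Rightarrow> 'k" where
  "free_gen u = coords u u (basis_path (u, [], u))"

lemma free_rep_space: "space (free_rep u) v = coords u v ` pspace u v"
  by (simp add: free_rep_def)

lemma arrow_pspace: "a \<in> arcs G \<Longrightarrow> arrow G a \<in> pspace (tail G a) (head G a)"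
  unfolding arrow_basis
  by (intro basis_path_pspace) (simp add: path_Cons_iff[OF wf_digraph_axioms] path_Nil_iff[OF wf_digraph_axioms])

lemma free_rep_act:
  assumes a: "a \<in> arcs G" and f: "f \<in> pspace u (tail G a)"
  shows "act (free_rep u) a (coords u (tail G a) f) = coords u (head G a) (f \<otimes>\<^bsub>path_algebra G\<^esub> arrow G a)"
proof -
  let ?h = "inv_into (pspace u (tail G a)) (coords u (tail G a)) (coords u (tail G a) f)"
  have h: "?h \<in> pspace u (tail G a)" "coords u (tail G a) ?h = coords u (tail G a) f"
    using f by (simp_all add: inv_into_into f_inv_into_f)
  then have "?h - f \<in> I" using coords_eq_iff f by blast
  then have "(?h - f) \<otimes>\<^bsub>path_algebra G\<^esub> arrow G a \<in> I"
    using ideal.I_r_closed[OF ideal_I] arrow_carrier[OF a] by blast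
  then have "?h \<otimes>\<^bsub>path_algebra G\<^esub> arrow G a - f \<otimes>\<^bsub>path_algebra G\<^esub> arrow G a \<in> I"
    using fsp.linear_diff[OF linear_mult_left] by metis
  then show ?thesis
    using coords_eq_iff[OF pspace_mult[OF h(1) arrow_pspace[OF a]] pspace_mult[OF f arrow_pspace[OF a]]]
    by (simp add: free_rep_def)
qed

lemma free_rep_fold:
  assumes "(w, p, v) \<in> paths G" "f \<in> pspace u w"
  shows "fold (act (free_rep u)) p (coords u w f) = coords u v (f \<otimes>\<^bsub>path_algebra G\<^esub> basis_path (w, p, v))"
  using assms
proof (induction p arbitrary: w f)
  case Nil
  then show ?case using mult_stationary by (simp add: path_Nil_iff[OF wf_digraph_axioms])
next
  case (Cons a p)
  then have a: "a \<in> arcs G" "w = tail G a" "(head G a, p, v) \<in> paths G"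
    by (simp_all add: path_Cons_iff[OF wf_digraph_axioms])
  have t: "(tail G a, [a], head G a) \<in> paths G"
    using a by (simp add: path_Cons_iff[OF wf_digraph_axioms] path_Nil_iff[OF wf_digraph_axioms])
  have f: "f \<otimes>\<^bsub>path_algebra G\<^esub> arrow G a \<in> pspace u (head G a)"
    using pspace_mult[OF _ arrow_pspace[OF a(1)]] Cons.prems(2) a(2) by blast
  have "f \<otimes>\<^bsub>path_algebra G\<^esub> arrow G a \<otimes>\<^bsub>path_algebra G\<^esub> basis_path (head G a, p, v) =
    f \<otimes>\<^bsub>path_algebra G\<^esub> basis_path (w, a # p, v)"
    unfolding path_algebra_mult_assoc arrow_basis basis_path_mult[OF t] a(2) by simp
  then show ?case
    using Cons.IH[OF a(3) f] free_rep_act[OF a(1), of f u] Cons.prems(2) a(2) by simp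
qed

lemma free_rep_mod: "free_rep u \<in> mod_of G I"
  unfolding mod_of_def mem_Collect_eq free_rep_space
proof (intro conjI ballI)
  show "fd_space (coords u v ` pspace u v)" for v by (rule coords(2))
next
  fix a assume a: "a \<in> arcs G"
  let ?t = "coords u (tail G a)" and ?h = "coords u (head G a)"
  show "linear_map (?t ` pspace u (tail G a)) (?h ` pspace u (head G a)) (act (free_rep u) a)"
    unfolding linear_map_def
  proof (intro conjI ballI allI)
    fix y assume "y \<in> ?t ` pspace u (tail G a)"
    then obtain f where f: "f \<in> pspace u (tail G a)" "y = ?t f" by blast
    show "act (free_rep u) a y \<in> ?h ` pspace u (head G a)"
      using free_rep_act[OF a f(1)] pspace_mult[OF f(1) arrow_pspace[OF a]] f(2) by blast
    show "act (free_rep u) a (scale c y) = scale c (act (free_rep u) a y)" for c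
    proof -
      have "act (free_rep u) a (scale c y) = act (free_rep u) a (?t (fscale c f))"
        using fss.linear_scale[OF coords(1)] f(2) by metis
      also have "\<dots> = ?h (fscale c f \<otimes>\<^bsub>path_algebra G\<^esub> arrow G a)"
        using free_rep_act[OF a fs.subspace_scale[OF subspace_pspace f(1)]] .
      also have "\<dots> = scale c (?h (f \<otimes>\<^bsub>path_algebra G\<^esub> arrow G a))"
        using fsp.linear_scale[OF linear_mult_left] fss.linear_scale[OF coords(1)] by metis
      finally show ?thesis using free_rep_act[OF a f(1)] f(2) by simp
    qed
    fix z assume "z \<in> ?t ` pspace u (tail G a)"
    then obtain g where g: "g \<in> pspace u (tail G a)" "z = ?t g" by blast
    have "act (free_rep u) a (y + z) = act (free_rep u) a (?t (f + g))"
      using fss.linear_add[OF coords(1)] f(2) g(2) by metis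
    also have "\<dots> = ?h ((f + g) \<otimes>\<^bsub>path_algebra G\<^esub> arrow G a)"
      using free_rep_act[OF a fs.subspace_add[OF subspace_pspace f(1) g(1)]] .
    also have "\<dots> = ?h (f \<otimes>\<^bsub>path_algebra G\<^esub> arrow G a) + ?h (g \<otimes>\<^bsub>path_algebra G\<^esub> arrow G a)"
      using fsp.linear_add[OF linear_mult_left] fss.linear_add[OF coords(1)] by metis
    finally show "act (free_rep u) a (y + z) = act (free_rep u) a y + act (free_rep u) a z"
      using free_rep_act[OF a f(1)] f(2) free_rep_act[OF a g(1)] g(2) by metis
  qed
next
  fix \<rho> w v y assume \<rho>: "\<rho> \<in> I" and wv: "w \<in> verts G" "v \<in> verts G" and "y \<in> coords u w ` pspace u w"
  then obtain f where f: "f \<in> pspace u w" "y = coords u w f" by blast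
  \<comment> \<open>Only the paths from \<open>w\<close> to \<open>v\<close> enter the condition,
    and they form an element of \<open>I\<close> by themselves; the sum then becomes the coordinate
    vector of \<open>f\<close> times that element.\<close>
  let ?\<rho> = "corner w v \<rho>"
  have r: "?\<rho> \<in> I" "?\<rho> \<in> pspace w v" using corner_in_ideal[OF ideal_I \<rho> wv] by auto
  have eq: "?\<rho> (w, p, v) = \<rho> (w, p, v)" for p by (simp add: corner_def)
  let ?L = "\<lambda>g. coords u v (f \<otimes>\<^bsub>path_algebra G\<^esub> g)"
  have L: "Vector_Spaces.linear fscale scale ?L"
    using Vector_Spaces.linear_compose[OF linear_mult_right coords(1)] by (simp add: comp_def)
  have "(\<Sum>p | \<rho> (w, p, v) \<noteq> 0. scale (\<rho> (w, p, v)) (fold (act (free_rep u)) p y)) = ?L ?\<rho>"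
    unfolding pspace_linear[OF r(2) L] eq
    using pspace_expand(2)[OF r(2)] free_rep_fold[OF _ f(1)] f(2) by (intro sum.cong) (auto simp: eq)
  also have "\<dots> = 0"
    using coords(3)[OF pspace_mult[OF f(1) r(2)]] ideal.I_l_closed[OF ideal_I r(1)] f(1)
    by (auto simp: pspace_def)
  finally show "(\<Sum>p | \<rho> (w, p, v) \<noteq> 0. scale (\<rho> (w, p, v)) (fold (act (free_rep u)) p y)) = 0" .
qed

lemma free_gen_mem: "u \<in> verts G \<Longrightarrow> free_gen u \<in> space (free_rep u) u"
  unfolding free_rep_space free_gen_def
  using basis_path_pspace path_Nil_iff[OF wf_digraph_axioms] by blast

lemma free_rep_fold_gen:
  assumes "(u, p, v) \<in> paths G"
  shows "fold (act (free_rep u)) p (free_gen u) = coords u v (basis_path (u, p, v))"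
proof -
  have "u \<in> verts G" using assms by (auto simp: paths_def)
  then have u: "(u, [], u) \<in> paths G" by (simp add: path_Nil_iff[OF wf_digraph_axioms])
  show ?thesis
    unfolding free_gen_def free_rep_fold[OF assms basis_path_pspace[OF u]] basis_path_mult[OF u] by simp
qed

text \<open>Consequently a morphism out of \<open>free_rep u\<close> is determined by its value on
  \<open>free_gen u\<close>; \<open>projective_free\<close> compares morphisms in this way.\<close>

lemma free_rep_generated:
  "space (free_rep u) v \<subseteq> seq.span {fold (act (free_rep u)) p (free_gen u) | p. (u, p, v) \<in> paths G}"
proof
  fix y assume "y \<in> space (free_rep u) v"
  then obtain f where f: "f \<in> pspace u v" "y = coords u v f" unfolding free_rep_space by blast
  have "y = (\<Sum>p | f (u, p, v) \<noteq> 0. scale (f (u, p, v)) (coords u v (basis_path (u, p, v))))"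
    unfolding f(2) by (rule pspace_linear[OF f(1) coords(1)])
  also have "\<dots> \<in> seq.span {fold (act (free_rep u)) p (free_gen u) | p. (u, p, v) \<in> paths G}"
  proof (intro seq.span_sum seq.span_scale seq.span_base)
    fix p assume "p \<in> {p. f (u, p, v) \<noteq> 0}"
    then have "(u, p, v) \<in> paths G" using pspace_expand(2)[OF f(1)] by blast
    then show "coords u v (basis_path (u, p, v)) \<in> {fold (act (free_rep u)) p (free_gen u) | p. (u, p, v) \<in> paths G}"
      using free_rep_fold_gen by force
  qed
  finally show "y \<in> seq.span {fold (act (free_rep u)) p (free_gen u) | p. (u, p, v) \<in> paths G}" .
qed

text \<open>Yoneda's lemma for \<open>e_u\<close>: the map that lets a path act on \<open>m\<close>
  kills the relations because \<open>M\<close> is bound by \<open>I\<close>, hence factors through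
  the coordinates.\<close>

lemma free_rep_universal:
  assumes M: "M \<in> mod_of G I" and u: "u \<in> verts G" and m: "m \<in> space M u"
  obtains h where "rep_hom G (free_rep u) M h" "h u (free_gen u) = m"
proof -
  have "fs.independent (range basis_path :: (('a, 'b) path \<Rightarrow> 'k) set)"
    unfolding basis_path_delta by (rule independent_delta)
  \<comment> \<open>Since \<open>basis_path\<close> is injective, a basis element can be decoded to
    its path; the list of arrows is the middle component of the triple.\<close>
  from fss.linear_independent_extend[OF this, of "\<lambda>b. fold (act M) (fst (snd (inv_into UNIV basis_path b))) m"]
  obtain ev :: "(('a, 'b) path \<Rightarrow> 'k) \<Rightarrow> nat \<Rightarrow> 'k" where ev: "Vector_Spaces.linear fscale scale ev"
    "\<forall>b\<in>range basis_path. ev b = fold (act M) (fst (snd (inv_into UNIV basis_path b))) m" by blast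
  have "inj (basis_path :: ('a, 'b) path \<Rightarrow> _ \<Rightarrow> 'k)" unfolding basis_path_delta by (rule delta_inj)
  then have evb: "ev (basis_path (u', p, v)) = fold (act M) p m" for u' p v
    using ev(2) inv_into_f_f[OF \<open>inj (basis_path :: ('a, 'b) path \<Rightarrow> _ \<Rightarrow> 'k)\<close> UNIV_I, of "(u', p, v)"] by simp
  have ev_mem: "ev f \<in> space M v" if f: "f \<in> pspace u v" and v: "v \<in> verts G" for f v
    unfolding pspace_linear[OF f ev(1)] evb
  proof (rule seq.subspace_sum[OF mod_subspace[OF M v]])
    fix p assume "p \<in> {p. f (u, p, v) \<noteq> 0}"
    then have "(u, p, v) \<in> paths G" using pspace_expand(2)[OF f] by blast
    then have "fold (act M) p m \<in> space M v" using fold_act_linear[OF M] m unfolding linear_map_def by blast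
    then show "scale (f (u, p, v)) (fold (act M) p m) \<in> space M v"
      using seq.subspace_scale[OF mod_subspace[OF M v]] by blast
  qed
  have ev_I: "ev f = 0" if f: "f \<in> pspace u v" "f \<in> I" and v: "v \<in> verts G" for f v
    unfolding pspace_linear[OF f(1) ev(1)] evb using M f u v m unfolding mod_of_def by blast
  define h where "h = (\<lambda>v y. ev (inv_into (pspace u v) (coords u v) y))"
  have h: "h v (coords u v f) = ev f" if f: "f \<in> pspace u v" and v: "v \<in> verts G" for f v
  proof -
    let ?g = "inv_into (pspace u v) (coords u v) (coords u v f)"
    have g: "?g \<in> pspace u v" "coords u v ?g = coords u v f"
      using f by (simp_all add: inv_into_into f_inv_into_f)
    then have "?g - f \<in> I" "?g - f \<in> pspace u v"
      using coords_eq_iff f fs.subspace_diff[OF subspace_pspace] by blast+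
    then have "ev (?g - f) = 0" using ev_I v by blast
    then show ?thesis unfolding h_def using fss.linear_diff[OF ev(1)] by (metis right_minus_eq)
  qed
  have "rep_hom G (free_rep u) M h"
    unfolding rep_hom_def free_rep_space
  proof (intro conjI ballI)
    fix v assume v: "v \<in> verts G"
    show "linear_map (coords u v ` pspace u v) (space M v) (h v)"
      unfolding linear_map_def
    proof (intro conjI ballI allI)
      fix y assume "y \<in> coords u v ` pspace u v"
      then obtain f where f: "f \<in> pspace u v" "y = coords u v f" by blast
      show "h v y \<in> space M v" using h[OF f(1) v] ev_mem[OF f(1) v] f(2) by simp
      show "h v (scale c y) = scale c (h v y)" for c
        using h[OF fs.subspace_scale[OF subspace_pspace f(1), of c] v] h[OF f(1) v] f(2)
          fss.linear_scale[OF ev(1)] fss.linear_scale[OF coords(1)] by metis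
      fix z assume "z \<in> coords u v ` pspace u v"
      then obtain g where g: "g \<in> pspace u v" "z = coords u v g" by blast
      show "h v (y + z) = h v y + h v z"
        using h[OF fs.subspace_add[OF subspace_pspace f(1) g(1)] v] h[OF f(1) v] h[OF g(1) v] f(2) g(2)
          fss.linear_add[OF ev(1)] fss.linear_add[OF coords(1)] by metis
    qed
  next
    fix a y assume a: "a \<in> arcs G" and "y \<in> coords u (tail G a) ` pspace u (tail G a)"
    then obtain f where f: "f \<in> pspace u (tail G a)" "y = coords u (tail G a) f" by blast
    have th: "tail G a \<in> verts G" "head G a \<in> verts G" using a by auto
    obtain A where A: "Vector_Spaces.linear scale scale A" "\<And>z. z \<in> space M (tail G a) \<Longrightarrow> A z = act M a z"
      using linear_map_extend[OF mod_subspace[OF M th(1)] mod_act[OF M a]] by blast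
    let ?L = "\<lambda>g. ev (g \<otimes>\<^bsub>path_algebra G\<^esub> arrow G a)" and ?L' = "\<lambda>g. A (ev g)"
    have L: "Vector_Spaces.linear fscale scale ?L" "Vector_Spaces.linear fscale scale ?L'"
      using Vector_Spaces.linear_compose[OF linear_mult_left ev(1)] Vector_Spaces.linear_compose[OF ev(1) A(1)]
      by (simp_all add: comp_def)
    have "?L (basis_path (u, p, tail G a)) = ?L' (basis_path (u, p, tail G a))" if "f (u, p, tail G a) \<noteq> 0" for p
    proof -
      have p: "(u, p, tail G a) \<in> paths G" using pspace_expand(2)[OF f(1)] that by blast
      have "fold (act M) p m \<in> space M (tail G a)" using fold_act_linear[OF M p] m unfolding linear_map_def by blast
      then show ?thesis
        unfolding arrow_basis basis_path_mult[OF p] evb by (simp add: A(2))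
    qed
    then have "?L f = ?L' f"
      unfolding pspace_linear[OF f(1) L(1)] pspace_linear[OF f(1) L(2)] by (intro sum.cong) auto
    then show "h (head G a) (act (free_rep u) a y) = act M a (h (tail G a) y)"
      using free_rep_act[OF a f(1)] h[OF pspace_mult[OF f(1) arrow_pspace[OF a]] th(2)] h[OF f(1) th(1)]
        A(2)[OF ev_mem[OF f(1) th(1)]] f(2) by simp
  qed
  moreover have "h u (free_gen u) = m"
    unfolding free_gen_def
    using h[OF basis_path_pspace u, of "[]"] evb u path_Nil_iff[OF wf_digraph_axioms] by simp
  ultimately show thesis using that by blast
qed

end

section \<open>Projective covers and syzygies\<close>

lemma (in fin_digraph) rep_hom_add:
  assumes "M \<in> mod_of G I" "N \<in> mod_of G I" "rep_hom G M N f" "rep_hom G M N g"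
  shows "rep_hom G M N (\<lambda>x m. f x m + g x m)"
  using rep_hom_diff[OF assms(1-3) rep_hom_diff[OF assms(1,2) rep_hom_zero[OF assms(1,2)] assms(4)]] by simp

lemma (in fin_digraph) rep_hom_fold:
  assumes "M \<in> mod_of G I" "rep_hom G M N f" "(u, p, v) \<in> paths G" "m \<in> space M u"
  shows "f v (fold (act M) p m) = fold (act N) p (f u m)"
  using assms(3,4)
proof (induction p arbitrary: u m)
  case Nil
  then show ?case by (simp add: path_Nil_iff[OF wf_digraph_axioms])
next
  case (Cons a p)
  then have a: "a \<in> arcs G" "u = tail G a" "(head G a, p, v) \<in> paths G"
    by (simp_all add: path_Cons_iff[OF wf_digraph_axioms])
  have "m \<in> space M (tail G a)" using Cons.prems a by simp
  then show ?case
    using Cons.IH[OF a(3) mod_act_mem[OF assms(1) a(1)]] rep_hom_act[OF assms(2) a(1)] a(2) by simp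
qed

lemma (in fin_digraph) rep_hom_dsum:
  assumes M: "M \<in> mod_of G I" "M' \<in> mod_of G I" and N: "N \<in> mod_of G I" "N' \<in> mod_of G I"
    and f: "rep_hom G M N f" "rep_hom G M' N' f'"
  shows "rep_hom G (dsum M M') (dsum N N') (\<lambda>x z. interleave (f x (deint0 z)) (f' x (deint1 z)))"
proof -
  note D = rep_hom_deint[OF M] and J = rep_hom_inj[OF N]
  note * = rep_hom_comp[OF rep_hom_comp[OF D(1) f(1)] J(1)] rep_hom_comp[OF rep_hom_comp[OF D(2) f(2)] J(2)]
  show ?thesis
    using rep_hom_add[OF dsum_mod[OF M] dsum_mod[OF N] *] by (simp only: interleave_add add_0_left add_0_right)
qed

context bound_quiver_algebra
begin

abbreviation "projective \<equiv> projective_rep G I"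
abbreviation "\<Omega> \<equiv> syzygy G I"

lemma projective_mod: "projective P \<Longrightarrow> P \<in> mod_of G I"
  unfolding projective_rep_def by blast

lemma projective_lift:
  assumes "projective P" "M \<in> mod_of G I" "N \<in> mod_of G I" "rep_epi G M N e" "rep_hom G P N f"
  obtains g where "rep_hom G P M g" "\<And>x z. x \<in> verts G \<Longrightarrow> z \<in> space P x \<Longrightarrow> e x (g x z) = f x z"
proof -
  have "\<exists>g. rep_hom G P M g \<and> (\<forall>x\<in>verts G. \<forall>z\<in>space P x. e x (g x z) = f x z)"
    using assms unfolding projective_rep_def by simp
  then show thesis using that by blast
qed

lemma rep_epi_hom: "rep_epi G M N e \<Longrightarrow> rep_hom G M N e"
  unfolding rep_epi_def by blast

lemma rep_epi_surj: "rep_epi G M N e \<Longrightarrow> x \<in> verts G \<Longrightarrow> e x ` space M x = space N x"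
  unfolding rep_epi_def by blast

text \<open>Surjectivity of \<open>e\<close> is used at the generator only; the resulting morphism
  is a lift everywhere because the images of the generator under paths span.\<close>

lemma projective_free:
  assumes u: "u \<in> verts G" shows "projective (free_rep u)"
  unfolding projective_rep_def
proof (intro conjI ballI allI impI)
  show F: "free_rep u \<in> mod_of G I" by (rule free_rep_mod)
  fix M N :: "('a, 'b, 'k) rep" and e f
  assume M: "M \<in> mod_of G I" and N: "N \<in> mod_of G I" and "rep_epi G M N e \<and> rep_hom G (free_rep u) N f"
  then have e: "rep_epi G M N e" and f: "rep_hom G (free_rep u) N f" by blast+
  have "f u (free_gen u) \<in> e u ` space M u"
    using rep_hom_mem[OF f u free_gen_mem[OF u]] rep_epi_surj[OF e u] by simp
  then obtain m where m: "m \<in> space M u" "e u m = f u (free_gen u)" by auto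
  obtain h where h: "rep_hom G (free_rep u) M h" "h u (free_gen u) = m"
    using free_rep_universal[OF M u m(1)] by blast
  note eh = rep_hom_comp[OF h(1) rep_epi_hom[OF e]]
  have "e x (h x z) = f x z" if x: "x \<in> verts G" and z: "z \<in> space (free_rep u) x" for x z
  proof -
    obtain L where L: "Vector_Spaces.linear scale scale L" "\<And>z. z \<in> space (free_rep u) x \<Longrightarrow> L z = e x (h x z)"
      using linear_map_extend[OF mod_subspace[OF F x] rep_hom_linear[OF eh x]] by metis
    obtain L' where L': "Vector_Spaces.linear scale scale L'" "\<And>z. z \<in> space (free_rep u) x \<Longrightarrow> L' z = f x z"
      using linear_map_extend[OF mod_subspace[OF F x] rep_hom_linear[OF f x]] by metis
    have "L z = L' z"
    proof (rule seq.linear_eq_on[OF L(1) L'(1)])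
      show "z \<in> seq.span {fold (act (free_rep u)) p (free_gen u) | p. (u, p, x) \<in> paths G}"
        using z free_rep_generated by blast
      fix b assume "b \<in> {fold (act (free_rep u)) p (free_gen u) | p. (u, p, x) \<in> paths G}"
      then obtain p where p: "(u, p, x) \<in> paths G" "b = fold (act (free_rep u)) p (free_gen u)" by blast
      have "b \<in> space (free_rep u) x"
        using fold_act_linear[OF F p(1)] free_gen_mem[OF u] p(2) unfolding linear_map_def by blast
      then show "L b = L' b"
        using L(2) L'(2) rep_hom_fold[OF F eh p(1) free_gen_mem[OF u]] rep_hom_fold[OF F f p(1) free_gen_mem[OF u]]
          m(2) h(2) p(2) by simp
    qed
    then show ?thesis using L(2) L'(2) z by simp
  qed
  then show "\<exists>g. rep_hom G (free_rep u) M g \<and> (\<forall>x\<in>verts G. \<forall>z\<in>space (free_rep u) x. e x (g x z) = f x z)"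
    using h(1) by blast
qed

lemma projective_retract:
  assumes "projective P" "additive.retract I L P"
  shows "projective L"
  unfolding projective_rep_def
proof (intro conjI ballI allI impI)
  obtain i p where ip: "i \<in> mod_hom G I L P" "p \<in> mod_hom G I P L" "mod_cmp p i = mod_id G L"
    using assms(2) unfolding additive.retract_def by blast
  then show "L \<in> mod_of G I" using mod_hom_mod by blast
  fix M N :: "('a, 'b, 'k) rep" and e f
  assume MN: "M \<in> mod_of G I" "N \<in> mod_of G I" and "rep_epi G M N e \<and> rep_hom G L N f"
  then have e: "rep_epi G M N e" and f: "rep_hom G L N f" by blast+
  obtain g where g: "rep_hom G P M g" "\<And>x z. x \<in> verts G \<Longrightarrow> z \<in> space P x \<Longrightarrow> e x (g x z) = f x (p x z)"
    using projective_lift[OF assms(1) MN e rep_hom_comp[OF mod_hom_rep_hom[OF ip(2)] f]] by metis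
  have "e x (g x (i x z)) = f x z" if "x \<in> verts G" "z \<in> space L x" for x z
    using g(2)[OF that(1) rep_hom_mem[OF mod_hom_rep_hom[OF ip(1)] that]] mod_cmp_eq_id[OF ip(3) that] by simp
  then show "\<exists>g. rep_hom G L M g \<and> (\<forall>x\<in>verts G. \<forall>z\<in>space L x. e x (g x z) = f x z)"
    using rep_hom_comp[OF mod_hom_rep_hom[OF ip(1)] g(1)] by blast
qed

lemma projective_dsum:
  assumes P: "projective P" and P': "projective P'"
  shows "projective (dsum P P')"
  unfolding projective_rep_def
proof (intro conjI ballI allI impI)
  have PM: "P \<in> mod_of G I" "P' \<in> mod_of G I" using assms projective_mod by blast+
  then show D: "dsum P P' \<in> mod_of G I" by (rule dsum_mod)
  fix M N :: "('a, 'b, 'k) rep" and e f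
  assume MN: "M \<in> mod_of G I" "N \<in> mod_of G I" and "rep_epi G M N e \<and> rep_hom G (dsum P P') N f"
  then have e: "rep_epi G M N e" and f: "rep_hom G (dsum P P') N f" by blast+
  obtain g where g: "rep_hom G P M g" "\<And>x z. x \<in> verts G \<Longrightarrow> z \<in> space P x \<Longrightarrow> e x (g x z) = f x (interleave z 0)"
    using projective_lift[OF P MN e rep_hom_comp[OF rep_hom_inj(1)[OF PM] f]] by metis
  obtain g' where g': "rep_hom G P' M g'" "\<And>x z. x \<in> verts G \<Longrightarrow> z \<in> space P' x \<Longrightarrow> e x (g' x z) = f x (interleave 0 z)"
    using projective_lift[OF P' MN e rep_hom_comp[OF rep_hom_inj(2)[OF PM] f]] by metis
  let ?h = "\<lambda>x z. g x (deint0 z) + g' x (deint1 z)"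
  have h: "rep_hom G (dsum P P') M ?h"
    using rep_hom_add[OF D MN(1) rep_hom_comp[OF rep_hom_deint(1)[OF PM] g(1)]
      rep_hom_comp[OF rep_hom_deint(2)[OF PM] g'(1)]] .
  have "e x (?h x z) = f x z" if x: "x \<in> verts G" and z: "z \<in> space (dsum P P') x" for x z
  proof -
    have z': "deint0 z \<in> space P x" "deint1 z \<in> space P' x" using z by (auto simp: dsum_space)
    have m: "g x (deint0 z) \<in> space M x" "g' x (deint1 z) \<in> space M x"
      using rep_hom_mem[OF g(1) x z'(1)] rep_hom_mem[OF g'(1) x z'(2)] .
    have "e x (?h x z) = e x (g x (deint0 z)) + e x (g' x (deint1 z))"
      using rep_hom_linear[OF rep_epi_hom[OF e] x] m unfolding linear_map_def by blast
    also have "\<dots> = f x (interleave (deint0 z) 0) + f x (interleave 0 (deint1 z))"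
      using g(2)[OF x z'(1)] g'(2)[OF x z'(2)] by metis
    also have "\<dots> = f x (interleave (deint0 z) 0 + interleave 0 (deint1 z))"
    proof -
      have "interleave (deint0 z) 0 \<in> space (dsum P P') x" "interleave 0 (deint1 z) \<in> space (dsum P P') x"
        using z' mod_0[OF PM(1) x] mod_0[OF PM(2) x] by simp_all
      then show ?thesis using rep_hom_linear[OF f x] unfolding linear_map_def by metis
    qed
    also have "\<dots> = f x z" by (simp add: interleave_add)
    finally show ?thesis .
  qed
  then show "\<exists>g. rep_hom G (dsum P P') M g \<and> (\<forall>x\<in>verts G. \<forall>z\<in>space (dsum P P') x. e x (g x z) = f x z)"
    using h by blast
qed

lemma projective_isom: "projective P \<Longrightarrow> additive.isom I L P \<Longrightarrow> projective L"
  using projective_retract additive.retract_isom by blast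

lemma projective_zero: "projective zero_rep"
  unfolding projective_rep_def
proof (intro conjI ballI allI impI)
  show "zero_rep \<in> mod_of G I" by (rule zero_rep_mod)
  fix M N :: "('a, 'b, 'k) rep" and e f
  assume MN: "M \<in> mod_of G I" "N \<in> mod_of G I" and ef: "rep_epi G M N e \<and> rep_hom G zero_rep N f"
  have "e x 0 = f x z" if "x \<in> verts G" "z \<in> space zero_rep x" for x z
    using that rep_hom_0[OF zero_rep_mod[of I], of N f x] rep_hom_0[OF MN(1), of N e x] ef
    by (simp add: rep_epi_def zero_rep_def)
  then show "\<exists>g. rep_hom G zero_rep M g \<and> (\<forall>x\<in>verts G. \<forall>z\<in>space zero_rep x. e x (g x z) = f x z)"
    using rep_hom_zero[OF zero_rep_mod MN(1)] by (intro exI[of _ "\<lambda>x m. 0"]) blast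
qed

lemma free_cover_finite:
  assumes M: "M \<in> mod_of G I" and "finite S" "\<And>x m. (x, m) \<in> S \<Longrightarrow> x \<in> verts G \<and> m \<in> space M x"
  shows "\<exists>P f. projective P \<and> cat.add_closure I (free_rep ` verts G) P \<and> rep_hom G P M f \<and>
    (\<forall>(x, m)\<in>S. m \<in> f x ` space P x)"
  using assms(2,3)
proof (induction S rule: finite_induct)
  case empty
  then show ?case
    using projective_zero rep_hom_zero[OF zero_rep_mod M] cat.add_closure.zero[OF zero_rep_null] by blast
next
  case (insert s S)
  obtain u m where s: "s = (u, m)" by (cases s)
  then have um: "u \<in> verts G" "m \<in> space M u" using insert.prems by auto
  obtain P f where P: "projective P" "cat.add_closure I (free_rep ` verts G) P" "rep_hom G P M f"
    "\<forall>(x, m)\<in>S. m \<in> f x ` space P x"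
    using insert by blast
  have PM: "P \<in> mod_of G I" using P(1) projective_mod by blast
  obtain h where h: "rep_hom G (free_rep u) M h" "h u (free_gen u) = m"
    using free_rep_universal[OF M um] by blast
  let ?Q = "dsum (free_rep u) P" and ?g = "\<lambda>x z. h x (deint0 z) + f x (deint1 z)"
  have F: "free_rep u \<in> mod_of G I" by (rule free_rep_mod)
  have "free_rep u \<in> free_rep ` verts G" using um(1) by blast
  from cat.add_closure.base[OF this additive.retract_isom[OF additive.isom_refl[OF F]]]
  have "cat.add_closure I (free_rep ` verts G) (free_rep u)" .
  then have 1: "cat.add_closure I (free_rep ` verts G) ?Q"
    using cat.add_closure.sum[OF decomp_dsum[OF F PM]] P(2) by blast
  have 2: "rep_hom G ?Q M ?g"
    using rep_hom_add[OF dsum_mod[OF F PM] M rep_hom_comp[OF rep_hom_deint(1)[OF F PM] h(1)]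
      rep_hom_comp[OF rep_hom_deint(2)[OF F PM] P(3)]] .
  have "n \<in> ?g x ` space ?Q x" if n: "(x, n) \<in> insert s S" for x n
  proof (cases "(x, n) = s")
    case True
    then have "n = ?g x (interleave (free_gen u) 0)"
      using s h(2) rep_hom_0[OF PM P(3) um(1)] by simp
    moreover have "interleave (free_gen u) 0 \<in> space ?Q x"
      using True s free_gen_mem[OF um(1)] mod_0[OF PM um(1)] by simp
    ultimately show ?thesis by blast
  next
    case False
    then have "(x, n) \<in> S" using n by blast
    then obtain z where z: "z \<in> space P x" "n = f x z" and x: "x \<in> verts G" using P(4) insert.prems by blast
    then have "n = ?g x (interleave 0 z)" using rep_hom_0[OF F h(1) x] by simp
    moreover have "interleave 0 z \<in> space ?Q x" using z mod_0[OF F x] by simp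
    ultimately show ?thesis by blast
  qed
  then show ?case using projective_dsum[OF projective_free[OF um(1)] P(1)] 1 2 by blast
qed

lemma enough_projectives:
  assumes M: "M \<in> mod_of G I"
  obtains P f where "projective P" "cat.add_closure I (free_rep ` verts G) P" "rep_epi G P M f"
proof -
  have "\<exists>B. finite B \<and> space M x = seq.span B" if "x \<in> verts G" for x
    using mod_fd[OF M that] unfolding fd_space_def by blast
  then obtain B where B: "\<And>x. x \<in> verts G \<Longrightarrow> finite (B x) \<and> space M x = seq.span (B x)" by metis
  define S where "S = Sigma (verts G) B"
  have "finite S" unfolding S_def using B by (intro finite_SigmaI) simp_all
  moreover have "x \<in> verts G \<and> m \<in> space M x" if "(x, m) \<in> S" for x m
    using that B seq.span_base unfolding S_def by auto
  ultimately obtain P f where P: "projective P" "cat.add_closure I (free_rep ` verts G) P" "rep_hom G P M f"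
    "\<forall>(x, m)\<in>S. m \<in> f x ` space P x"
    using free_cover_finite[OF M, of S] by blast
  have "f x ` space P x = space M x" if x: "x \<in> verts G" for x
  proof
    show "f x ` space P x \<subseteq> space M x" using rep_hom_mem[OF P(3) x] by blast
    have "seq.subspace (f x ` space P x)"
      using linear_map_image[OF mod_subspace[OF projective_mod[OF P(1)] x] rep_hom_linear[OF P(3) x]]
        mod_subspace[OF projective_mod[OF P(1)] x] by blast
    moreover have "B x \<subseteq> f x ` space P x" using P(4) x unfolding S_def by blast
    ultimately show "space M x \<subseteq> f x ` space P x" using B[OF x] seq.span_minimal by metis
  qed
  then show thesis using that P(1-3) unfolding rep_epi_def by blast
qed

text \<open>A cover of \<open>P\<close> by a sum of the \<open>free_rep u\<close> splits, so
  \<open>P\<close> is a retract of such a sum; each indecomposable retract of the sum is one of a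
  single \<open>free_rep u\<close> by \<open>retract_decomp\<close>. Hence finitely many modules
  account for all projectives.\<close>

lemma projective_add_free:
  assumes "projective P"
  shows "cat.add_closure I (free_rep ` verts G) P"
proof -
  have PM: "P \<in> mod_of G I" using assms projective_mod by blast
  obtain Q e where Q: "projective Q" "cat.add_closure I (free_rep ` verts G) Q" "rep_epi G Q P e"
    using enough_projectives[OF PM] by blast
  have QM: "Q \<in> mod_of G I" using Q projective_mod by blast
  obtain s where s: "rep_hom G P Q s" "\<And>x z. x \<in> verts G \<Longrightarrow> z \<in> space P x \<Longrightarrow> e x (s x z) = z"
    using projective_lift[OF assms QM PM Q(3) rep_hom_id] by metis
  have eh: "rep_hom G Q P e" using Q(3) rep_epi_hom by blast
  have n: "normalize_map G P s \<in> mod_hom G I P Q" "normalize_map G Q e \<in> mod_hom G I Q P"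
    using normalize_hom[OF PM QM s(1)] normalize_hom[OF QM PM eh] .
  have "mod_cmp (normalize_map G Q e) (normalize_map G P s) = mod_id G P"
    by (rule mod_hom_eqI[OF mod_cmp_hom[OF n(2,1)] mod_id_hom[OF PM]])
      (simp add: mod_cmp_def s(2) rep_hom_mem[OF s(1)])
  then have PQ: "additive.retract I P Q" unfolding additive.retract_def using n by blast
  have "additive.retract I L Q \<longrightarrow> cat.add_closure I (free_rep ` verts G) L" if "L \<in> mod_of G I" for L
    using that
  proof (induction L rule: cat.decomp_induct[where I = I, consumes 1])
    case (null M)
    then show ?case using cat.add_closure.zero by blast
  next
    case (indecomposable L)
    have "additive.retract I L N \<longrightarrow> (\<exists>V\<in>free_rep ` verts G. additive.retract I L V)"
      if "cat.add_closure I (free_rep ` verts G) N" for N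
      using that
    proof induction
      case (zero N)
      then show ?case using additive.retract_null indecomposable unfolding additive.indecomposable_def by blast
    next
      case (base V N)
      then show ?case using additive.retract_trans by blast
    next
      case (sum N A B)
      then show ?case using cat.retract_decomp[OF indecomposable] by blast
    qed
    then show ?case using Q(2) cat.add_closure.base by blast
  next
    case (decomp M A B)
    then show ?case
      using additive.retract_trans[OF additive.decomp_retract] additive.decomp_sym cat.add_closure.sum by blast
  qed
  then show ?thesis using PM PQ by blast
qed

text \<open>Among all epimorphisms from projectives onto \<open>M\<close> one of least total
  dimension is a cover. The idea for superfluity of its kernel: a subrepresentation \<open>U\<close>
  that still maps onto \<open>M\<close> yields an endomorphism of \<open>P\<close> with image in
  \<open>U\<close>, and by Fitting's decomposition and minimality that endomorphism is onto.\<close>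

lemma projective_cover_exists:
  assumes M: "M \<in> mod_of G I"
  shows "\<exists>P f. projective_cover G I M P f"
proof -
  obtain P0 f0 where P0: "projective P0" "rep_epi G P0 M f0" using enough_projectives[OF M] by blast
  have "\<exists>Pf. (projective (fst Pf) \<and> rep_epi G (fst Pf) M (snd Pf)) \<and>
    (\<forall>Pg. projective (fst Pg) \<and> rep_epi G (fst Pg) M (snd Pg) \<longrightarrow> total_dim G (fst Pf) \<le> total_dim G (fst Pg))"
    by (rule ex_has_least_nat[where k = "(P0, f0)"]) (use P0 in simp)
  then obtain Pf where Pf: "projective (fst Pf) \<and> rep_epi G (fst Pf) M (snd Pf)"
    "\<And>Pg. projective (fst Pg) \<and> rep_epi G (fst Pg) M (snd Pg) \<Longrightarrow> total_dim G (fst Pf) \<le> total_dim G (fst Pg)"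
    by blast
  obtain P f where [simp]: "Pf = (P, f)" by (cases Pf)
  have P: "projective P" "rep_epi G P M f" using Pf(1) by auto
  have min: "total_dim G P \<le> total_dim G Q" if "projective Q" "rep_epi G Q M g" for Q g
    using Pf(2)[of "(Q, g)"] that by simp
  have PM: "P \<in> mod_of G I" using P projective_mod by blast
  note fh = rep_epi_hom[OF P(2)]
  let ?K = "space (kernel_rep P f)"
  have "U v = space P v"
    if U: "subrep G P U" and KU: "\<And>x. x \<in> verts G \<Longrightarrow> {l + u | l u. l \<in> ?K x \<and> u \<in> U x} = space P x" and v: "v \<in> verts G" for U v
  proof -
    let ?S = "sub_rep P U"
    have S: "?S \<in> mod_of G I" using sub_rep_mod[OF PM U] .
    have Usub: "U x \<subseteq> space P x" if "x \<in> verts G" for x using U that unfolding subrep_def by blast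
    have "rep_epi G ?S M f"
      unfolding rep_epi_def
    proof (intro conjI ballI)
      show "rep_hom G ?S M f" using rep_hom_restrict_sub[OF fh U] .
      fix x assume x: "x \<in> verts G"
      show "f x ` space ?S x = space M x"
      proof
        show "f x ` space ?S x \<subseteq> space M x" using rep_hom_mem[OF fh x] Usub[OF x] by auto
        show "space M x \<subseteq> f x ` space ?S x"
        proof
          fix m assume "m \<in> space M x"
          then obtain z where z: "z \<in> space P x" "m = f x z" using rep_epi_surj[OF P(2) x] by blast
          then obtain l u where lu: "z = l + u" "l \<in> ?K x" "u \<in> U x" using KU[OF x] by blast
          have "f x z = f x l + f x u"
            using rep_hom_linear[OF fh x] lu Usub[OF x] unfolding linear_map_def by auto
          then have "m = f x u" using lu(2) z(2) by simp
          then show "m \<in> f x ` space ?S x" using lu(3) by simp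
        qed
      qed
    qed
    \<comment> \<open>\<open>U\<close> already maps onto \<open>M\<close>, so projectivity lifts
      \<open>f\<close> along the restriction of \<open>f\<close> to \<open>U\<close>.\<close>
    then obtain g where g: "rep_hom G P ?S g" "\<And>x z. x \<in> verts G \<Longrightarrow> z \<in> space P x \<Longrightarrow> f x (g x z) = f x z"
      using projective_lift[OF P(1) S M _ fh] by metis
    have gP: "rep_hom G P P g" using rep_hom_comp[OF g(1) rep_hom_inclusion[OF PM U]] by simp
    define h where "h = normalize_map G P g"
    have hg: "h x y = g x y" if "x \<in> verts G" "y \<in> space P x" for x y
      unfolding h_def using that by simp
    have h: "h \<in> mod_hom G I P P" unfolding h_def using normalize_hom[OF PM PM gP] .
    \<comment> \<open>All powers of \<open>h\<close> are compatible with \<open>f\<close>, so their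
      stable image \<open>W\<close> still maps onto \<open>M\<close>; as a summand of
      \<open>P\<close> it is projective, and minimality leaves a zero complement
      \<open>R\<close>.\<close>
    obtain n W R where W: "subrep G P W" "additive.decomp I P (sub_rep P W) R"
      "\<And>x. W x = (mod_cmp h ^^ n) (mod_id G P) x ` space P x"
      "\<And>x. additive.null I R \<Longrightarrow> x \<in> verts G \<Longrightarrow> h x ` space P x = space P x"
      using fitting_decomp[OF h] by metis
    have pw: "(mod_cmp h ^^ k) (mod_id G P) x z \<in> space P x \<and> f x ((mod_cmp h ^^ k) (mod_id G P) x z) = f x z"
      if "x \<in> verts G" "z \<in> space P x" for x z k
    proof (induction k)
      case (Suc k)
      let ?y = "(mod_cmp h ^^ k) (mod_id G P) x z"
      have "(mod_cmp h ^^ Suc k) (mod_id G P) x z = h x ?y" by (simp add: mod_cmp_def)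
      moreover have "h x ?y = g x ?y" using hg that(1) Suc by blast
      ultimately show ?case using Suc g(2)[OF that(1)] rep_hom_mem[OF gP that(1)] by simp
    qed (use that in simp)
    have "rep_epi G (sub_rep P W) M f"
      unfolding rep_epi_def
    proof (intro conjI ballI)
      show "rep_hom G (sub_rep P W) M f" using rep_hom_restrict_sub[OF fh W(1)] .
      fix x assume x: "x \<in> verts G"
      have "f x ` (mod_cmp h ^^ n) (mod_id G P) x ` space P x = f x ` space P x"
        unfolding image_image using pw[OF x, of _ n] by (intro image_cong) simp_all
      then show "f x ` space (sub_rep P W) x = space M x" using W(3)[of x] rep_epi_surj[OF P(2) x] by simp
    qed
    moreover have "projective (sub_rep P W)" using projective_retract[OF P(1) additive.decomp_retract[OF W(2)]] .
    ultimately have "total_dim G P \<le> total_dim G (sub_rep P W)" using min by blast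
    then have "additive.null I R" using total_dim_less[OF additive.decomp_sym[OF W(2)]] by fastforce
    then have "space P v = h v ` space P v" using W(4) v by blast
    also have "\<dots> \<subseteq> U v"
      using rep_hom_mem[OF g(1) v] v unfolding h_def by auto
    finally show ?thesis using Usub[OF v] by blast
  qed
  note full = this
  have "superfluous G P ?K"
    unfolding superfluous_def
  proof (intro conjI allI impI ballI)
    show "subrep G P ?K" using subrep_kernel[OF PM fh M] .
    fix U x
    assume U: "subrep G P U \<and> (\<forall>x\<in>verts G. {l + u | l u. l \<in> ?K x \<and> u \<in> U x} = space P x)" and x: "x \<in> verts G"
    show "U x = space P x" by (rule full[OF conjunct1[OF U] bspec[OF conjunct2[OF U]] x])
  qed
  then show ?thesis unfolding projective_cover_def using P by blast
qed

section \<open>Syzygies: independence of the cover and additivity\<close>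

lemma syzygy_cover:
  assumes "M \<in> mod_of G I"
  obtains P f where "projective_cover G I M P f" "\<Omega> M = kernel_rep P f"
proof -
  have "\<exists>Pf. case Pf of (P, f) \<Rightarrow> projective_cover G I M P f"
    using projective_cover_exists[OF assms] by auto
  then have *: "case (SOME (P, f). projective_cover G I M P f) of (P, f) \<Rightarrow> projective_cover G I M P f"
    by (rule someI_ex)
  obtain P f where Pf: "(SOME (P, f). projective_cover G I M P f) = (P, f)" by (metis surj_pair)
  then show thesis using that[of P f] * unfolding syzygy_def by simp
qed

lemma cover_kernel_mod:
  assumes "projective_cover G I M P f" "M \<in> mod_of G I" shows "kernel_rep P f \<in> mod_of G I"
  using assms kernel_mod[of P I M f] projective_mod[of P] unfolding projective_cover_def rep_epi_def by blast

lemma syzygy_mod: "M \<in> mod_of G I \<Longrightarrow> \<Omega> M \<in> mod_of G I"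
  using syzygy_cover cover_kernel_mod by metis

lemma projective_cover_iff_rad:
  assumes "M \<in> mod_of G I"
  shows "projective_cover G I M P f \<longleftrightarrow> projective P \<and> rep_epi G P M f \<and> (\<forall>x\<in>verts G. space (kernel_rep P f) x \<subseteq> rad P x)"
proof (cases "projective P \<and> rep_epi G P M f")
  case True
  then have "P \<in> mod_of G I" "subrep G P (space (kernel_rep P f))"
    using projective_mod subrep_kernel[OF _ _ assms] rep_epi_hom by blast+
  then show ?thesis unfolding projective_cover_def using True superfluous_iff by blast
qed (auto simp: projective_cover_def)

lemma cover_lift_surj:
  assumes M: "M \<in> mod_of G I" "M' \<in> mod_of G I"
    and c: "projective_cover G I M P f" "projective_cover G I M' P' f'"
    and \<phi>: "rep_hom G M M' \<phi>" "\<And>x. x \<in> verts G \<Longrightarrow> \<phi> x ` space M x = space M' x"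
  obtains g where "rep_hom G P P' g" "\<And>x z. x \<in> verts G \<Longrightarrow> z \<in> space P x \<Longrightarrow> f' x (g x z) = \<phi> x (f x z)"
    "\<And>x. x \<in> verts G \<Longrightarrow> g x ` space P x = space P' x"
proof -
  have P: "projective P" "rep_epi G P M f" and P': "projective P'" "rep_epi G P' M' f'"
    and S: "superfluous G P' (space (kernel_rep P' f'))"
    using c unfolding projective_cover_def by blast+
  have PM: "P \<in> mod_of G I" "P' \<in> mod_of G I" using P P' projective_mod by blast+
  obtain g where g: "rep_hom G P P' g" "\<And>x z. x \<in> verts G \<Longrightarrow> z \<in> space P x \<Longrightarrow> f' x (g x z) = \<phi> x (f x z)"
    using projective_lift[OF P(1) PM(2) M(2) P'(2) rep_hom_comp[OF rep_epi_hom[OF P(2)] \<phi>(1)]] by metis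
  let ?U = "\<lambda>x. g x ` space P x"
  have U: "subrep G P' ?U" using subrep_image[OF PM(1) g(1) subrep_UNIV[OF PM(1)]] .
  have "{l + u | l u. l \<in> space (kernel_rep P' f') x \<and> u \<in> ?U x} = space P' x" if x: "x \<in> verts G" for x
  proof
    show "{l + u | l u. l \<in> space (kernel_rep P' f') x \<and> u \<in> ?U x} \<subseteq> space P' x"
      using seq.subspace_add[OF mod_subspace[OF PM(2) x]] rep_hom_mem[OF g(1) x] by auto
    show "space P' x \<subseteq> {l + u | l u. l \<in> space (kernel_rep P' f') x \<and> u \<in> ?U x}"
    proof
      fix z assume z: "z \<in> space P' x"
      have "f' x z \<in> space M' x" using rep_hom_mem[OF rep_epi_hom[OF P'(2)] x z] .
      then obtain m where m: "m \<in> space M x" "f' x z = \<phi> x m" using \<phi>(2)[OF x] by blast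
      then obtain y where y: "y \<in> space P x" "m = f x y" using rep_epi_surj[OF P(2) x] by blast
      have gy: "g x y \<in> space P' x" using rep_hom_mem[OF g(1) x y(1)] .
      have "f' x (z - g x y) = 0"
        using rep_hom_diff_eq[OF PM(2) rep_epi_hom[OF P'(2)] x z gy] g(2)[OF x y(1)] m y by simp
      moreover have "z - g x y \<in> space P' x" using seq.subspace_diff[OF mod_subspace[OF PM(2) x] z gy] .
      ultimately have "z - g x y \<in> space (kernel_rep P' f') x" by simp
      moreover have "z = (z - g x y) + g x y" by simp
      ultimately show "z \<in> {l + u | l u. l \<in> space (kernel_rep P' f') x \<and> u \<in> ?U x}" using y(1) by blast
    qed
  qed
  then have "\<forall>x\<in>verts G. ?U x = space P' x" using S U unfolding superfluous_def by blast
  then show thesis using that g by blast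
qed

text \<open>Surjective lifts in both directions compose to a surjective endomorphism of
  \<open>P\<close>, which is injective by finite dimension; so the lift is bijective and matches the
  kernels. This removes the dependence of \<open>syzygy\<close> on its choice of cover.\<close>

lemma cover_kernel_isom:
  assumes iso: "additive.isom I M M'"
    and c: "projective_cover G I M P f" "projective_cover G I M' P' f'"
  shows "additive.isom I (kernel_rep P f) (kernel_rep P' f')"
proof -
  have M: "M \<in> mod_of G I" "M' \<in> mod_of G I" using iso additive.isom_Ob by blast+
  obtain \<phi> where \<phi>: "rep_hom G M M' \<phi>" "\<forall>x\<in>verts G. bij_betw (\<phi> x) (space M x) (space M' x)"
    using isom_imp_bij[OF iso] by blast
  obtain \<psi> where \<psi>: "rep_hom G M' M \<psi>" "\<forall>x\<in>verts G. bij_betw (\<psi> x) (space M' x) (space M x)"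
    using isom_imp_bij[OF additive.isom_sym[OF iso]] by blast
  have surj: "\<And>x. x \<in> verts G \<Longrightarrow> \<phi> x ` space M x = space M' x" "\<And>x. x \<in> verts G \<Longrightarrow> \<psi> x ` space M' x = space M x"
    using \<phi>(2) \<psi>(2) unfolding bij_betw_def by blast+
  obtain g where g: "rep_hom G P P' g" "\<And>x z. x \<in> verts G \<Longrightarrow> z \<in> space P x \<Longrightarrow> f' x (g x z) = \<phi> x (f x z)"
    "\<And>x. x \<in> verts G \<Longrightarrow> g x ` space P x = space P' x"
    using cover_lift_surj[OF M c \<phi>(1) surj(1)] by metis
  obtain h where h: "rep_hom G P' P h" "\<And>x. x \<in> verts G \<Longrightarrow> h x ` space P' x = space P x"
    using cover_lift_surj[OF M(2,1) c(2,1) \<psi>(1) surj(2)] by metis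
  have PM: "P \<in> mod_of G I" "P' \<in> mod_of G I" and fh: "rep_hom G P M f"
    using c projective_mod rep_epi_hom unfolding projective_cover_def by blast+
  have inj: "inj_on (g x) (space P x)" if x: "x \<in> verts G" for x
  proof -
    have "(\<lambda>z. h x (g x z)) ` space P x = h x ` g x ` space P x" by (simp add: image_image)
    also have "\<dots> = space P x" using g(3)[OF x] h(2)[OF x] by simp
    finally have "inj_on (\<lambda>z. h x (g x z)) (space P x)"
      using surj_endo_inj[OF mod_fd[OF PM(1) x] rep_hom_linear[OF rep_hom_comp[OF g(1) h(1)] x]] by blast
    then show ?thesis by (auto simp: inj_on_def)
  qed
  let ?K = "kernel_rep P f" and ?K' = "kernel_rep P' f'"
  note K = cover_kernel_mod[OF c(1) M(1)] cover_kernel_mod[OF c(2) M(2)]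
  have ker: "f' x (g x z) = 0 \<longleftrightarrow> f x z = 0" if x: "x \<in> verts G" and z: "z \<in> space P x" for x z
  proof -
    have fz: "f x z \<in> space M x" using rep_hom_mem[OF fh x z] .
    have "\<phi> x (f x z) = 0 \<longleftrightarrow> f x z = 0"
      using \<phi>(2) x fz mod_0[OF M(1) x] rep_hom_0[OF M(1) \<phi>(1) x] unfolding bij_betw_def by (metis inj_onD)
    then show ?thesis using g(2)[OF x z] by simp
  qed
  have "rep_hom G ?K P' g"
    using rep_hom_restrict_sub[OF g(1) subrep_kernel[OF PM(1) fh M(1)]] unfolding kernel_rep_sub[of P f, symmetric] .
  then have "rep_hom G ?K (sub_rep P' (space ?K')) g"
  proof (rule rep_hom_into_sub)
    fix x z assume "x \<in> verts G" "z \<in> space ?K x"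
    then show "g x z \<in> space ?K' x" using ker rep_hom_mem[OF g(1)] by simp
  qed
  then have gK: "rep_hom G ?K ?K' g" unfolding kernel_rep_sub[of P' f', symmetric] .
  have "bij_betw (g x) (space ?K x) (space ?K' x)" if x: "x \<in> verts G" for x
    unfolding bij_betw_def
  proof
    show "inj_on (g x) (space ?K x)" using inj_on_subset[OF inj[OF x]] by (simp add: subset_iff)
    show "g x ` space ?K x = space ?K' x"
    proof
      show "g x ` space ?K x \<subseteq> space ?K' x" using rep_hom_mem[OF gK x] by blast
      show "space ?K' x \<subseteq> g x ` space ?K x"
      proof
        fix y assume y: "y \<in> space ?K' x"
        then obtain z where z: "z \<in> space P x" "y = g x z" using g(3)[OF x] by auto
        then have "z \<in> space ?K x" using ker[OF x z(1)] y by simp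
        then show "y \<in> g x ` space ?K x" using z(2) by blast
      qed
    qed
  qed
  then show ?thesis
    using bij_inverse_pair[OF K gK] unfolding additive.isom_def by blast
qed

lemma syzygy_isom_cover:
  assumes "projective_cover G I M P f" "M \<in> mod_of G I"
  shows "additive.isom I (\<Omega> M) (kernel_rep P f)"
  using syzygy_cover[OF assms(2)] cover_kernel_isom[OF additive.isom_refl[OF assms(2)] _ assms(1)] by metis

lemma syzygy_isom:
  assumes "additive.isom I M M'" shows "additive.isom I (\<Omega> M) (\<Omega> M')"
proof -
  have M: "M \<in> mod_of G I" "M' \<in> mod_of G I" using assms additive.isom_Ob by blast+
  obtain P f where "projective_cover G I M P f" "\<Omega> M = kernel_rep P f" using syzygy_cover[OF M(1)] by blast
  moreover obtain P' f' where "projective_cover G I M' P' f'" "\<Omega> M' = kernel_rep P' f'" using syzygy_cover[OF M(2)] by blast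
  ultimately show ?thesis using cover_kernel_isom[OF assms] by simp
qed

lemma same_space_isom:
  assumes "M \<in> mod_of G I" "\<And>x. x \<in> verts G \<Longrightarrow> space N x = space M x"
    "\<And>a m. a \<in> arcs G \<Longrightarrow> m \<in> space M (tail G a) \<Longrightarrow> act N a m = act M a m"
    "N \<in> mod_of G I"
  shows "additive.isom I M N"
proof -
  have "rep_hom G M N (\<lambda>x m. m)" unfolding rep_hom_def linear_map_def using assms by simp
  moreover have "bij_betw (\<lambda>m. m) (space M x) (space N x)" if "x \<in> verts G" for x
    using assms(2)[OF that] by (simp add: bij_betw_def)
  ultimately show ?thesis
    using bij_inverse_pair[OF assms(1,4)] unfolding additive.isom_def by blast
qed

text \<open>A direct sum of two projective covers is a projective cover, its kernel lying in the
  radical of the sum. As \<open>syzygy\<close> chooses its own cover of \<open>M\<close>, the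
  outcome is a decomposition up to isomorphism.\<close>

lemma syzygy_decomp:
  assumes "additive.decomp I M A B"
  shows "additive.decomp I (\<Omega> M) (\<Omega> A) (\<Omega> B)"
proof -
  have M: "M \<in> mod_of G I" "A \<in> mod_of G I" "B \<in> mod_of G I" using assms additive.decomp_Ob by blast+
  obtain P f where P: "projective_cover G I A P f" "\<Omega> A = kernel_rep P f" using syzygy_cover[OF M(2)] by blast
  obtain P' f' where P': "projective_cover G I B P' f'" "\<Omega> B = kernel_rep P' f'" using syzygy_cover[OF M(3)] by blast
  have p: "projective P" "rep_epi G P A f" "\<forall>x\<in>verts G. space (kernel_rep P f) x \<subseteq> rad P x"
    using P(1) projective_cover_iff_rad[OF M(2)] by blast+
  have p': "projective P'" "rep_epi G P' B f'" "\<forall>x\<in>verts G. space (kernel_rep P' f') x \<subseteq> rad P' x"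
    using P'(1) projective_cover_iff_rad[OF M(3)] by blast+
  have PM: "P \<in> mod_of G I" "P' \<in> mod_of G I" using p p' projective_mod by blast+
  let ?f = "\<lambda>x z. interleave (f x (deint0 z)) (f' x (deint1 z))"
  have hom: "rep_hom G (dsum P P') (dsum A B) ?f"
    using rep_hom_dsum[OF PM M(2,3) rep_epi_hom[OF p(2)] rep_epi_hom[OF p'(2)]] .
  have epi: "rep_epi G (dsum P P') (dsum A B) ?f"
    unfolding rep_epi_def
  proof (intro conjI ballI hom)
    fix x assume x: "x \<in> verts G"
    show "?f x ` space (dsum P P') x = space (dsum A B) x"
    proof
      show "?f x ` space (dsum P P') x \<subseteq> space (dsum A B) x" using rep_hom_mem[OF hom x] by blast
      show "space (dsum A B) x \<subseteq> ?f x ` space (dsum P P') x"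
      proof
        fix z assume "z \<in> space (dsum A B) x"
        then have "deint0 z \<in> f x ` space P x" "deint1 z \<in> f' x ` space P' x"
          using rep_epi_surj[OF p(2) x] rep_epi_surj[OF p'(2) x] by (auto simp: dsum_space)
        then obtain y y' where y: "y \<in> space P x" "deint0 z = f x y" "y' \<in> space P' x" "deint1 z = f' x y'" by blast
        then have "z = ?f x (interleave y y')" using interleave_deint[of z] by simp
        moreover have "interleave y y' \<in> space (dsum P P') x" using y by simp
        ultimately show "z \<in> ?f x ` space (dsum P P') x" by blast
      qed
    qed
  qed
  let ?K = "kernel_rep (dsum P P') ?f" and ?D = "dsum (kernel_rep P f) (kernel_rep P' f')"
  have sp: "space ?K x = space ?D x" for x
    using interleave_eq_iff[of _ _ 0 0] by (auto simp: dsum_space)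
  have "\<forall>x\<in>verts G. space ?K x \<subseteq> rad (dsum P P') x"
  proof (intro ballI subsetI)
    fix x z assume x: "x \<in> verts G" and "z \<in> space ?K x"
    then have "deint0 z \<in> space (kernel_rep P f) x" "deint1 z \<in> space (kernel_rep P' f') x"
      unfolding sp dsum_space by blast+
    then show "z \<in> rad (dsum P P') x" using p(3) p'(3) x by (intro rad_dsum[OF PM x]) blast+
  qed
  then have cover: "projective_cover G I (dsum A B) (dsum P P') ?f"
    using projective_cover_iff_rad[OF dsum_mod[OF M(2,3)]] projective_dsum[OF p(1) p'(1)] epi by blast
  have K: "?K \<in> mod_of G I" using cover_kernel_mod[OF cover dsum_mod[OF M(2,3)]] .
  note K1 = cover_kernel_mod[OF P(1) M(2)] cover_kernel_mod[OF P'(1) M(3)]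
  have "additive.isom I (\<Omega> M) (\<Omega> (dsum A B))"
    using syzygy_isom[OF additive.decomp_unique[OF assms decomp_dsum[OF M(2,3)]]] .
  moreover have "additive.isom I (\<Omega> (dsum A B)) ?K"
    using syzygy_isom_cover[OF cover dsum_mod[OF M(2,3)]] .
  moreover have "additive.isom I ?K ?D"
    by (rule same_space_isom[OF K]) (use sp dsum_mod[OF K1] in \<open>simp_all add: dsum_act\<close>)
  ultimately have "additive.isom I (\<Omega> M) ?D" using additive.isom_trans by blast
  then show ?thesis unfolding P(2) P'(2) using additive.decomp_isom[OF decomp_dsum[OF K1]] by blast
qed

lemma syzygy_retract: "additive.retract I L M \<Longrightarrow> additive.retract I (\<Omega> L) (\<Omega> M)"
  using retract_split[of I L M] syzygy_decomp additive.decomp_retract by blast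

lemma syzygy_null:
  assumes "additive.null I M" shows "additive.null I (\<Omega> M)"
proof -
  have M: "M \<in> mod_of G I" using assms unfolding additive.null_def by blast
  have "projective M" using projective_isom[OF projective_zero additive.null_isom[OF assms zero_rep_null]] .
  moreover have "rep_epi G M M (\<lambda>x m. m)" unfolding rep_epi_def using rep_hom_id by simp
  moreover have ker: "space (kernel_rep M (\<lambda>x m. m)) x = {0}" if "x \<in> verts G" for x
    using mod_0[OF M that] by auto
  then have "\<forall>x\<in>verts G. space (kernel_rep M (\<lambda>x m. m)) x \<subseteq> rad M x"
    using seq.subspace_0[OF rad_subspace] by (metis empty_subsetI insert_subset)
  ultimately have "projective_cover G I M M (\<lambda>x m. m)"
    using projective_cover_iff_rad[OF M] by metis
  then have iso: "additive.isom I (\<Omega> M) (kernel_rep M (\<lambda>x m. m))" using syzygy_isom_cover M by blast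
  then have "kernel_rep M (\<lambda>x m. m) \<in> mod_of G I" using additive.isom_Ob by blast
  then have "additive.null I (kernel_rep M (\<lambda>x m. m))"
    using ker by (simp only: null_iff) blast
  then show ?thesis using additive.retract_null[OF additive.retract_isom[OF iso]] by blast
qed

lemma syzygy_orbit_mod: "M \<in> mod_of G I \<Longrightarrow> syzygy_orbit G I M \<subseteq> mod_of G I"
proof -
  assume M: "M \<in> mod_of G I"
  have "(\<Omega> ^^ n) M \<in> mod_of G I" for n by (induction n) (use M syzygy_mod in auto)
  then show ?thesis unfolding syzygy_orbit_def by blast
qed

lemma syzygy_add_orbit:
  assumes "cat.add_closure I (syzygy_orbit G I M) N"
  shows "cat.add_closure I (syzygy_orbit G I M) (\<Omega> N)"
  using assms
proof induction
  case (zero N)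
  then show ?case using cat.add_closure.zero syzygy_null by blast
next
  case (base V N)
  then obtain n where "V = (\<Omega> ^^ n) M" unfolding syzygy_orbit_def by blast
  then have "\<Omega> V = (\<Omega> ^^ Suc n) M" by simp
  then have "\<Omega> V \<in> syzygy_orbit G I M" unfolding syzygy_orbit_def by blast
  then show ?case using cat.add_closure.base syzygy_retract[OF base(2)] by blast
next
  case (sum N A B)
  then show ?case using cat.add_closure.sum syzygy_decomp by blast
qed

end

section \<open>Finite generation in the Grothendieck group\<close>

text \<open>The additive extension of \<open>w\<close> to formal integer combinations. With
  \<open>w\<close> the multiplicity of a non-projective indecomposable, it vanishes on the relations
  of \<open>K0\<close>.\<close>

definition weight :: "('o \<Rightarrow> int) \<Rightarrow> ('o \<Rightarrow>\<^sub>0 int) \<Rightarrow> int" where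
  "weight w c = (\<Sum>i\<in>Poly_Mapping.keys c. Poly_Mapping.lookup c i * w i)"

lemma weight_superset:
  assumes "finite T" "Poly_Mapping.keys c \<subseteq> T"
  shows "weight w c = (\<Sum>i\<in>T. Poly_Mapping.lookup c i * w i)"
  unfolding weight_def using assms
  by (intro sum.mono_neutral_left) (auto simp: in_keys_iff)

lemma weight_add: "weight w (c + d) = weight w c + weight w d"
proof -
  let ?T = "Poly_Mapping.keys c \<union> Poly_Mapping.keys d"
  have "Poly_Mapping.keys (c + d) \<subseteq> ?T" by (rule Poly_Mapping.keys_add)
  then show ?thesis
    by (simp add: weight_superset[of ?T] lookup_add algebra_simps sum.distrib)
qed

lemma weight_zero [simp]: "weight w 0 = 0"
  by (simp add: weight_def)

lemma weight_minus: "weight w (- c) = - weight w c"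
  using weight_add[of w c "- c"] by simp

lemma weight_diff: "weight w (c - d) = weight w c - weight w d"
  using weight_add[of w c "- d"] by (simp add: weight_minus)

lemma weight_frag_of [simp]: "weight w (frag_of M) = w M"
  by (simp add: weight_def)

context bound_quiver_algebra
begin

text \<open>By contradiction: if no module of \<open>F\<close> has the summand \<open>W\<close>,
  then the multiplicity of \<open>W\<close> vanishes on generators and relations, hence on the class
  of \<open>W\<close>, which lies in the subgroup since summands are among its generators.
  \<open>F\<close> is fixed before \<open>W\<close>, so the bound is uniform.\<close>

lemma K0_finitely_generated:
  assumes fg: "finitely_generated_subgroup (K0 G I) (K0_span G I Ms)"
  obtains F where "finite F" "F \<subseteq> mod_of G I"
    "\<And>W M. additive.indecomposable I W \<Longrightarrow> \<not> projective W \<Longrightarrow> M \<in> Ms \<Longrightarrow> direct_summand G I W M \<Longrightarrow>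
       \<exists>N\<in>F. additive.retract I W N"
proof -
  let ?A = "free_Abelian_group (mod_of G I)"
  let ?H = "generate ?A (K0_relations G I)"
  interpret A: comm_group ?A by (rule abelian_free_Abelian_group)
  have rel: "K0_relations G I \<subseteq> carrier ?A"
  proof
    fix c assume "c \<in> K0_relations G I"
    then consider M M' M'' where "c = frag_of M - (frag_of M' + frag_of M'')"
        "M \<in> mod_of G I" "M' \<in> mod_of G I" "M'' \<in> mod_of G I"
      | P where "c = frag_of P" "projective P"
      unfolding K0_relations_def by blast
    then show "c \<in> carrier ?A"
    proof cases
      case 1
      have "Poly_Mapping.keys c \<subseteq> Poly_Mapping.keys (frag_of M) \<union> Poly_Mapping.keys (frag_of M' + frag_of M'')"
        unfolding 1(1) by (rule keys_diff)
      also have "\<dots> \<subseteq> {M} \<union> ({M'} \<union> {M''})"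
        using Poly_Mapping.keys_add[of "frag_of M'" "frag_of M''"] by auto
      finally show ?thesis using 1 by auto
    next
      case 2
      then show ?thesis using projective_mod by auto
    qed
  qed
  have H: "subgroup ?H ?A" using A.generate_is_subgroup rel by blast
  then interpret N: normal ?H ?A using A.subgroup_imp_normal by blast
  obtain S where S: "finite S" "S \<subseteq> carrier (K0 G I)" "K0_span G I Ms = generate (K0 G I) S"
    using fg unfolding finitely_generated_subgroup_def by blast
  have "\<exists>c. c \<in> carrier ?A \<and> s = ?H #>\<^bsub>?A\<^esub> c" if "s \<in> S" for s
    using that S(2) unfolding K0_def carrier_FactGroup by blast
  then obtain c where c: "\<And>s. s \<in> S \<Longrightarrow> c s \<in> carrier ?A \<and> s = ?H #>\<^bsub>?A\<^esub> c s" by metis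
  \<comment> \<open>Arbitrary representatives of the generating cosets suffice, because the weights
    used below are constant on cosets.\<close>
  define F where "F = (\<Union>s\<in>S. Poly_Mapping.keys (c s))"
  show thesis
  proof (rule that)
    show "finite F" unfolding F_def using S(1) by simp
    show FM: "F \<subseteq> mod_of G I" unfolding F_def using c by auto
    fix W M
    assume W: "additive.indecomposable I W" "\<not> projective W" and M: "M \<in> Ms" "direct_summand G I W M"
    show "\<exists>N\<in>F. additive.retract I W N"
    proof (rule ccontr)
      assume no: "\<not> (\<exists>N\<in>F. additive.retract I W N)"
      define w where "w = (\<lambda>M. int (cat.mult I W M))"
      have WM: "W \<in> mod_of G I" using W unfolding additive.indecomposable_def by blast
      have c0: "weight w (c s) = 0" if "s \<in> S" for s
        unfolding weight_def
      proof (rule sum.neutral, rule ballI)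
        fix N assume N: "N \<in> Poly_Mapping.keys (c s)"
        then have "N \<in> F" unfolding F_def using that by blast
        then have "cat.mult I W N = 0" using cat.mult_eq_0[OF W(1)] FM no by blast
        then show "Poly_Mapping.lookup (c s) N * w N = 0" unfolding w_def by simp
      qed
      \<comment> \<open>For the relations from direct sums this is additivity of the multiplicity; a
        projective has multiplicity zero because its retracts are projective and \<open>W\<close> is
        not.\<close>
      have rel0: "weight w r = 0" if "r \<in> K0_relations G I" for r
      proof -
        from that consider M M' M'' where "r = frag_of M - (frag_of M' + frag_of M'')" "additive.decomp I M M' M''"
          | P where "r = frag_of P" "projective P"
          unfolding K0_relations_def decomp_iff by blast
        then show ?thesis
        proof cases
          case 1
          then show ?thesis using cat.mult_decomp[OF W(1) 1(2)] by (simp add: weight_diff weight_add w_def)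
        next
          case 2
          then have "\<not> additive.retract I W P" using W(2) projective_retract by blast
          then show ?thesis using 2 cat.mult_eq_0[OF W(1) projective_mod[OF 2(2)]] by (simp add: w_def)
        qed
      qed
      have H0: "weight w h = 0" if "h \<in> ?H" for h
        using that
      proof (induction rule: generate.induct)
        case (inv h)
        then have "h \<in> carrier ?A" using rel by blast
        then have "inv\<^bsub>?A\<^esub> h = - h" by simp
        then show ?case using rel0[OF inv] by (simp add: weight_minus)
      qed (use rel0 in \<open>simp_all add: weight_add\<close>)
      have coset: "weight w y = weight w d" if "y \<in> ?H #>\<^bsub>?A\<^esub> d" for y d
        using that H0 by (auto simp: r_coset_def weight_add)
      \<comment> \<open>Vanishing is claimed for every representative of a coset, so that no induced
        map on the quotient group has to be built.\<close>
      have gen0: "\<forall>y\<in>x. weight w y = 0" if "x \<in> generate (K0 G I) S" for x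
        using that
      proof (induction rule: generate.induct)
        case one
        then show ?case using H0 by (simp add: K0_def)
      next
        case (incl s)
        then show ?case using coset c c0 by metis
      next
        case (inv s)
        have s: "s \<in> carrier (?A Mod ?H)" using inv S(2) by (auto simp: K0_def)
        show ?case
        proof
          fix y assume "y \<in> inv\<^bsub>K0 G I\<^esub> s"
          then have "y \<in> set_inv\<^bsub>?A\<^esub> s" using N.inv_FactGroup[OF s] by (simp add: K0_def)
          then obtain z where z: "z \<in> s" "y = inv\<^bsub>?A\<^esub> z" by (auto simp: SET_INV_def)
          have "z \<in> carrier ?A" using z(1) c[OF inv] A.r_coset_subset_G[OF N.subset] by blast
          then have "y = - z" using z(2) by simp
          moreover have "weight w z = 0" using z(1) coset c c0 inv by metis
          ultimately show "weight w y = 0" by (simp add: weight_minus)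
        qed
      next
        case (eng a b)
        show ?case
        proof
          fix y assume "y \<in> a \<otimes>\<^bsub>K0 G I\<^esub> b"
          then obtain p q where "p \<in> a" "q \<in> b" "y = p + q" by (auto simp: K0_def set_mult_def)
          then show "weight w y = 0" using eng by (simp add: weight_add)
        qed
      qed
      have "K0_class G I W \<in> generate (K0 G I) S"
        unfolding S(3)[symmetric] K0_span_def using M by (intro generate.incl) blast
      moreover have "frag_of W \<in> K0_class G I W"
        unfolding K0_class_def using A.rcos_self[OF _ H, of "frag_of W"] WM by simp
      ultimately have "w W = 0" using gen0 by fastforce
      then show False using cat.mult_self[OF W(1)] by (simp add: w_def)
    qed
  qed
qed

end

section \<open>Semisimple modules\<close>

context bound_quiver_algebra
begin

text \<open>Being killed by the arrows, that is, semisimplicity, in a form that is inherited by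
  retracts and immediate for tops.\<close>

definition zero_arrows :: "('a, 'b, 'k) rep \<Rightarrow> bool" where
  "zero_arrows M \<longleftrightarrow> (\<forall>a\<in>arcs G. \<forall>m\<in>space M (tail G a). act M a m = 0)"

lemma zero_arrows_retract:
  assumes "additive.retract I L M" "zero_arrows M"
  shows "zero_arrows L"
  unfolding zero_arrows_def
proof (intro ballI)
  obtain i p where ip: "i \<in> mod_hom G I L M" "p \<in> mod_hom G I M L" "mod_cmp p i = mod_id G L"
    using assms(1) unfolding additive.retract_def by blast
  note h = mod_hom_rep_hom[OF ip(1)] mod_hom_rep_hom[OF ip(2)]
  have LM: "L \<in> mod_of G I" "M \<in> mod_of G I" using mod_hom_mod[OF ip(1)] by blast+
  fix a m assume a: "a \<in> arcs G" and m: "m \<in> space L (tail G a)"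
  then have th: "tail G a \<in> verts G" "head G a \<in> verts G" by auto
  have "act L a m = p (head G a) (i (head G a) (act L a m))"
    using mod_cmp_eq_id[OF ip(3) th(2) mod_act_mem[OF LM(1) a m]] by simp
  also have "i (head G a) (act L a m) = 0"
    using rep_hom_act[OF h(1) a m] assms(2) rep_hom_mem[OF h(1) th(1) m] a unfolding zero_arrows_def by simp
  also have "p (head G a) 0 = 0" using rep_hom_0[OF LM(2) h(2) th(2)] .
  finally show "act L a m = 0" .
qed

lemma graded_projector:
  assumes "\<And>x. x \<in> V \<Longrightarrow> seq.subspace (U x)"
  shows "\<exists>r. \<forall>x\<in>V. Vector_Spaces.linear scale scale (r x) \<and> (\<forall>m. r x m \<in> U x) \<and> (\<forall>m\<in>U x. r x m = m)"
proof (rule bchoice, rule ballI)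
  fix x assume "x \<in> V"
  then show "\<exists>r. Vector_Spaces.linear scale scale r \<and> (\<forall>m. r m \<in> U x) \<and> (\<forall>m\<in>U x. r m = m)"
    using subspace_projector[OF assms] by metis
qed

text \<open>When the arrows act as zero, any family of linear projectors is a morphism, so every
  subrepresentation splits off; indecomposability then leaves only the trivial ones.\<close>

lemma indecomposable_zero_arrows_simple:
  assumes ind: "additive.indecomposable I T" and z: "zero_arrows T"
  shows "simple_rep G I T"
  unfolding simple_rep_def
proof (intro conjI allI impI)
  show T: "T \<in> mod_of G I" using ind unfolding additive.indecomposable_def by blast
  show "\<exists>x\<in>verts G. space T x \<noteq> {0}" using ind T null_iff unfolding additive.indecomposable_def by blast
  fix U assume U: "subrep G T U"
  have Us: "seq.subspace (U x)" "U x \<subseteq> space T x" if "x \<in> verts G" for x using U that unfolding subrep_def by blast+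
  from graded_projector[of "verts G" U, OF Us(1)] obtain r where
    r: "\<And>x. x \<in> verts G \<Longrightarrow> Vector_Spaces.linear scale scale (r x)"
      "\<And>x m. x \<in> verts G \<Longrightarrow> r x m \<in> U x" "\<And>x m. x \<in> verts G \<Longrightarrow> m \<in> U x \<Longrightarrow> r x m = m"
    by blast
  let ?S = "sub_rep T U"
  have S: "?S \<in> mod_of G I" using sub_rep_mod[OF T U] .
  have "rep_hom G T ?S r"
    unfolding rep_hom_def
  proof (intro conjI ballI)
    show "linear_map (space T x) (space ?S x) (r x)" if "x \<in> verts G" for x
      using linear_map_linear[OF r(1)[OF that]] r(2)[OF that] by simp
    fix a m assume a: "a \<in> arcs G" "m \<in> space T (tail G a)"
    then have th: "tail G a \<in> verts G" "head G a \<in> verts G" by auto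
    have "act T a m = 0" using z a unfolding zero_arrows_def by blast
    moreover have "act T a (r (tail G a) m) = 0"
      using z a r(2)[OF th(1)] Us(2)[OF th(1)] unfolding zero_arrows_def by blast
    ultimately show "r (head G a) (act T a m) = act ?S a (r (tail G a) m)"
      using seq.linear_0[OF r(1)[OF th(2)]] by simp
  qed
  then have p: "normalize_map G T r \<in> mod_hom G I T ?S" using normalize_hom[OF T S] by blast
  have i: "normalize_map G ?S (\<lambda>x m. m) \<in> mod_hom G I ?S T"
    using normalize_hom[OF S T rep_hom_inclusion[OF T U]] .
  have "mod_cmp (normalize_map G T r) (normalize_map G ?S (\<lambda>x m. m)) = mod_id G ?S"
  proof (rule mod_hom_eqI[OF mod_cmp_hom[OF p i] mod_id_hom[OF S]])
    fix x m assume "x \<in> verts G" "m \<in> space ?S x"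
    moreover from this have "m \<in> space T x" using Us(2) by auto
    ultimately show "mod_cmp (normalize_map G T r) (normalize_map G ?S (\<lambda>x m. m)) x m = mod_id G ?S x m"
      using r(3) by (simp add: mod_cmp_def)
  qed
  then have "additive.retract I ?S T" unfolding additive.retract_def using p i by blast
  then obtain R where D: "additive.decomp I T ?S R" using retract_split by blast
  then have "additive.null I ?S \<or> additive.null I R" using ind unfolding additive.indecomposable_def by blast
  then show "(\<forall>x\<in>verts G. U x = {0}) \<or> (\<forall>x\<in>verts G. U x = space T x)"
    using sub_rep_full[OF T U D] null_iff[of I ?S] by auto
qed

text \<open>A semisimple module splits into simples, each a retract of \<open>dsum_list Ss\<close>,
  and syzygies respect the splitting. A simple may occur repeatedly, hence the additive
  closure.\<close>

lemma syzygy_semisimple: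
  assumes Ss: "complete_simples G I Ss" and T: "T \<in> mod_of G I" and "zero_arrows T"
  shows "cat.add_closure I {\<Omega> (dsum_list Ss)} (\<Omega> T)"
proof -
  have "zero_arrows T \<longrightarrow> cat.add_closure I {\<Omega> (dsum_list Ss)} (\<Omega> T)"
    using T
  proof (induction T rule: cat.decomp_induct[where I = I, consumes 1])
    case (null M)
    then show ?case using syzygy_null cat.add_closure.zero by blast
  next
    case (indecomposable T)
    show ?case
    proof
      assume "zero_arrows T"
      then have "simple_rep G I T" using indecomposable_zero_arrows_simple indecomposable by blast
      then obtain S where S: "S \<in> set Ss" "rep_iso G T S" using Ss unfolding complete_simples_def by blast
      have mods: "set Ss \<subseteq> mod_of G I" using Ss unfolding complete_simples_def simple_rep_def by blast
      have "T \<in> mod_of G I" using indecomposable unfolding additive.indecomposable_def by blast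
      then have "additive.isom I T S" using S mods isom_iff by blast
      then have "additive.retract I T (dsum_list Ss)"
        using additive.retract_trans[OF additive.retract_isom dsum_list_retract[OF mods S(1)]] by blast
      then show "cat.add_closure I {\<Omega> (dsum_list Ss)} (\<Omega> T)"
        using cat.add_closure.base[OF singletonI syzygy_retract] by blast
    qed
  next
    case (decomp M A B)
    have "zero_arrows M \<longrightarrow> zero_arrows A \<and> zero_arrows B"
      using zero_arrows_retract additive.decomp_retract[OF decomp(1)]
        additive.decomp_retract[OF additive.decomp_sym[OF decomp(1)]] by blast
    then show ?case using decomp cat.add_closure.sum[OF syzygy_decomp[OF decomp(1)]] by blast
  qed
  then show ?thesis using assms(3) by blast
qed

text \<open>The top of \<open>P\<close> is realised on a vector space complement of the radical.\<close>

lemma top_exists: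
  assumes P: "projective P"
  obtains T p where "T \<in> mod_of G I" "zero_arrows T" "projective_cover G I T P p"
    "\<And>x. x \<in> verts G \<Longrightarrow> space (kernel_rep P p) x = rad P x"
proof -
  have PM: "P \<in> mod_of G I" using P projective_mod by blast
  from graded_projector[of "verts G" "rad P", OF rad_subspace] obtain r where
    r: "\<And>x. x \<in> verts G \<Longrightarrow> Vector_Spaces.linear scale scale (r x)"
      "\<And>x m. x \<in> verts G \<Longrightarrow> r x m \<in> rad P x" "\<And>x m. x \<in> verts G \<Longrightarrow> m \<in> rad P x \<Longrightarrow> r x m = m"
    by blast
  \<comment> \<open>The projection along the radical: on \<open>P\<close> its kernel is the radical
    and its image a complement.\<close>
  define p where "p = (\<lambda>x m. m - r x m)"
  define T :: "('a, 'b, 'k) rep" where "T = \<lparr>space = (\<lambda>x. p x ` space P x), act = (\<lambda>a m. 0)\<rparr>"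
  have Ts: "space T x = p x ` space P x" "act T a = (\<lambda>m. 0)" for x a by (simp_all add: T_def)
  have lin: "linear_map (space P x) (space T x) (p x)" if x: "x \<in> verts G" for x
  proof (rule linear_map_linear)
    show "Vector_Spaces.linear scale scale (p x)"
    proof (rule linear_scaleI)
      show "p x (m + n) = p x m + p x n" for m n
        unfolding p_def seq.linear_add[OF r(1)[OF x]] by (rule add_diff_add)
      show "p x (scale c m) = scale c (p x m)" for c m
        unfolding p_def seq.linear_scale[OF r(1)[OF x]] by (rule seq.scale_right_diff_distrib[symmetric])
    qed
  qed (simp add: Ts)
  have ker: "p x m = 0 \<longleftrightarrow> m \<in> rad P x" if "x \<in> verts G" for x m
    using r(2,3)[OF that] unfolding p_def by (metis right_minus_eq)
  have T: "T \<in> mod_of G I"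
    unfolding mod_of_def mem_Collect_eq
  proof (intro conjI ballI)
    fix x assume x: "x \<in> verts G"
    show "fd_space (space T x)" unfolding Ts using linear_map_fd_image[OF mod_fd[OF PM x] lin[OF x]] .
  next
    fix a assume a: "a \<in> arcs G"
    have "0 \<in> space T (head G a)"
      using mod_0[OF PM, of "head G a"] a ker[of "head G a" 0] seq.subspace_0[OF rad_subspace]
      by (metis Ts(1) image_eqI wellformed(2))
    then show "linear_map (space T (tail G a)) (space T (head G a)) (act T a)"
      unfolding linear_map_def Ts(2) by simp
  next
    fix \<rho> u v m assume \<rho>: "\<rho> \<in> I"
    \<comment> \<open>All arrows act as zero, so a relation could fail only through a stationary
      path, and elements of an admissible ideal involve none.\<close>
    have "fold (act T) p m = 0" if "p \<noteq> []" for p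
      using that by (cases p rule: rev_cases) (simp_all add: Ts)
    then have "fold (act T) p m = 0" if "\<rho> (u, p, v) \<noteq> 0" for p
      using that ideal_I_no_stationary[OF \<rho>] by metis
    then show "(\<Sum>p | \<rho> (u, p, v) \<noteq> 0. scale (\<rho> (u, p, v)) (fold (act T) p m)) = 0"
      by (intro sum.neutral) (metis (mono_tags, lifting) mem_Collect_eq seq.scale_zero_right)
  qed
  have hom: "rep_hom G P T p"
    unfolding rep_hom_def using lin ker by (auto simp: Ts(2) rad_act)
  have epi: "rep_epi G P T p" unfolding rep_epi_def using hom Ts by blast
  have kr: "space (kernel_rep P p) x = rad P x" if "x \<in> verts G" for x
    using ker[OF that] rad_subset[OF PM that] by auto
  have "projective_cover G I T P p"
    using projective_cover_iff_rad[OF T] P epi kr by blast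
  moreover have "zero_arrows T" unfolding zero_arrows_def Ts by simp
  ultimately show thesis using that T kr by blast
qed

end

section \<open>Gluing\<close>

lemma restrict_rep_simps [simp]:
  "space (restrict_rep Q M) x = (if x \<in> verts Q then space M x else {0})"
  "act (restrict_rep Q M) a = (if a \<in> arcs Q then act M a else (\<lambda>m. 0))"
  by (simp_all add: restrict_rep_def)

locale gluing =
  A: bound_quiver_algebra QA IA + B: bound_quiver_algebra QB IB + C: bound_quiver_algebra QC IC
  for QA QB QC :: "('v, 'e) pre_digraph" and IA IB IC :: "(('v, 'e) path \<Rightarrow> 'k::field) set" +
  fixes \<alpha>s \<beta>s :: "'e set"
  assumes morita: "Morita_context_ideal QA IA QB IB IC"
    and glued: "glued_quiver QA QB \<alpha>s \<beta>s QC"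
    and relations: "genideal (path_algebra QC) (gluing_relations QA IA QB IB \<alpha>s \<beta>s QC) \<subseteq> IC"
begin

text \<open>The hypotheses are symmetric under exchanging \<open>A\<close> with \<open>B\<close> and
  \<open>\<alpha>s\<close> with \<open>\<beta>s\<close>. Statements are therefore proved on the side
  of \<open>A\<close> only and reused through this second interpretation.\<close>

lemma gluing_swap: "gluing QB QA QC IB IA IC \<beta>s \<alpha>s"
proof
  show "Morita_context_ideal QB IB QA IA IC" using morita unfolding Morita_context_ideal_def by blast
  show "glued_quiver QB QA \<beta>s \<alpha>s QC" using glued unfolding glued_quiver_def by blast
  have "gluing_relations QB IB QA IA \<beta>s \<alpha>s QC = gluing_relations QA IA QB IB \<alpha>s \<beta>s QC"
    unfolding gluing_relations_def by blast
  then show "genideal (path_algebra QC) (gluing_relations QB IB QA IA \<beta>s \<alpha>s QC) \<subseteq> IC" using relations by simp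
qed

abbreviation "resA \<equiv> restrict_rep QA"
abbreviation "resB \<equiv> restrict_rep QB"

section \<open>Arrows, paths and relations of the glued quiver\<close>

lemma verts_C: "verts QC = verts QA \<union> verts QB" and verts_disjoint: "verts QA \<inter> verts QB = {}"
  and arcs_C: "arcs QC = arcs QA \<union> arcs QB \<union> \<alpha>s \<union> \<beta>s"
  using glued unfolding glued_quiver_def by simp_all

lemma arcs_disjoint: "arcs QA \<inter> arcs QB = {}" "arcs QA \<inter> (\<alpha>s \<union> \<beta>s) = {}" "arcs QB \<inter> (\<alpha>s \<union> \<beta>s) = {}"
proof -
  have "arcs QA \<inter> arcs QB = {}" "(arcs QA \<union> arcs QB) \<inter> (\<alpha>s \<union> \<beta>s) = {}"
    using glued unfolding glued_quiver_def by simp_all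
  then show "arcs QA \<inter> arcs QB = {}" "arcs QA \<inter> (\<alpha>s \<union> \<beta>s) = {}" "arcs QB \<inter> (\<alpha>s \<union> \<beta>s) = {}"
    by blast+
qed

lemma arc_A: "a \<in> arcs QA \<Longrightarrow> tail QC a = tail QA a \<and> head QC a = head QA a \<and> tail QA a \<in> verts QA \<and> head QA a \<in> verts QA"
  and arc_B: "a \<in> arcs QB \<Longrightarrow> tail QC a = tail QB a \<and> head QC a = head QB a \<and> tail QB a \<in> verts QB \<and> head QB a \<in> verts QB"
  and arc_alpha: "a \<in> \<alpha>s \<Longrightarrow> tail QC a \<in> verts QA \<and> head QC a \<in> verts QB"
  and arc_beta: "a \<in> \<beta>s \<Longrightarrow> tail QC a \<in> verts QB \<and> head QC a \<in> verts QA"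
  using glued A.wellformed B.wellformed unfolding glued_quiver_def by simp_all

lemma verts_A_C: "x \<in> verts QA \<Longrightarrow> x \<in> verts QC" and verts_not_both: "x \<in> verts QA \<Longrightarrow> x \<notin> verts QB"
  using verts_C verts_disjoint by blast+

lemma arcs_A_C: "a \<in> arcs QA \<Longrightarrow> a \<in> arcs QC"
  using arcs_C by blast

lemma not_A_arc:
  assumes "a \<in> arcs QC" "a \<notin> arcs QA"
  shows "a \<in> arcs QB \<or> a \<in> \<alpha>s \<or> a \<in> \<beta>s"
  using assms arcs_C by blast

lemma relation_pair:
  assumes "x \<in> arcs QA \<and> y \<in> \<alpha>s \<or> x \<in> arcs QB \<and> y \<in> \<beta>s \<or> x \<in> \<alpha>s \<and> y \<in> \<beta>s \<or> x \<in> \<beta>s \<and> y \<in> \<alpha>s"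
    and "head QC x = tail QC y"
  shows "basis_path (tail QC x, [x, y], head QC y) \<in> IC" "(tail QC x, [x, y], head QC y) \<in> paths QC"
proof -
  have xy: "x \<in> arcs QC" "y \<in> arcs QC" using assms(1) arcs_C by blast+
  have "arrow QC x \<otimes>\<^bsub>path_algebra QC\<^esub> arrow QC y \<in> gluing_relations QA IA QB IB \<alpha>s \<beta>s QC"
    using assms(1) unfolding gluing_relations_def by blast
  then have "arrow QC x \<otimes>\<^bsub>path_algebra QC\<^esub> arrow QC y \<in> IC"
    using relations unfolding genideal_def by blast
  moreover have p: "(tail QC x, [x], tail QC y) \<in> paths QC"
    using xy assms(2) by (simp add: path_Cons_iff[OF C.wf_digraph_axioms] path_Nil_iff[OF C.wf_digraph_axioms])
  moreover have "(arrow QC x \<otimes>\<^bsub>path_algebra QC\<^esub> arrow QC y :: _ \<Rightarrow> 'k) = basis_path (tail QC x, [x, y], head QC y)"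
    using basis_path_mult[OF p, of "[y]" "head QC y"] assms(2) by (simp add: arrow_basis)
  ultimately show "basis_path (tail QC x, [x, y], head QC y) \<in> IC" by simp
  show "(tail QC x, [x, y], head QC y) \<in> paths QC"
    using xy assms(2) by (simp add: path_Cons_iff[OF C.wf_digraph_axioms] path_Nil_iff[OF C.wf_digraph_axioms])
qed

text \<open>The end points force any arrow \<open>x\<close> that can precede a connecting arrow
  \<open>y\<close> into one of the four cases of \<open>gluing_relations\<close>, so
  \<open>y\<close> kills all images of arrows, and these span the radical.\<close>

lemma connecting_kills_rad:
  assumes M: "M \<in> mod_of QC IC" and y: "y \<in> \<alpha>s \<union> \<beta>s" and r: "r \<in> C.rad M (tail QC y)"
  shows "act M y r = 0"
proof -
  have yC: "y \<in> arcs QC" using y arcs_C by blast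
  have t: "tail QC y \<in> verts QC" using yC by simp
  obtain L where L: "Vector_Spaces.linear scale scale L" "\<And>m. m \<in> space M (tail QC y) \<Longrightarrow> L m = act M y m"
    using linear_map_extend[OF C.mod_subspace[OF M t] C.mod_act[OF M yC]] by metis
  have "C.rad M (tail QC y) \<subseteq> {m. L m = 0}"
  proof (rule C.rad_least)
    show "seq.subspace {m. L m = 0}" using seq.linear_subspace_kernel[OF L(1)] .
    fix x m assume x: "x \<in> arcs QC" "head QC x = tail QC y" "m \<in> space M (tail QC x)"
    have cases: "x \<in> arcs QA \<or> x \<in> arcs QB \<or> x \<in> \<alpha>s \<or> x \<in> \<beta>s" using x(1) arcs_C by blast
    have "x \<in> arcs QA \<or> x \<in> \<beta>s \<Longrightarrow> head QC x \<in> verts QA" "x \<in> arcs QB \<or> x \<in> \<alpha>s \<Longrightarrow> head QC x \<in> verts QB"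
      using arc_A[of x] arc_B[of x] arc_alpha[of x] arc_beta[of x] by auto
    moreover have "y \<in> \<alpha>s \<Longrightarrow> head QC x \<in> verts QA" "y \<in> \<beta>s \<Longrightarrow> head QC x \<in> verts QB"
      using arc_alpha[of y] arc_beta[of y] x(2) by auto
    ultimately have "x \<in> arcs QA \<and> y \<in> \<alpha>s \<or> x \<in> arcs QB \<and> y \<in> \<beta>s \<or> x \<in> \<alpha>s \<and> y \<in> \<beta>s \<or> x \<in> \<beta>s \<and> y \<in> \<alpha>s"
      using cases y verts_not_both by blast
    from C.basis_in_ideal_act[OF M relation_pair(2)[OF this x(2)] relation_pair(1)[OF this x(2)] x(3)]
    have "act M y (act M x m) = 0" by simp
    then show "act M x m \<in> {m. L m = 0}" using L(2) C.mod_act_mem[OF M x(1,3)] x(2) by simp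
  qed
  moreover have "r \<in> space M (tail QC y)" using C.rad_subset[OF M t] r by blast
  ultimately show ?thesis using r L(2) by auto
qed

lemma paths_A_iff:
  "(u, p, v) \<in> paths QA \<longleftrightarrow> u \<in> verts QA \<and> (u, p, v) \<in> paths QC \<and> set p \<subseteq> arcs QA"
proof (induction p arbitrary: u)
  case Nil
  then show ?case
    using verts_A_C by (auto simp: path_Nil_iff[OF A.wf_digraph_axioms] path_Nil_iff[OF C.wf_digraph_axioms])
next
  case (Cons a p)
  then show ?case
    using arc_A[of a] arcs_A_C[of a]
    by (auto simp: path_Cons_iff[OF A.wf_digraph_axioms] path_Cons_iff[OF C.wf_digraph_axioms])
qed

text \<open>Let \<open>y\<close> be the last arrow outside \<open>QA\<close>. It ends in
  \<open>QA\<close>, so it belongs to \<open>\<beta>s\<close> and starts in \<open>QB\<close>; as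
  the path starts in \<open>QA\<close>, some arrow \<open>x\<close> precedes \<open>y\<close>, and
  \<open>x\<close> lies in \<open>QB\<close> or in \<open>\<alpha>s\<close>. Either way the product
  of \<open>x\<close> and \<open>y\<close> is a relation.\<close>

lemma mixed_path_in_ideal:
  assumes p: "(u, p, v) \<in> paths QC" and uv: "u \<in> verts QA" "v \<in> verts QA" and mix: "\<not> set p \<subseteq> arcs QA"
  shows "basis_path (u, p, v) \<in> IC"
proof -
  have "\<exists>y\<in>set p. y \<notin> arcs QA" using mix by blast
  then obtain p1 y p2 where y: "p = p1 @ y # p2" "y \<notin> arcs QA" "\<forall>z\<in>set p2. \<not> z \<notin> arcs QA"
    using split_list_last_prop[of p "\<lambda>y. y \<notin> arcs QA"] by blast
  obtain w where w: "(u, p1, w) \<in> paths QC" "(w, y # p2, v) \<in> paths QC"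
    using p path_append_iff[OF C.wf_digraph_axioms] unfolding y(1) by blast
  then have yC: "y \<in> arcs QC" "w = tail QC y" "(head QC y, p2, v) \<in> paths QC"
    by (simp_all add: path_Cons_iff[OF C.wf_digraph_axioms])
  have "head QC y \<in> verts QA"
  proof (cases p2)
    case Nil
    then show ?thesis using yC(3) uv by (simp add: path_Nil_iff[OF C.wf_digraph_axioms])
  next
    case (Cons z p3)
    then have "head QC y = tail QC z" using yC(3) by (simp add: path_Cons_iff[OF C.wf_digraph_axioms])
    then show ?thesis using y(3) Cons arc_A[of z] by simp
  qed
  then have yb: "y \<in> \<beta>s" using not_A_arc[OF yC(1) y(2)] arc_B[of y] arc_alpha[of y] verts_not_both by metis
  then have tB: "tail QC y \<in> verts QB" using arc_beta by blast
  then have "p1 \<noteq> []" using w(1) yC(2) uv(1) verts_not_both by (auto simp: path_Nil_iff[OF C.wf_digraph_axioms])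
  then obtain q x where q: "p1 = q @ [x]" by (cases p1 rule: rev_cases) auto
  then obtain w' where w': "(u, q, w') \<in> paths QC" "(w', [x], w) \<in> paths QC"
    using w(1) path_append_iff[OF C.wf_digraph_axioms] by blast
  then have x: "x \<in> arcs QC" "w' = tail QC x" "head QC x = tail QC y"
    using yC(2) by (simp_all add: path_Cons_iff[OF C.wf_digraph_axioms] path_Nil_iff[OF C.wf_digraph_axioms])
  have "x \<in> arcs QB \<or> x \<in> \<alpha>s"
    using x tB arcs_C arc_A[of x] arc_beta[of x] verts_not_both by (metis Un_iff)
  then have pr: "x \<in> arcs QA \<and> y \<in> \<alpha>s \<or> x \<in> arcs QB \<and> y \<in> \<beta>s \<or> x \<in> \<alpha>s \<and> y \<in> \<beta>s \<or> x \<in> \<beta>s \<and> y \<in> \<alpha>s"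
    using yb by blast
  let ?xy = "(tail QC x, [x, y], head QC y)"
  note R = relation_pair[OF pr x(3)]
  have q1: "(u, q, tail QC x) \<in> paths QC" using w'(1) x(2) by simp
  have "(basis_path (u, q, tail QC x) :: _ \<Rightarrow> 'k) \<otimes>\<^bsub>path_algebra QC\<^esub> basis_path ?xy = basis_path (u, q @ [x, y], head QC y)"
    by (rule basis_path_mult[OF q1])
  moreover have "basis_path (u, q, tail QC x) \<otimes>\<^bsub>path_algebra QC\<^esub> basis_path ?xy \<in> IC"
    using ideal.I_l_closed[OF C.ideal_I R(1) basis_path_carrier[OF q1]] .
  ultimately have "basis_path (u, q @ [x, y], head QC y) \<in> IC" by simp
  from ideal.I_r_closed[OF C.ideal_I this basis_path_carrier[OF yC(3)]]
  have "basis_path (u, q @ [x, y], head QC y) \<otimes>\<^bsub>path_algebra QC\<^esub> basis_path (head QC y, p2, v) \<in> IC" .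
  moreover have "(basis_path (u, q @ [x, y], head QC y) :: _ \<Rightarrow> 'k) \<otimes>\<^bsub>path_algebra QC\<^esub> basis_path (head QC y, p2, v)
    = basis_path (u, p, v)"
    using basis_path_mult[OF paths_append[OF q1 R(2)], of p2 v] unfolding y(1) q by simp
  ultimately show ?thesis by simp
qed

text \<open>The point is that the extension satisfies \<open>IC\<close>. A relation between vertices
  of \<open>QA\<close> is the sum of its part \<open>\<sigma>\<close> on paths inside
  \<open>QA\<close> and of mixed paths; the latter lie in \<open>IC\<close> by
  \<open>mixed_path_in_ideal\<close>, so \<open>\<sigma>\<close> lies in \<open>IC\<close> and hence
  in \<open>IA\<close>. If an end point is outside \<open>QA\<close>, either the space is zero or
  every path contains an arrow acting as zero.\<close>

lemma ext_mod:
  assumes M: "M \<in> mod_of QA IA"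
  shows "resA M \<in> mod_of QC IC"
  unfolding mod_of_def mem_Collect_eq
proof (intro conjI ballI)
  fix x assume "x \<in> verts QC"
  then show "fd_space (space (resA M) x)" using A.mod_fd[OF M] by simp
next
  fix a assume a: "a \<in> arcs QC"
  show "linear_map (space (resA M) (tail QC a)) (space (resA M) (head QC a)) (act (resA M) a)"
  proof (cases "a \<in> arcs QA")
    case True
    then show ?thesis using A.mod_act[OF M True] arc_A[OF True] by simp
  next
    case False
    then show ?thesis using A.mod_0[OF M] by (simp add: linear_map_def)
  qed
next
  fix \<rho> u v m assume \<rho>: "\<rho> \<in> IC" and uv: "u \<in> verts QC" "v \<in> verts QC" and m: "m \<in> space (resA M) u"
  have act0: "act (resA M) a 0 = 0" for a
    using A.mod_act_0[OF M, of a] by (simp add: zero_fun_def)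
  have fold0: "fold (act (resA M)) p 0 = 0" for p
    by (induction p) (simp_all only: fold_simps act0)
  have foldz: "fold (act (resA M)) p m = 0" if "\<not> set p \<subseteq> arcs QA" for p m
    using that
  proof (induction p arbitrary: m)
    case (Cons a p)
    show ?case
    proof (cases "a \<in> arcs QA")
      case True
      then show ?thesis using Cons by simp
    next
      case False
      then have "act (resA M) a m = 0" by (simp add: zero_fun_def)
      then show ?thesis using fold0[of p] by (simp only: fold_simps)
    qed
  qed simp
  have P: "(u, p, v) \<in> paths QC" if "\<rho> (u, p, v) \<noteq> 0" for p
    using that ideal.Icarr[OF C.ideal_I \<rho>] by (auto simp: path_algebra_def)
  show "(\<Sum>p | \<rho> (u, p, v) \<noteq> 0. scale (\<rho> (u, p, v)) (fold (act (resA M)) p m)) = 0"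
  proof (cases "u \<in> verts QA \<and> v \<in> verts QA")
    case False
    have "fold (act (resA M)) p m = 0" if "\<rho> (u, p, v) \<noteq> 0" for p
    proof (cases "u \<in> verts QA")
      case True
      then have "(u, p, v) \<notin> paths QA" using False by (auto simp: paths_def)
      then show ?thesis using foldz paths_A_iff P[OF that] True by blast
    next
      case False
      then show ?thesis using m fold0 by simp
    qed
    then show ?thesis by (intro sum.neutral) (metis (mono_tags, lifting) mem_Collect_eq seq.scale_zero_right)
  next
    case True
    define \<sigma> where "\<sigma> = (\<lambda>r. if r \<in> paths QA then C.corner u v \<rho> r else 0)"
    have c: "C.corner u v \<rho> \<in> IC" "C.corner u v \<rho> \<in> C.pspace u v"
      using C.corner_in_ideal[OF C.ideal_I \<rho> uv] by blast+
    have s0: "\<sigma> (u, p, v) = (if set p \<subseteq> arcs QA then \<rho> (u, p, v) else 0)" if "\<rho> (u, p, v) \<noteq> 0" for p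
      unfolding \<sigma>_def C.corner_def using paths_A_iff P[OF that] True by simp
    have s1: "{r. \<sigma> r \<noteq> 0} \<subseteq> {r. C.corner u v \<rho> r \<noteq> 0}" "{r. \<sigma> r \<noteq> 0} \<subseteq> paths QA"
      unfolding \<sigma>_def by auto
    moreover have "finite {r. C.corner u v \<rho> r \<noteq> 0}" "{r. C.corner u v \<rho> r \<noteq> 0} \<subseteq> paths QC"
      using c(2) unfolding C.pspace_def path_algebra_def by auto
    ultimately have scar: "\<sigma> \<in> carrier (path_algebra QA)" "\<sigma> \<in> carrier (path_algebra QC)"
      unfolding path_algebra_def using finite_subset[OF s1(1)] by auto
    have "\<sigma> \<in> C.pspace u v"
      using scar(2) s1(1) c(2) unfolding C.pspace_def by blast
    then have d: "C.corner u v \<rho> - \<sigma> \<in> C.pspace u v" (is "?d \<in> _")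
      using c(2) fs.subspace_diff[OF C.subspace_pspace] by blast
    have "?d = (\<Sum>p | ?d (u, p, v) \<noteq> 0. fscale (?d (u, p, v)) (basis_path (u, p, v)))"
      by (rule C.pspace_expand(3)[OF d])
    also have "\<dots> \<in> IC"
    proof (intro fs.subspace_sum[OF C.subspace_I] fs.subspace_scale[OF C.subspace_I])
      fix p assume "p \<in> {p. ?d (u, p, v) \<noteq> 0}"
      then have "(u, p, v) \<in> paths QC" "(u, p, v) \<notin> paths QA"
        using C.pspace_expand(2)[OF d, of p] by (auto simp: \<sigma>_def)
      then show "basis_path (u, p, v) \<in> IC" using mixed_path_in_ideal True paths_A_iff by blast
    qed
    finally have "\<sigma> \<in> IC"
      using fs.subspace_diff[OF C.subspace_I c(1), of ?d] by simp
    then have "\<sigma> \<in> IA" using scar(1) morita unfolding Morita_context_ideal_def by blast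
    moreover have "m \<in> space M u" using m True by simp
    ultimately have Z: "(\<Sum>p | \<sigma> (u, p, v) \<noteq> 0. scale (\<sigma> (u, p, v)) (fold (act M) p m)) = 0"
      using M True unfolding mod_of_def by blast
    have fin: "finite {p. \<rho> (u, p, v) \<noteq> 0}"
      using C.pspace_expand(1)[OF c(2)] by (simp add: C.corner_def)
    have sub: "{p. \<sigma> (u, p, v) \<noteq> 0} \<subseteq> {p. \<rho> (u, p, v) \<noteq> 0}"
      by (auto simp: \<sigma>_def C.corner_def split: if_splits)
    have "(\<Sum>p | \<rho> (u, p, v) \<noteq> 0. scale (\<rho> (u, p, v)) (fold (act (resA M)) p m)) =
      (\<Sum>p | \<sigma> (u, p, v) \<noteq> 0. scale (\<sigma> (u, p, v)) (fold (act M) p m))"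
    proof (rule sum.mono_neutral_cong_right[OF fin sub])
      show "\<forall>p\<in>{p. \<rho> (u, p, v) \<noteq> 0} - {p. \<sigma> (u, p, v) \<noteq> 0}. scale (\<rho> (u, p, v)) (fold (act (resA M)) p m) = 0"
      proof
        fix p assume "p \<in> {p. \<rho> (u, p, v) \<noteq> 0} - {p. \<sigma> (u, p, v) \<noteq> 0}"
        then have "\<not> set p \<subseteq> arcs QA" using s0[of p] by auto
        then show "scale (\<rho> (u, p, v)) (fold (act (resA M)) p m) = 0"
          using foldz seq.scale_zero_right by metis
      qed
      fix p assume p: "p \<in> {p. \<sigma> (u, p, v) \<noteq> 0}"
      then have "\<rho> (u, p, v) \<noteq> 0" using sub by blast
      then have "set p \<subseteq> arcs QA" "\<sigma> (u, p, v) = \<rho> (u, p, v)" using s0[of p] p by (auto split: if_splits)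
      moreover have "fold (act (resA M)) p m = fold (act M) p m" if "set p \<subseteq> arcs QA" for p m
        using that by (induction p arbitrary: m) auto
      ultimately show "scale (\<rho> (u, p, v)) (fold (act (resA M)) p m) = scale (\<sigma> (u, p, v)) (fold (act M) p m)" by simp
    qed
    then show ?thesis using Z by simp
  qed
qed

lemma res_mod:
  assumes M: "M \<in> mod_of QC IC"
  shows "resA M \<in> mod_of QA IA"
  unfolding mod_of_def mem_Collect_eq
proof (intro conjI ballI)
  fix x assume "x \<in> verts QA"
  then show "fd_space (space (resA M) x)" using C.mod_fd[OF M verts_A_C] by simp
next
  fix a assume a: "a \<in> arcs QA"
  then show "linear_map (space (resA M) (tail QA a)) (space (resA M) (head QA a)) (act (resA M) a)"
    using C.mod_act[OF M arcs_A_C[OF a]] arc_A[OF a] by simp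
next
  fix \<rho> u v m assume \<rho>: "\<rho> \<in> IA" and uv: "u \<in> verts QA" "v \<in> verts QA" and m: "m \<in> space (resA M) u"
  have "\<rho> \<in> IC" using \<rho> morita unfolding Morita_context_ideal_def by blast
  then have Z: "(\<Sum>p | \<rho> (u, p, v) \<noteq> 0. scale (\<rho> (u, p, v)) (fold (act M) p m)) = 0"
    using M m uv verts_A_C unfolding mod_of_def by simp
  have "fold (act (resA M)) p m = fold (act M) p m" if "set p \<subseteq> arcs QA" for p m
    using that by (induction p arbitrary: m) auto
  moreover have "set p \<subseteq> arcs QA" if "\<rho> (u, p, v) \<noteq> 0" for p
  proof -
    have "(u, p, v) \<in> paths QA" using that ideal.Icarr[OF A.ideal_I \<rho>] by (auto simp: path_algebra_def)
    then show ?thesis using paths_A_iff by blast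
  qed
  ultimately have "(\<Sum>p | \<rho> (u, p, v) \<noteq> 0. scale (\<rho> (u, p, v)) (fold (act (resA M)) p m)) =
    (\<Sum>p | \<rho> (u, p, v) \<noteq> 0. scale (\<rho> (u, p, v)) (fold (act M) p m))"
    by (intro sum.cong) simp_all
  then show "(\<Sum>p | \<rho> (u, p, v) \<noteq> 0. scale (\<rho> (u, p, v)) (fold (act (resA M)) p m)) = 0" using Z by simp
qed

section \<open>Restriction and extension by zero as additive functors\<close>

lemma restrict_restrict [simp]: "restrict_rep Q (restrict_rep Q M) = restrict_rep Q M"
  by (simp add: restrict_rep_def fun_eq_iff)

lemma resA_mod_A: "M \<in> mod_of QA IA \<Longrightarrow> resA M \<in> mod_of QA IA"
  using res_mod[OF ext_mod] by simp

text \<open>Restriction changes only values outside \<open>QA\<close>, which do not count over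
  \<open>QA\<close>; but the records may differ, hence an isomorphism in place of an
  equation.\<close>

lemma isom_resA: "M \<in> mod_of QA IA \<Longrightarrow> A.additive.isom IA M (resA M)"
  by (rule A.same_space_isom) (simp_all add: resA_mod_A)

lemma res_hom:
  assumes "rep_hom QC M N f" shows "rep_hom QA (resA M) (resA N) f"
  unfolding rep_hom_def
proof (intro conjI ballI)
  fix x assume "x \<in> verts QA"
  then show "linear_map (space (resA M) x) (space (resA N) x) (f x)"
    using C.rep_hom_linear[OF assms verts_A_C] by simp
next
  fix a m assume a: "a \<in> arcs QA" and m: "m \<in> space (resA M) (tail QA a)"
  then show "f (head QA a) (act (resA M) a m) = act (resA N) a (f (tail QA a) m)"
    using C.rep_hom_act[OF assms arcs_A_C[OF a]] arc_A[OF a] by simp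
qed

lemma ext_hom:
  assumes M: "M \<in> mod_of QA IA" and "rep_hom QA M N f"
  shows "rep_hom QC (resA M) (resA N) (\<lambda>x. if x \<in> verts QA then f x else (\<lambda>m. 0))"
  unfolding rep_hom_def
proof (intro conjI ballI)
  fix x assume "x \<in> verts QC"
  then show "linear_map (space (resA M) x) (space (resA N) x) (if x \<in> verts QA then f x else (\<lambda>m. 0))"
    using A.rep_hom_linear[OF assms(2)] by (simp add: linear_map_def)
next
  fix a m assume a: "a \<in> arcs QC" and m: "m \<in> space (resA M) (tail QC a)"
  show "(if head QC a \<in> verts QA then f (head QC a) else (\<lambda>m. 0)) (act (resA M) a m) =
    act (resA N) a ((if tail QC a \<in> verts QA then f (tail QC a) else (\<lambda>m. 0)) m)"
  proof (cases "a \<in> arcs QA")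
    case True
    then show ?thesis using A.rep_hom_act[OF assms(2) True] m arc_A[OF True] by simp
  next
    case False
    then show ?thesis using A.rep_hom_0[OF M assms(2), of "head QC a"] by (simp add: zero_fun_def)
  qed
qed

lemma res_isom:
  assumes "C.additive.isom IC M N" shows "A.additive.isom IA (resA M) (resA N)"
proof -
  have MN: "M \<in> mod_of QC IC" "N \<in> mod_of QC IC" using assms C.additive.isom_Ob by blast+
  obtain f where f: "rep_hom QC M N f" "\<forall>x\<in>verts QC. bij_betw (f x) (space M x) (space N x)"
    using C.isom_imp_bij[OF assms] by blast
  have "bij_betw (f x) (space (resA M) x) (space (resA N) x)" if "x \<in> verts QA" for x
    using f(2) that verts_A_C by simp
  then show ?thesis
    using A.bij_inverse_pair[OF res_mod[OF MN(1)] res_mod[OF MN(2)] res_hom[OF f(1)]]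
    unfolding A.additive.isom_def by blast
qed

lemma ext_isom:
  assumes "A.additive.isom IA M N" shows "C.additive.isom IC (resA M) (resA N)"
proof -
  have MN: "M \<in> mod_of QA IA" "N \<in> mod_of QA IA" using assms A.additive.isom_Ob by blast+
  obtain f where f: "rep_hom QA M N f" "\<forall>x\<in>verts QA. bij_betw (f x) (space M x) (space N x)"
    using A.isom_imp_bij[OF assms] by blast
  let ?g = "\<lambda>x. if x \<in> verts QA then f x else (\<lambda>m. 0)"
  have "bij_betw (?g x) (space (resA M) x) (space (resA N) x)" if "x \<in> verts QC" for x
    using f(2) by (auto simp: bij_betw_def)
  then show ?thesis
    using C.bij_inverse_pair[OF ext_mod[OF MN(1)] ext_mod[OF MN(2)] ext_hom[OF MN(1) f(1)]]
    unfolding C.additive.isom_def by blast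
qed

lemma res_decomp:
  assumes "C.additive.decomp IC M N L" shows "A.additive.decomp IA (resA M) (resA N) (resA L)"
proof -
  have NL: "N \<in> mod_of QC IC" "L \<in> mod_of QC IC" using assms C.additive.decomp_Ob by blast+
  note r = res_mod[OF NL(1)] res_mod[OF NL(2)]
  have "A.additive.isom IA (resA M) (resA (dsum N L))"
    using res_isom[OF C.additive.decomp_unique[OF assms C.decomp_dsum[OF NL]]] .
  moreover have "A.additive.isom IA (resA (dsum N L)) (dsum (resA N) (resA L))"
    by (rule A.same_space_isom[OF res_mod[OF C.dsum_mod[OF NL]]])
      (simp_all add: dsum_space dsum_act A.dsum_mod[OF r])
  ultimately show ?thesis
    using A.additive.decomp_isom[OF A.decomp_dsum[OF r] A.additive.isom_trans] by blast
qed

lemma ext_decomp: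
  assumes "A.additive.decomp IA M N L" shows "C.additive.decomp IC (resA M) (resA N) (resA L)"
proof -
  have NL: "N \<in> mod_of QA IA" "L \<in> mod_of QA IA" using assms A.additive.decomp_Ob by blast+
  note r = ext_mod[OF NL(1)] ext_mod[OF NL(2)]
  have "C.additive.isom IC (resA M) (resA (dsum N L))"
    using ext_isom[OF A.additive.decomp_unique[OF assms A.decomp_dsum[OF NL]]] .
  moreover have "C.additive.isom IC (resA (dsum N L)) (dsum (resA N) (resA L))"
  proof (rule C.same_space_isom[OF ext_mod[OF A.dsum_mod[OF NL]] _ _ C.dsum_mod[OF r]])
    fix x
    have "deint0 z = 0 \<and> deint1 z = 0 \<longleftrightarrow> z = 0" for z :: "nat \<Rightarrow> 'k"
      using interleave_deint[of z] by (metis interleave_zero deint_linear(5,6))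
    then have "{z. deint0 z = 0 \<and> deint1 z = 0} = {0 :: nat \<Rightarrow> 'k}" by blast
    then show "space (dsum (resA N) (resA L)) x = space (resA (dsum N L)) x"
      by (simp add: dsum_space)
    show "act (dsum (resA N) (resA L)) a m = act (resA (dsum N L)) a m" for a m
      by (simp add: dsum_act interleave_zero[unfolded zero_fun_def] zero_fun_def)
  qed
  ultimately show ?thesis
    using C.additive.decomp_isom[OF C.decomp_dsum[OF r] C.additive.isom_trans] by blast
qed

lemma res_null: "C.additive.null IC M \<Longrightarrow> A.additive.null IA (resA M)"
  unfolding A.null_iff C.null_iff using res_mod by simp (blast intro: verts_A_C)

lemma ext_null: "A.additive.null IA M \<Longrightarrow> C.additive.null IC (resA M)"
  unfolding A.null_iff C.null_iff using ext_mod by simp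

lemma res_retract: "C.additive.retract IC L M \<Longrightarrow> A.additive.retract IA (resA L) (resA M)"
  using C.retract_split[of IC L M] res_decomp A.additive.decomp_retract by blast

lemma ext_retract: "A.additive.retract IA L M \<Longrightarrow> C.additive.retract IC (resA L) (resA M)"
  using A.retract_split[of IA L M] ext_decomp C.additive.decomp_retract by blast

lemma res_add:
  assumes "C.cat.add_closure IC Vs M" shows "A.cat.add_closure IA (resA ` Vs) (resA M)"
  using assms
proof induction
  case (zero M)
  then show ?case using A.cat.add_closure.zero res_null by blast
next
  case (base V M)
  then show ?case using A.cat.add_closure.base[of "resA V" "resA ` Vs"] res_retract by blast
next
  case (sum M N L)
  then show ?case using A.cat.add_closure.sum res_decomp by blast
qed

lemma ext_add:
  assumes "A.cat.add_closure IA Vs M" shows "C.cat.add_closure IC (resA ` Vs) (resA M)"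
  using assms
proof induction
  case (zero M)
  then show ?case using C.cat.add_closure.zero ext_null by blast
next
  case (base V M)
  then show ?case using C.cat.add_closure.base[of "resA V" "resA ` Vs"] ext_retract by blast
next
  case (sum M N L)
  then show ?case using C.cat.add_closure.sum ext_decomp by blast
qed

section \<open>Splitting of syzygies over \<open>C\<close>\<close>

lemma split_connecting:
  assumes N: "N \<in> mod_of QC IC"
    and z: "\<And>y m. y \<in> \<alpha>s \<union> \<beta>s \<Longrightarrow> m \<in> space N (tail QC y) \<Longrightarrow> act N y m = 0"
  shows "C.additive.decomp IC N (resA N) (resB N)"
proof -
  interpret S: gluing QB QA QC IB IA IC \<beta>s \<alpha>s by (rule gluing_swap)
  have AB: "resA N \<in> mod_of QC IC" "resB N \<in> mod_of QC IC"
    using ext_mod[OF res_mod[OF N]] S.ext_mod[OF S.res_mod[OF N]] by simp_all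
  \<comment> \<open>Each vertex lies in exactly one of \<open>QA\<close> and \<open>QB\<close>, and
    its space is sent to the matching half of the interleaving.\<close>
  let ?f = "\<lambda>x m. if x \<in> verts QA then interleave m 0 else interleave 0 m"
  have "rep_hom QC N (dsum (resA N) (resB N)) ?f"
    unfolding rep_hom_def
  proof (intro conjI ballI)
    fix x assume x: "x \<in> verts QC"
    show "linear_map (space N x) (space (dsum (resA N) (resB N)) x) (?f x)"
      using x verts_C verts_not_both[of x]
      by (auto simp: linear_map_def dsum_space interleave_add interleave_scale)
  next
    fix a m assume a: "a \<in> arcs QC" and m: "m \<in> space N (tail QC a)"
    have N0: "act N a 0 = 0" using C.mod_act_0[OF N a] .
    consider "a \<in> arcs QA" | "a \<in> arcs QB" | "a \<in> \<alpha>s \<union> \<beta>s" using a arcs_C by blast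
    then show "?f (head QC a) (act N a m) = act (dsum (resA N) (resB N)) a (?f (tail QC a) m)"
    proof cases
      case 1
      then have "a \<notin> arcs QB" using arcs_disjoint by blast
      then show ?thesis using 1 arc_A[OF 1] by (simp add: dsum_act zero_fun_def)
    next
      case 2
      then have "a \<notin> arcs QA" "tail QC a \<notin> verts QA" "head QC a \<notin> verts QA"
        using arcs_disjoint arc_B[OF 2] verts_disjoint by (blast, metis disjoint_iff, metis disjoint_iff)
      then show ?thesis using 2 by (simp add: dsum_act zero_fun_def)
    next
      case 3
      then have "a \<notin> arcs QA" "a \<notin> arcs QB" using arcs_disjoint by blast+
      moreover have "?f (head QC a) 0 = 0" by simp
      ultimately show ?thesis using z[OF 3 m] by (simp add: dsum_act zero_fun_def)
    qed
  qed
  moreover have "bij_betw (?f x) (space N x) (space (dsum (resA N) (resB N)) x)" if x: "x \<in> verts QC" for x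
  proof (rule bij_betw_byWitness[where f' = "\<lambda>z. if x \<in> verts QA then deint0 z else deint1 z"])
    have "interleave (deint0 z) 0 = z" if "deint1 z = 0" for z :: "nat \<Rightarrow> 'k"
      using interleave_deint[of z] that by simp
    moreover have "interleave 0 (deint1 z) = z" if "deint0 z = 0" for z :: "nat \<Rightarrow> 'k"
      using interleave_deint[of z] that by simp
    ultimately show "\<forall>z\<in>space (dsum (resA N) (resB N)) x. ?f x (if x \<in> verts QA then deint0 z else deint1 z) = z"
      using verts_not_both[of x] x verts_C by (auto simp: dsum_space)
    show "?f x ` space N x \<subseteq> space (dsum (resA N) (resB N)) x"
      using x verts_C verts_not_both[of x] by (auto simp: dsum_space)
    show "(\<lambda>z. if x \<in> verts QA then deint0 z else deint1 z) ` space (dsum (resA N) (resB N)) x \<subseteq> space N x"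
      using x verts_C by (auto simp: dsum_space)
  qed simp
  ultimately have "C.additive.isom IC N (dsum (resA N) (resB N))"
    using C.bij_inverse_pair[OF N C.dsum_mod[OF AB]] unfolding C.additive.isom_def by blast
  then show ?thesis using C.additive.decomp_isom[OF C.decomp_dsum[OF AB]] by blast
qed

lemma cover_kernel_split:
  assumes M: "M \<in> mod_of QC IC" and c: "projective_cover QC IC M P f"
  shows "C.additive.decomp IC (kernel_rep P f) (resA (kernel_rep P f)) (resB (kernel_rep P f))"
proof (rule split_connecting[OF C.cover_kernel_mod[OF c M]])
  fix y m assume y: "y \<in> \<alpha>s \<union> \<beta>s" and m: "m \<in> space (kernel_rep P f) (tail QC y)"
  have "y \<in> arcs QC" using y arcs_C by blast
  then have "m \<in> C.rad P (tail QC y)"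
    using c m unfolding C.projective_cover_iff_rad[OF M] by (meson C.wellformed(1) subsetD)
  moreover have "P \<in> mod_of QC IC" using c C.projective_mod unfolding projective_cover_def by blast
  ultimately show "act (kernel_rep P f) y m = 0" using connecting_kills_rad[OF _ y] by simp
qed

lemma syzygy_split:
  assumes "M \<in> mod_of QC IC"
  shows "C.additive.decomp IC (syzygy QC IC M) (resA (syzygy QC IC M)) (resB (syzygy QC IC M))"
  using C.syzygy_cover[OF assms] cover_kernel_split[OF assms] by metis

text \<open>
  Over \<open>C\<close>, the projective cover \<open>P\<close> of an \<open>A\<close>-module has its top supported on \<open>QA\<close>, so that the
  arrows from \<open>QB\<close> to \<open>QA\<close> act on \<open>P\<close> as zero and \<open>\<Pi>\<^sub>A P\<close> stays projective.
\<close>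

lemma res_cover:
  assumes X0: "X0 \<in> mod_of QA IA" and c: "projective_cover QC IC (resA X0) P f"
  shows "projective_cover QA IA (resA X0) (resA P) f" "\<And>x. x \<in> verts QB \<Longrightarrow> space P x = C.rad P x"
proof -
  have E: "resA X0 \<in> mod_of QC IC" using ext_mod[OF X0] .
  have P: "C.projective P" "rep_epi QC P (resA X0) f" "\<forall>x\<in>verts QC. space (kernel_rep P f) x \<subseteq> C.rad P x"
    using c C.projective_cover_iff_rad[OF E] by blast+
  have PM: "P \<in> mod_of QC IC" using P(1) C.projective_mod by blast
  have fh: "rep_hom QC P (resA X0) f" using P(2) C.rep_epi_hom by blast
  \<comment> \<open>The target of the cover is zero at the vertices of \<open>QB\<close>, so there
    its kernel is all of \<open>P\<close>, and the kernel of a cover lies in the radical.\<close>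
  show PB: "space P x = C.rad P x" if x: "x \<in> verts QB" for x
  proof
    have xC: "x \<in> verts QC" using x verts_C by blast
    show "C.rad P x \<subseteq> space P x" using C.rad_subset[OF PM xC] .
    show "space P x \<subseteq> C.rad P x"
    proof
      fix z assume z: "z \<in> space P x"
      have "x \<notin> verts QA" using x verts_disjoint by blast
      then have "f x z = 0" using C.rep_hom_mem[OF fh xC z] by simp
      then show "z \<in> C.rad P x" using P(3) xC z by auto
    qed
  qed
  have beta0: "act P y m = 0" if y: "y \<in> \<beta>s" and m: "m \<in> space P (tail QC y)" for y m
  proof -
    have "m \<in> C.rad P (tail QC y)" using PB arc_beta[OF y] m by blast
    then show ?thesis using connecting_kills_rad[OF PM] y by blast
  qed
  have rP: "resA P \<in> mod_of QA IA" using res_mod[OF PM] .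
  have "A.projective (resA P)"
    unfolding projective_rep_def
  proof (intro conjI ballI allI impI rP)
    fix M N e g
    assume MN: "M \<in> mod_of QA IA" "N \<in> mod_of QA IA" and "rep_epi QA M N e \<and> rep_hom QA (resA P) N g"
    then have e: "rep_epi QA M N e" and g: "rep_hom QA (resA P) N g" by blast+
    \<comment> \<open>A lifting problem over \<open>A\<close> is extended by zero to one over
      \<open>C\<close>, where \<open>P\<close> is projective. That \<open>?g\<close> respects the
      arrows entering \<open>QA\<close> from \<open>QB\<close> is due to
      \<open>beta0\<close>.\<close>
    let ?e = "\<lambda>x. if x \<in> verts QA then e x else (\<lambda>m. 0)" and ?g = "\<lambda>x. if x \<in> verts QA then g x else (\<lambda>m. 0)"
    have epi: "rep_epi QC (resA M) (resA N) ?e"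
      unfolding rep_epi_def
    proof (intro conjI ballI)
      show "rep_hom QC (resA M) (resA N) ?e" using ext_hom[OF MN(1) A.rep_epi_hom[OF e]] .
      fix x show "?e x ` space (resA M) x = space (resA N) x" using A.rep_epi_surj[OF e, of x] by simp
    qed
    have hom: "rep_hom QC P (resA N) ?g"
      unfolding rep_hom_def
    proof (intro conjI ballI)
      fix x assume "x \<in> verts QC"
      then show "linear_map (space P x) (space (resA N) x) (?g x)"
        using A.rep_hom_linear[OF g, of x] by (simp add: linear_map_def)
    next
      fix a m assume a: "a \<in> arcs QC" and m: "m \<in> space P (tail QC a)"
      consider "a \<in> arcs QA" | "a \<notin> arcs QA" "head QC a \<notin> verts QA" | "a \<notin> arcs QA" "a \<in> \<beta>s"
        using not_A_arc[OF a] arc_B[of a] arc_alpha[of a] verts_not_both by metis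
      then show "?g (head QC a) (act P a m) = act (resA N) a (?g (tail QC a) m)"
      proof cases
        case 1
        then show ?thesis using A.rep_hom_act[OF g 1] m arc_A[OF 1] by simp
      next
        case 2
        then show ?thesis by (simp add: zero_fun_def)
      next
        case 3
        have "act P a m = 0" using beta0[OF 3(2) m] .
        moreover have "?g (head QC a) 0 = 0" using A.rep_hom_0[OF rP g, of "head QC a"] by (simp add: zero_fun_def)
        ultimately show ?thesis using 3(1) by (simp add: zero_fun_def)
      qed
    qed
    obtain h where h: "rep_hom QC P (resA M) h"
      "\<And>x z. x \<in> verts QC \<Longrightarrow> z \<in> space P x \<Longrightarrow> ?e x (h x z) = ?g x z"
      using C.projective_lift[OF P(1) ext_mod[OF MN(1)] ext_mod[OF MN(2)] epi hom] by blast
    have "rep_hom QA (resA P) M h"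
      using res_hom[OF h(1)] unfolding restrict_restrict rep_hom_def by simp
    moreover have "\<forall>x\<in>verts QA. \<forall>z\<in>space (resA P) x. e x (h x z) = g x z"
    proof (intro ballI)
      fix x z assume x: "x \<in> verts QA" and "z \<in> space (resA P) x"
      then have "z \<in> space P x" by simp
      from h(2)[OF verts_A_C[OF x] this] show "e x (h x z) = g x z" using x by simp
    qed
    ultimately show "\<exists>h. rep_hom QA (resA P) M h \<and> (\<forall>x\<in>verts QA. \<forall>z\<in>space (resA P) x. e x (h x z) = g x z)" by blast
  qed
  moreover have "rep_epi QA (resA P) (resA X0) f"
    unfolding rep_epi_def
  proof (intro conjI ballI)
    show "rep_hom QA (resA P) (resA X0) f" using res_hom[OF fh] by simp
    fix x assume "x \<in> verts QA"
    then show "f x ` space (resA P) x = space (resA X0) x" using C.rep_epi_surj[OF P(2) verts_A_C] by simp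
  qed
  moreover have "space (kernel_rep (resA P) f) x \<subseteq> A.rad (resA P) x" if x: "x \<in> verts QA" for x
  proof -
    \<comment> \<open>At a vertex of \<open>QA\<close> the arrows from \<open>QB\<close> contribute
      nothing to the radical, by \<open>beta0\<close>, so passing to \<open>QA\<close> does not make
      the radical smaller.\<close>
    have "C.rad P x \<subseteq> A.rad (resA P) x"
    proof (rule C.rad_least[OF A.rad_subspace])
      fix a m assume a: "a \<in> arcs QC" "head QC a = x" "m \<in> space P (tail QC a)"
      consider "a \<in> arcs QA" | "a \<in> \<beta>s"
        using not_A_arc[OF a(1)] arc_B[of a] arc_alpha[of a] verts_not_both[OF x] a(2) by metis
      then show "act P a m \<in> A.rad (resA P) x"
      proof cases
        case 1
        then show ?thesis using A.rad_act[OF 1, of m "resA P"] arc_A[OF 1] a by simp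
      next
        case 2
        then show ?thesis using beta0[OF 2 a(3)] seq.subspace_0[OF A.rad_subspace] by metis
      qed
    qed
    moreover have "space (kernel_rep P f) x \<subseteq> C.rad P x" using P(3) verts_A_C[OF x] by blast
    ultimately show ?thesis using x by simp
  qed
  ultimately show "projective_cover QA IA (resA X0) (resA P) f"
    using A.projective_cover_iff_rad[OF resA_mod_A[OF X0]] by blast
qed

text \<open>The \<open>A\<close>-part is the kernel of the restricted cover of
  \<open>res_cover\<close>. The \<open>B\<close>-part is all of \<open>P\<close> over
  \<open>QB\<close>, which there equals its radical; so it agrees with the \<open>B\<close>-part of
  the syzygy of the top of \<open>P\<close>, and \<open>syzygy_semisimple\<close> applies.\<close>

lemma syzygy_ext:
  assumes Ss: "complete_simples QC IC Ss" and X0: "X0 \<in> mod_of QA IA"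
  obtains Z where "C.additive.decomp IC (syzygy QC IC (resA X0)) (resA (syzygy QA IA X0)) (resB Z)"
    "B.cat.add_closure IB {resB (syzygy QC IC (dsum_list Ss))} Z"
proof -
  interpret S: gluing QB QA QC IB IA IC \<beta>s \<alpha>s by (rule gluing_swap)
  have E: "resA X0 \<in> mod_of QC IC" using ext_mod[OF X0] .
  obtain P f where c: "projective_cover QC IC (resA X0) P f" "syzygy QC IC (resA X0) = kernel_rep P f"
    using C.syzygy_cover[OF E] by blast
  let ?K = "kernel_rep P f"
  have K: "?K \<in> mod_of QC IC" using C.cover_kernel_mod[OF c(1) E] .
  have P: "C.projective P" "P \<in> mod_of QC IC" using c(1) C.projective_mod unfolding projective_cover_def by blast+
  note rc = res_cover[OF X0 c(1)]
  have "A.additive.isom IA (resA ?K) (kernel_rep (resA P) f)"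
    by (rule A.same_space_isom[OF res_mod[OF K]]) (simp_all add: A.cover_kernel_mod[OF rc(1) resA_mod_A[OF X0]])
  moreover have "A.additive.isom IA (syzygy QA IA X0) (kernel_rep (resA P) f)"
    using A.additive.isom_trans[OF A.syzygy_isom[OF isom_resA[OF X0]] A.syzygy_isom_cover[OF rc(1) resA_mod_A[OF X0]]] .
  ultimately have "A.additive.isom IA (resA ?K) (syzygy QA IA X0)"
    using A.additive.isom_trans A.additive.isom_sym by blast
  from ext_isom[OF this] have kA: "C.additive.isom IC (resA ?K) (resA (syzygy QA IA X0))" by simp
  \<comment> \<open>The projection to the top is a projective cover with the same domain
    \<open>P\<close>, so its kernel is, up to isomorphism, the syzygy of the semisimple module
    \<open>T\<close>.\<close>
  obtain T p where T: "T \<in> mod_of QC IC" "C.zero_arrows T" "projective_cover QC IC T P p"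
    "\<And>x. x \<in> verts QC \<Longrightarrow> space (kernel_rep P p) x = C.rad P x"
    using C.top_exists[OF P(1)] by metis
  let ?R = "kernel_rep P p"
  have R: "?R \<in> mod_of QC IC" using C.cover_kernel_mod[OF T(3,1)] .
  have "B.additive.isom IB (resB ?R) (resB ?K)"
  proof (rule B.same_space_isom[OF S.res_mod[OF R] _ _ S.res_mod[OF K]])
    fix x assume x: "x \<in> verts QB"
    then have xC: "x \<in> verts QC" and xA: "x \<notin> verts QA" using verts_C verts_disjoint by blast+
    have "rep_hom QC P (resA X0) f" using c(1) unfolding projective_cover_def rep_epi_def by blast
    then have "f x z = 0" if "z \<in> space P x" for z using C.rep_hom_mem[OF _ xC that] xA by fastforce
    then have "space ?K x = space P x" by auto
    then show "space (resB ?K) x = space (resB ?R) x"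
      using x T(4)[OF xC] rc(2)[OF x] by (simp del: kernel_rep_simps(1))
  qed simp
  moreover have "B.additive.isom IB (resB (syzygy QC IC T)) (resB ?R)"
    using S.res_isom[OF C.syzygy_isom_cover[OF T(3,1)]] .
  ultimately have "B.additive.isom IB (resB ?K) (resB (syzygy QC IC T))"
    using B.additive.isom_trans B.additive.isom_sym by blast
  moreover have "B.cat.add_closure IB (resB ` {syzygy QC IC (dsum_list Ss)}) (resB (syzygy QC IC T))"
    using S.res_add[OF C.syzygy_semisimple[OF Ss T(1,2)]] .
  ultimately have "B.cat.add_closure IB {resB (syzygy QC IC (dsum_list Ss))} (resB ?K)"
    using B.cat.add_closure_isom by simp
  moreover have "C.additive.decomp IC ?K (resA (syzygy QA IA X0)) (resB (resB ?K))"
    using C.additive.decomp_cong[OF cover_kernel_split[OF E c(1)] kA C.additive.isom_refl] S.ext_mod[OF S.res_mod[OF K]]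
    by simp
  ultimately show thesis using that[of "resB ?K"] c(2) by simp
qed

end

section \<open>Short exact sequences\<close>

context fin_digraph
begin

lemma short_exact_isom:
  assumes s: "short_exact G M1 M0 M f g" and iso: "additive.isom I M N"
  obtains h where "short_exact G M1 M0 N f h"
proof -
  obtain \<phi> where \<phi>: "rep_hom G M N \<phi>" "\<forall>x\<in>verts G. bij_betw (\<phi> x) (space M x) (space N x)"
    using isom_imp_bij[OF iso] by blast
  have MN: "M \<in> mod_of G I" using iso additive.isom_Ob by blast
  have g: "rep_hom G M0 M g" "\<And>x. x \<in> verts G \<Longrightarrow> g x ` space M0 x = space M x"
    using s unfolding short_exact_def rep_epi_def by blast+
  let ?h = "\<lambda>x m. \<phi> x (g x m)"
  have "\<phi> x (g x m) = 0 \<longleftrightarrow> g x m = 0" if x: "x \<in> verts G" and m: "m \<in> space M0 x" for x m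
  proof -
    have "inj_on (\<phi> x) (space M x)" using \<phi>(2) x unfolding bij_betw_def by blast
    then show ?thesis
      using inj_onD[of "\<phi> x" "space M x" "g x m" 0] rep_hom_mem[OF g(1) x m] mod_0[OF MN x] rep_hom_0[OF MN \<phi>(1) x]
      by metis
  qed
  then have "space (kernel_rep M0 ?h) x = space (kernel_rep M0 g) x" if "x \<in> verts G" for x
    using that by auto
  moreover have "rep_epi G M0 N ?h"
    unfolding rep_epi_def
  proof (intro conjI ballI rep_hom_comp[OF g(1) \<phi>(1)])
    fix x assume x: "x \<in> verts G"
    have "?h x ` space M0 x = \<phi> x ` (g x ` space M0 x)" by (simp add: image_image)
    then show "?h x ` space M0 x = space N x" using g(2)[OF x] \<phi>(2) x unfolding bij_betw_def by simp
  qed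
  ultimately have "short_exact G M1 M0 N f ?h"
    using s unfolding short_exact_def by simp
  then show thesis using that by blast
qed

lemma short_exact_dsum:
  assumes mods: "M1 \<in> mod_of G I" "M0 \<in> mod_of G I" "M \<in> mod_of G I" "N1 \<in> mod_of G I" "N0 \<in> mod_of G I" "N \<in> mod_of G I"
    and s: "short_exact G M1 M0 M f g" and t: "short_exact G N1 N0 N f' g'"
  shows "short_exact G (dsum M1 N1) (dsum M0 N0) (dsum M N)
    (\<lambda>x z. interleave (f x (deint0 z)) (f' x (deint1 z))) (\<lambda>x z. interleave (g x (deint0 z)) (g' x (deint1 z)))"
    (is "short_exact G ?D ?D' ?D'' ?f ?g")
proof -
  have f: "rep_hom G M1 M0 f" "rep_hom G N1 N0 f'"
    and fi: "\<And>x. x \<in> verts G \<Longrightarrow> inj_on (f x) (space M1 x)" "\<And>x. x \<in> verts G \<Longrightarrow> inj_on (f' x) (space N1 x)"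
    and g: "rep_hom G M0 M g" "rep_hom G N0 N g'"
    and gs: "\<And>x. x \<in> verts G \<Longrightarrow> g x ` space M0 x = space M x" "\<And>x. x \<in> verts G \<Longrightarrow> g' x ` space N0 x = space N x"
    and ex: "\<And>x. x \<in> verts G \<Longrightarrow> f x ` space M1 x = space (kernel_rep M0 g) x"
      "\<And>x. x \<in> verts G \<Longrightarrow> f' x ` space N1 x = space (kernel_rep N0 g') x"
    using s t unfolding short_exact_def rep_epi_def rep_mono_def by simp_all
  have img: "(\<lambda>z. interleave (h (deint0 z)) (h' (deint1 z))) ` {z. deint0 z \<in> S \<and> deint1 z \<in> S'} =
    {z. deint0 z \<in> h ` S \<and> deint1 z \<in> h' ` S'}" for h h' :: "(nat \<Rightarrow> 'c) \<Rightarrow> nat \<Rightarrow> 'c" and S S'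
  proof
    show "{z. deint0 z \<in> h ` S \<and> deint1 z \<in> h' ` S'} \<subseteq> (\<lambda>z. interleave (h (deint0 z)) (h' (deint1 z))) ` {z. deint0 z \<in> S \<and> deint1 z \<in> S'}"
    proof
      fix z :: "nat \<Rightarrow> 'c" assume "z \<in> {z. deint0 z \<in> h ` S \<and> deint1 z \<in> h' ` S'}"
      then obtain y y' where y: "y \<in> S" "deint0 z = h y" "y' \<in> S'" "deint1 z = h' y'" by blast
      have "z = interleave (h (deint0 (interleave y y'))) (h' (deint1 (interleave y y')))"
        using interleave_deint[of z] y by simp
      moreover have "interleave y y' \<in> {z. deint0 z \<in> S \<and> deint1 z \<in> S'}" using y by simp
      ultimately show "z \<in> (\<lambda>z. interleave (h (deint0 z)) (h' (deint1 z))) ` {z. deint0 z \<in> S \<and> deint1 z \<in> S'}" by blast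
    qed
  qed auto
  have zero: "interleave y y' = 0 \<longleftrightarrow> y = 0 \<and> y' = 0" for y y' :: "nat \<Rightarrow> 'c"
    by (metis interleave_eq_iff interleave_zero)
  have "rep_mono G ?D ?D' ?f"
    unfolding rep_mono_def
  proof (intro conjI ballI)
    show "rep_hom G ?D ?D' ?f" using rep_hom_dsum[OF mods(1,4,2,5) f] .
    fix x assume x: "x \<in> verts G"
    show "inj_on (?f x) (space ?D x)"
    proof (rule inj_onI)
      fix z z' assume z: "z \<in> space ?D x" "z' \<in> space ?D x" and eq: "?f x z = ?f x z'"
      have e: "f x (deint0 z) = f x (deint0 z')" "f' x (deint1 z) = f' x (deint1 z')"
        using eq unfolding interleave_eq_iff by blast+
      have "deint0 z = deint0 z'" "deint1 z = deint1 z'"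
        using inj_onD[OF fi(1)[OF x], OF e(1)] inj_onD[OF fi(2)[OF x], OF e(2)] z unfolding dsum_space by blast+
      then show "z = z'" by (metis interleave_deint)
    qed
  qed
  moreover have "rep_epi G ?D' ?D'' ?g"
    unfolding rep_epi_def
  proof (intro conjI ballI)
    show "rep_hom G ?D' ?D'' ?g" using rep_hom_dsum[OF mods(2,5,3,6) g] .
    fix x assume x: "x \<in> verts G"
    show "?g x ` space ?D' x = space ?D'' x" unfolding dsum_space img gs(1)[OF x] gs(2)[OF x] ..
  qed
  moreover have "?f x ` space ?D x = space (kernel_rep ?D' ?g) x" if x: "x \<in> verts G" for x
    unfolding dsum_space img ex(1)[OF x] ex(2)[OF x] by (auto simp: dsum_space zero)
  ultimately show ?thesis unfolding short_exact_def by blast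
qed

text \<open>The trivial resolution, to be used for the error term, which itself lies in the additive
  closure of the witness.\<close>

lemma short_exact_zero_left:
  assumes W: "W \<in> mod_of G I"
  shows "short_exact G zero_rep W W (\<lambda>x m. 0) (\<lambda>x m. m)"
  unfolding short_exact_def rep_mono_def rep_epi_def
  using rep_hom_zero[OF zero_rep_mod W] rep_hom_id mod_0[OF W] by (auto simp: zero_rep_def)

end

text \<open>Regroups (A + B) + (C + D) as (A + C) + (B + D); it collects \<open>A\<close>-parts with
  \<open>A\<close>-parts, and main terms with main terms.\<close>

lemma (in krull_schmidt_category) decomp_interchange:
  assumes "decomp W W1 W2" "decomp W1 A B" "decomp W2 C D" "decomp E A C" "decomp F B D"
  shows "decomp W E F"
proof -
  obtain H where H: "decomp H W2 B" using biproduct_exists decomp_Ob assms by meson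
  have "decomp W H A" using decomp_assoc[OF decomp_sym[OF assms(1)] decomp_sym[OF assms(2)] H] .
  moreover have "decomp H F C" using decomp_assoc[OF decomp_sym[OF H] decomp_sym[OF assms(3)] assms(5)] .
  ultimately show ?thesis using decomp_assoc[OF decomp_sym decomp_sym assms(4)] by blast
qed

section \<open>The Igusa--Todorov property\<close>

lemma (in gluing) short_exact_ext:
  assumes mods: "M1 \<in> mod_of QA IA" "M0 \<in> mod_of QA IA" and s: "short_exact QA M1 M0 M f g"
  obtains f' g' where "short_exact QC (resA M1) (resA M0) (resA M) f' g'"
proof -
  have f: "rep_hom QA M1 M0 f" "\<And>x. x \<in> verts QA \<Longrightarrow> inj_on (f x) (space M1 x)"
    and g: "rep_hom QA M0 M g" "\<And>x. x \<in> verts QA \<Longrightarrow> g x ` space M0 x = space M x"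
    and ex: "\<And>x. x \<in> verts QA \<Longrightarrow> f x ` space M1 x = space (kernel_rep M0 g) x"
    using s unfolding short_exact_def rep_epi_def rep_mono_def by simp_all
  let ?f = "\<lambda>x. if x \<in> verts QA then f x else (\<lambda>m. 0)" and ?g = "\<lambda>x. if x \<in> verts QA then g x else (\<lambda>m. 0)"
  have "rep_mono QC (resA M1) (resA M0) ?f"
    unfolding rep_mono_def using ext_hom[OF mods(1) f(1)] f(2) by simp
  moreover have "rep_epi QC (resA M0) (resA M) ?g"
    unfolding rep_epi_def using ext_hom[OF mods(2) g(1)] g(2) by simp
  moreover have "?f x ` space (resA M1) x = space (kernel_rep (resA M0) ?g) x" for x
    using ex[of x] by auto
  ultimately show thesis using that unfolding short_exact_def by blast
qed

section \<open>The class of error terms, iteration and the witness\<close>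

context gluing
begin

text \<open>The \<open>C\<close>-modules whose classes span the subgroup \<open>\<O>\<close>, up to summands and isomorphism.\<close>

definition orbit_pair :: "('v, 'e, 'k) rep \<Rightarrow> ('v, 'e, 'k) rep \<Rightarrow> bool" where
  "orbit_pair C0 W \<longleftrightarrow> (\<exists>U U'. A.cat.add_closure IA (syzygy_orbit QA IA (resA (syzygy QC IC C0))) U \<and>
     B.cat.add_closure IB (syzygy_orbit QB IB (resB (syzygy QC IC C0))) U' \<and>
     C.additive.decomp IC W (resA U) (resB U'))"

lemma orbit_pair_sum:
  assumes "C.additive.decomp IC W W1 W2" "orbit_pair C0 W1" "orbit_pair C0 W2"
  shows "orbit_pair C0 W"
proof -
  interpret S: gluing QB QA QC IB IA IC \<beta>s \<alpha>s by (rule gluing_swap)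
  let ?OA = "syzygy_orbit QA IA (resA (syzygy QC IC C0))" and ?OB = "syzygy_orbit QB IB (resB (syzygy QC IC C0))"
  obtain U U' where U: "A.cat.add_closure IA ?OA U" "B.cat.add_closure IB ?OB U'" "C.additive.decomp IC W1 (resA U) (resB U')"
    using assms(2) unfolding orbit_pair_def by blast
  obtain V V' where V: "A.cat.add_closure IA ?OA V" "B.cat.add_closure IB ?OB V'" "C.additive.decomp IC W2 (resA V) (resB V')"
    using assms(3) unfolding orbit_pair_def by blast
  have DA: "A.additive.decomp IA (dsum U V) U V"
    using A.decomp_dsum A.cat.add_closure_Ob U(1) V(1) by blast
  have DB: "B.additive.decomp IB (dsum U' V') U' V'"
    using B.decomp_dsum B.cat.add_closure_Ob U(2) V(2) by blast
  have "C.additive.decomp IC W (resA (dsum U V)) (resB (dsum U' V'))"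
    using C.cat.decomp_interchange[OF assms(1) U(3) V(3) ext_decomp[OF DA] S.ext_decomp[OF DB]] .
  then show ?thesis
    unfolding orbit_pair_def using A.cat.add_closure.sum[OF DA U(1) V(1)] B.cat.add_closure.sum[OF DB U(2) V(2)] by blast
qed

text \<open>Allows facts obtained from the exchanged interpretation to be read back on the original
  side.\<close>

lemma orbit_pair_swap:
  "gluing.orbit_pair QB QA QC IB IA IC C0 W \<longleftrightarrow> orbit_pair C0 W"
proof -
  interpret S: gluing QB QA QC IB IA IC \<beta>s \<alpha>s by (rule gluing_swap)
  show ?thesis unfolding S.orbit_pair_def orbit_pair_def using C.additive.decomp_sym by blast
qed

lemma orbit_pair_left:
  assumes U: "A.cat.add_closure IA (syzygy_orbit QA IA (resA (syzygy QC IC C0))) U"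
  shows "orbit_pair C0 (resA U)"
proof -
  interpret S: gluing QB QA QC IB IA IC \<beta>s \<alpha>s by (rule gluing_swap)
  have "C.additive.decomp IC (resA U) (resA U) (resB zero_rep)"
    using C.additive.decomp_null[OF C.additive.isom_refl S.ext_null[OF B.zero_rep_null]]
      ext_mod[OF A.cat.add_closure_Ob[OF U]] by blast
  then show ?thesis unfolding orbit_pair_def using U B.cat.add_closure.zero[OF B.zero_rep_null] by blast
qed

lemma orbit_pair_null: "C.additive.null IC W \<Longrightarrow> orbit_pair C0 W"
proof -
  interpret S: gluing QB QA QC IB IA IC \<beta>s \<alpha>s by (rule gluing_swap)
  assume W: "C.additive.null IC W"
  have "C.additive.decomp IC W (resA zero_rep) (resB zero_rep)"
    using C.additive.decomp_null[OF C.additive.null_isom[OF W ext_null[OF A.zero_rep_null]] S.ext_null[OF B.zero_rep_null]] .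
  then show ?thesis
    unfolding orbit_pair_def using A.cat.add_closure.zero[OF A.zero_rep_null] B.cat.add_closure.zero[OF B.zero_rep_null] by blast
qed

lemma base_orbit: "X0 \<in> syzygy_orbit Q I X0"
  unfolding syzygy_orbit_def by (rule CollectI) (metis funpow_0)

lemma syzygy_ext_orbit:
  assumes Ss: "complete_simples QC IC Ss" and X0: "X0 \<in> mod_of QA IA"
  obtains W where "C.additive.decomp IC (syzygy QC IC (resA X0)) (resA (syzygy QA IA X0)) W"
    "orbit_pair (dsum_list Ss) W"
proof -
  interpret S: gluing QB QA QC IB IA IC \<beta>s \<alpha>s by (rule gluing_swap)
  obtain Z where Z: "C.additive.decomp IC (syzygy QC IC (resA X0)) (resA (syzygy QA IA X0)) (resB Z)"
    "B.cat.add_closure IB {resB (syzygy QC IC (dsum_list Ss))} Z"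
    using syzygy_ext[OF Ss X0] by blast
  have "B.cat.add_closure IB (syzygy_orbit QB IB (resB (syzygy QC IC (dsum_list Ss)))) Z"
    using B.cat.add_closure_mono[OF Z(2)] base_orbit B.additive.retract_isom[OF B.additive.isom_refl] by blast
  then show thesis using that[OF Z(1)] S.orbit_pair_left orbit_pair_swap by blast
qed

text \<open>The \<open>C\<close>-syzygy of the \<open>A\<close>-part is its \<open>A\<close>-syzygy,
  which stays in the closure of the same orbit, plus a \<open>B\<close>-module from the closure of
  the initial term of the other orbit; symmetrically for the \<open>B\<close>-part. Without this
  closure the errors of successive steps could not be gathered.\<close>

lemma orbit_pair_syzygy:
  assumes Ss: "complete_simples QC IC Ss" and W: "orbit_pair (dsum_list Ss) W"
  shows "orbit_pair (dsum_list Ss) (syzygy QC IC W)"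
proof -
  interpret S: gluing QB QA QC IB IA IC \<beta>s \<alpha>s by (rule gluing_swap)
  let ?C0 = "dsum_list Ss"
  obtain U U' where U: "A.cat.add_closure IA (syzygy_orbit QA IA (resA (syzygy QC IC ?C0))) U"
    "B.cat.add_closure IB (syzygy_orbit QB IB (resB (syzygy QC IC ?C0))) U'" "C.additive.decomp IC W (resA U) (resB U')"
    using W unfolding orbit_pair_def by blast
  obtain V where V: "C.additive.decomp IC (syzygy QC IC (resA U)) (resA (syzygy QA IA U)) V" "orbit_pair ?C0 V"
    using syzygy_ext_orbit[OF Ss A.cat.add_closure_Ob[OF U(1)]] by blast
  obtain V' where V': "C.additive.decomp IC (syzygy QC IC (resB U')) (resB (syzygy QB IB U')) V'" "S.orbit_pair ?C0 V'"
    using S.syzygy_ext_orbit[OF Ss B.cat.add_closure_Ob[OF U(2)]] by blast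
  have "orbit_pair ?C0 (syzygy QC IC (resA U))"
    using orbit_pair_sum[OF V(1) orbit_pair_left[OF A.syzygy_add_orbit[OF U(1)]] V(2)] .
  moreover have "orbit_pair ?C0 (syzygy QC IC (resB U'))"
    using S.orbit_pair_sum[OF V'(1) S.orbit_pair_left[OF B.syzygy_add_orbit[OF U(2)]] V'(2)] orbit_pair_swap by blast
  ultimately show ?thesis using orbit_pair_sum[OF C.syzygy_decomp[OF U(3)]] by blast
qed

text \<open>\<open>N0\<close> is the main term, and \<open>W\<close> accumulates everything else: in
  each step the old error is replaced by its syzygy, and the syzygies of the two parts of
  \<open>N0\<close> add new errors.\<close>

lemma iterated_syzygy:
  assumes Ss: "complete_simples QC IC Ss" and X0: "X0 \<in> mod_of QA IA" and Y0: "Y0 \<in> mod_of QB IB"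
    and N: "C.additive.decomp IC N (resA X0) (resB Y0)"
  shows "\<exists>W N0. orbit_pair (dsum_list Ss) W \<and> C.additive.decomp IC ((syzygy QC IC ^^ n) N) N0 W \<and>
    C.additive.decomp IC N0 (resA ((syzygy QA IA ^^ n) X0)) (resB ((syzygy QB IB ^^ n) Y0))"
proof (induction n)
  case 0
  have "C.additive.decomp IC N N zero_rep"
    using C.additive.decomp_null[OF C.additive.isom_refl C.zero_rep_null] C.additive.decomp_Ob[OF N] by blast
  then show ?case using N orbit_pair_null[OF C.zero_rep_null] by (simp del: dsum_list_def) blast
next
  case (Suc n)
  interpret S: gluing QB QA QC IB IA IC \<beta>s \<alpha>s by (rule gluing_swap)
  let ?C0 = "dsum_list Ss"
  let ?N = "(syzygy QC IC ^^ n) N" and ?X = "(syzygy QA IA ^^ n) X0" and ?Y = "(syzygy QB IB ^^ n) Y0"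
  have mods: "?X \<in> mod_of QA IA" "?Y \<in> mod_of QB IB"
    by (induction n) (use X0 Y0 A.syzygy_mod B.syzygy_mod in auto)
  obtain W N0 where W: "orbit_pair ?C0 W" "C.additive.decomp IC ?N N0 W" "C.additive.decomp IC N0 (resA ?X) (resB ?Y)"
    using Suc by blast
  obtain V where V: "C.additive.decomp IC (syzygy QC IC (resA ?X)) (resA (syzygy QA IA ?X)) V" "orbit_pair ?C0 V"
    using syzygy_ext_orbit[OF Ss mods(1)] by blast
  obtain V' where V': "C.additive.decomp IC (syzygy QC IC (resB ?Y)) (resB (syzygy QB IB ?Y)) V'" "S.orbit_pair ?C0 V'"
    using S.syzygy_ext_orbit[OF Ss mods(2)] by blast
  note obs = C.additive.decomp_Ob[OF V(1)] C.additive.decomp_Ob[OF V'(1)]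
  let ?D = "dsum (resA (syzygy QA IA ?X)) (resB (syzygy QB IB ?Y))" and ?V = "dsum V V'"
  have D: "C.additive.decomp IC ?D (resA (syzygy QA IA ?X)) (resB (syzygy QB IB ?Y))" "C.additive.decomp IC ?V V V'"
    using C.decomp_dsum obs by blast+
  \<comment> \<open>The syzygies of the two main parts each give a main part and an error;
    regrouping separates the new main term \<open>?D\<close> from the new errors
    \<open>?V\<close>.\<close>
  have 1: "C.additive.decomp IC (syzygy QC IC N0) ?D ?V"
    using C.cat.decomp_interchange[OF C.syzygy_decomp[OF W(3)] V(1) V'(1) D] .
  have V2: "orbit_pair ?C0 ?V" using orbit_pair_sum[OF D(2) V(2)] V'(2) orbit_pair_swap by blast
  \<comment> \<open>\<open>E\<close> is the total error, namely the syzygy of the old error together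
    with the errors just produced.\<close>
  obtain E where E: "C.additive.decomp IC (syzygy QC IC ?N) E ?D" "C.additive.decomp IC E (syzygy QC IC W) ?V"
    using C.cat.decomp_assoc_ex[OF C.additive.decomp_sym[OF C.syzygy_decomp[OF W(2)]] C.additive.decomp_sym[OF 1]] by blast
  have "orbit_pair ?C0 E" using orbit_pair_sum[OF E(2) orbit_pair_syzygy[OF Ss W(1)] V2] .
  moreover have "C.additive.decomp IC ((syzygy QC IC ^^ Suc n) N) ?D E"
    using C.additive.decomp_sym[OF E(1)] by simp
  ultimately show ?case using D(1) by auto
qed

text \<open>\<open>W\<close> is split into indecomposables: the projective ones are reached through
  the \<open>free_rep u\<close> and \<open>projective_add_free\<close>, the others through
  \<open>F\<close>. Since \<open>F\<close> and \<open>V\<close> do not depend on \<open>W\<close>,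
  one module serves all error terms.\<close>

lemma orbit_pair_add:
  assumes F: "\<And>W M. C.additive.indecomposable IC W \<Longrightarrow> \<not> C.projective W \<Longrightarrow>
      M \<in> pair_class QA QB
        (add_class QA IA (syzygy_orbit QA IA (resA (syzygy QC IC C0))))
        (add_class QB IB (syzygy_orbit QB IB (resB (syzygy QC IC C0)))) \<Longrightarrow>
      direct_summand QC IC W M \<Longrightarrow> \<exists>N\<in>F. C.additive.retract IC W N"
    and C0: "C0 \<in> mod_of QC IC"
    and V: "\<And>N. N \<in> F \<Longrightarrow> C.additive.retract IC N V" "\<And>u. u \<in> verts QC \<Longrightarrow> C.additive.retract IC (C.free_rep u) V"
    and W: "orbit_pair C0 W"
  shows "C.cat.add_closure IC {V} W"
proof -
  interpret S: gluing QB QA QC IB IA IC \<beta>s \<alpha>s by (rule gluing_swap)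
  let ?OA = "syzygy_orbit QA IA (resA (syzygy QC IC C0))" and ?OB = "syzygy_orbit QB IB (resB (syzygy QC IC C0))"
  obtain U U' where U: "A.cat.add_closure IA ?OA U" "B.cat.add_closure IB ?OB U'" "C.additive.decomp IC W (resA U) (resB U')"
    using W unfolding orbit_pair_def by blast
  note UM = ext_mod[OF A.cat.add_closure_Ob[OF U(1)]] S.ext_mod[OF B.cat.add_closure_Ob[OF U(2)]]
  let ?M = "dsum (resA U) (resB U')"
  have O: "?OA \<subseteq> mod_of QA IA" "?OB \<subseteq> mod_of QB IB"
    using A.syzygy_orbit_mod[OF res_mod[OF C.syzygy_mod[OF C0]]] B.syzygy_orbit_mod[OF S.res_mod[OF C.syzygy_mod[OF C0]]] .
  have M: "?M \<in> pair_class QA QB (add_class QA IA ?OA) (add_class QB IB ?OB)"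
    unfolding pair_class_def using U(1,2) A.add_class_iff[OF O(1)] B.add_class_iff[OF O(2)] by blast
  have iso: "C.additive.isom IC W ?M" using C.additive.decomp_unique[OF U(3) C.decomp_dsum[OF UM]] .
  have WM: "W \<in> mod_of QC IC" using C.additive.isom_Ob[OF iso] by blast
  have "C.additive.retract IC L W \<longrightarrow> C.cat.add_closure IC {V} L" if "L \<in> mod_of QC IC" for L
    using that
  proof (induction L rule: C.cat.decomp_induct[where I = IC, consumes 1])
    case (null L)
    then show ?case using C.cat.add_closure.zero by blast
  next
    case (indecomposable L)
    show ?case
    proof
      assume LW: "C.additive.retract IC L W"
      show "C.cat.add_closure IC {V} L"
      proof (cases "C.projective L")
        case True
        show ?thesis
          using C.cat.add_closure_mono[OF C.projective_add_free[OF True]] V(2) by blast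
      next
        case False
        have "C.additive.retract IC L ?M"
          using C.additive.retract_trans[OF LW C.additive.retract_isom[OF iso]] .
        then have "direct_summand QC IC L ?M" using C.direct_summand_iff[OF C.dsum_mod[OF UM]] by blast
        then obtain N where N: "N \<in> F" "C.additive.retract IC L N" using F[OF indecomposable False M] by blast
        then show ?thesis using C.cat.add_closure.base[OF singletonI C.additive.retract_trans[OF N(2) V(1)[OF N(1)]]] by blast
      qed
    qed
  next
    case (decomp L L1 L2)
    then show ?case
      using C.additive.retract_trans[OF C.additive.decomp_retract[OF decomp(1)], of W]
        C.additive.retract_trans[OF C.additive.decomp_retract[OF C.additive.decomp_sym[OF decomp(1)]], of W]
        C.cat.add_closure.sum[OF decomp(1)] by blast
  qed
  then show ?thesis using C.additive.retract_isom[OF C.additive.isom_refl[OF WM]] WM by blast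
qed

lemma Igusa_Todorov_gluing:
  assumes Ss: "complete_simples QC IC Ss"
    and fg: "finitely_generated_subgroup (K0 QC IC)
      (K0_span QC IC (pair_class QA QB
        (add_class QA IA (syzygy_orbit QA IA (resA (syzygy QC IC (dsum_list Ss)))))
        (add_class QB IB (syzygy_orbit QB IB (resB (syzygy QC IC (dsum_list Ss)))))))"
    and ITA: "Igusa_Todorov n QA IA" and ITB: "Igusa_Todorov n QB IB"
  shows "Igusa_Todorov (n + 1) QC IC"
proof -
  interpret S: gluing QB QA QC IB IA IC \<beta>s \<alpha>s by (rule gluing_swap)
  obtain F where F: "finite F" "F \<subseteq> mod_of QC IC"
    "\<And>W M. C.additive.indecomposable IC W \<Longrightarrow> \<not> C.projective W \<Longrightarrow>
      M \<in> pair_class QA QB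
        (add_class QA IA (syzygy_orbit QA IA (resA (syzygy QC IC (dsum_list Ss)))))
        (add_class QB IB (syzygy_orbit QB IB (resB (syzygy QC IC (dsum_list Ss))))) \<Longrightarrow>
      direct_summand QC IC W M \<Longrightarrow> \<exists>N\<in>F. C.additive.retract IC W N"
    using C.K0_finitely_generated[OF fg] by metis
  obtain VA where VA: "VA \<in> mod_of QA IA" "\<And>M. M \<in> mod_of QA IA \<Longrightarrow> \<exists>V1\<in>add_class QA IA {VA}. \<exists>V0\<in>add_class QA IA {VA}.
      \<exists>f g. short_exact QA V1 V0 ((syzygy QA IA ^^ n) M) f g"
    using ITA unfolding Igusa_Todorov_def by blast
  obtain VB where VB: "VB \<in> mod_of QB IB" "\<And>M. M \<in> mod_of QB IB \<Longrightarrow> \<exists>V1\<in>add_class QB IB {VB}. \<exists>V0\<in>add_class QB IB {VB}.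
      \<exists>f g. short_exact QB V1 V0 ((syzygy QB IB ^^ n) M) f g"
    using ITB unfolding Igusa_Todorov_def by blast
  obtain Fs where Fs: "set Fs = F" using F(1) finite_list by blast
  obtain us where us: "set us = verts QC" using C.finite_verts finite_list by blast
  \<comment> \<open>One source for each kind of term: the witnesses of \<open>A\<close> and
    \<open>B\<close> for the main part, \<open>Fs\<close> for non-projective and the
    \<open>free_rep u\<close> for projective summands of the error.\<close>
  define Vs where "Vs = resA VA # resB VB # Fs @ map C.free_rep us"
  define V where "V = dsum_list Vs"
  have Vs: "set Vs \<subseteq> mod_of QC IC"
    unfolding Vs_def using ext_mod[OF VA(1)] S.ext_mod[OF VB(1)] F(2) Fs C.free_rep_mod by auto
  have VM: "V \<in> mod_of QC IC" unfolding V_def using C.dsum_list_mod[OF Vs] .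
  have ret: "C.additive.retract IC N V" if "N \<in> set Vs" for N
    unfolding V_def using C.dsum_list_retract[OF Vs that] .
  have "S \<in> mod_of QC IC" if "S \<in> set Ss" for S
    using Ss that unfolding complete_simples_def simple_rep_def by simp
  then have C0: "dsum_list Ss \<in> mod_of QC IC" by (intro C.dsum_list_mod) blast
  have addW: "C.cat.add_closure IC {V} W" if "orbit_pair (dsum_list Ss) W" for W
  proof (rule orbit_pair_add[OF F(3) C0 _ _ that])
    show "C.additive.retract IC N V" if "N \<in> F" for N using ret that Fs unfolding Vs_def by auto
    show "C.additive.retract IC (C.free_rep u) V" if "u \<in> verts QC" for u using ret that us unfolding Vs_def by auto
  qed
  have addA: "C.cat.add_closure IC {V} (resA M)" if "M \<in> add_class QA IA {VA}" for M
  proof -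
    have "C.cat.add_closure IC (resA ` {VA}) (resA M)"
      using A.add_class_iff[of "{VA}" IA M] that VA(1) by (intro ext_add) simp
    then show ?thesis by (rule C.cat.add_closure_mono) (use ret in \<open>auto simp: Vs_def\<close>)
  qed
  have addB: "C.cat.add_closure IC {V} (resB M)" if "M \<in> add_class QB IB {VB}" for M
  proof -
    have "C.cat.add_closure IC (resB ` {VB}) (resB M)"
      using B.add_class_iff[of "{VB}" IB M] that VB(1) by (intro S.ext_add) simp
    then show ?thesis by (rule C.cat.add_closure_mono) (use ret in \<open>auto simp: Vs_def\<close>)
  qed
  have addI: "M \<in> add_class QC IC {V} \<longleftrightarrow> C.cat.add_closure IC {V} M" for M
    using C.add_class_iff[of "{V}" IC M] VM by simp
  note sumI = C.cat.add_closure.sum[OF C.decomp_dsum]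
  show ?thesis
    unfolding Igusa_Todorov_def
  proof (intro bexI[OF _ VM] ballI)
    fix M assume M: "M \<in> mod_of QC IC"
    let ?N = "syzygy QC IC M"
    have N: "?N \<in> mod_of QC IC" using C.syzygy_mod[OF M] .
    let ?X = "(syzygy QA IA ^^ n) (resA ?N)" and ?Y = "(syzygy QB IB ^^ n) (resB ?N)"
    note X0 = res_mod[OF N] and Y0 = S.res_mod[OF N]
    \<comment> \<open>One syzygy is spent on splitting \<open>?N\<close> into an
      \<open>A\<close>-part and a \<open>B\<close>-part; the other \<open>n\<close> act on these
      parts, matching the Igusa-Todorov index of \<open>A\<close> and \<open>B\<close>.\<close>
    obtain W N0 where W: "orbit_pair (dsum_list Ss) W" "C.additive.decomp IC ((syzygy QC IC ^^ n) ?N) N0 W"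
      "C.additive.decomp IC N0 (resA ?X) (resB ?Y)"
      using iterated_syzygy[OF Ss X0 Y0, of ?N n] syzygy_split[OF M] by auto
    have XY: "?X \<in> mod_of QA IA" "?Y \<in> mod_of QB IB"
      by (induction n) (use X0 Y0 A.syzygy_mod B.syzygy_mod in auto)
    obtain A1 A0 fA gA where SA: "A1 \<in> add_class QA IA {VA}" "A0 \<in> add_class QA IA {VA}" "short_exact QA A1 A0 ?X fA gA"
      using VA(2)[OF X0] by blast
    obtain B1 B0 fB gB where SB: "B1 \<in> add_class QB IB {VB}" "B0 \<in> add_class QB IB {VB}" "short_exact QB B1 B0 ?Y fB gB"
      using VB(2)[OF Y0] by blast
    have am: "A1 \<in> mod_of QA IA" "A0 \<in> mod_of QA IA" "B1 \<in> mod_of QB IB" "B0 \<in> mod_of QB IB"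
      using SA(1,2) SB(1,2) unfolding add_class_def by blast+
    note em = ext_mod[OF am(1)] ext_mod[OF am(2)] ext_mod[OF XY(1)] S.ext_mod[OF am(3)] S.ext_mod[OF am(4)] S.ext_mod[OF XY(2)]
    have WM: "W \<in> mod_of QC IC" using C.additive.decomp_Ob[OF W(2)] by blast
    obtain f1 g1 where s1: "short_exact QC (resA A1) (resA A0) (resA ?X) f1 g1"
      using short_exact_ext[OF am(1,2) SA(3)] by blast
    obtain f2 g2 where s2: "short_exact QC (resB B1) (resB B0) (resB ?Y) f2 g2"
      using S.short_exact_ext[OF am(3,4) SB(3)] by blast
    \<comment> \<open>The resolutions of the two main parts are added to the trivial one of
      \<open>W\<close>, so \<open>W\<close> appears in \<open>?V0\<close> and the zero module in
      \<open>?V1\<close>.\<close>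
    let ?V1 = "dsum (dsum (resA A1) (resB B1)) zero_rep" and ?V0 = "dsum (dsum (resA A0) (resB B0)) W"
    let ?E = "dsum (resA ?X) (resB ?Y)"
    note dm = C.dsum_mod[OF em(1,4)] C.dsum_mod[OF em(2,5)] C.dsum_mod[OF em(3,6)]
    obtain f3 g3 where s3: "short_exact QC ?V1 ?V0 (dsum ?E W) f3 g3"
      using C.short_exact_dsum[OF dm C.zero_rep_mod WM WM C.short_exact_dsum[OF em s1 s2] C.short_exact_zero_left[OF WM]]
      by blast
    have "C.additive.isom IC ?E N0"
      using C.additive.decomp_unique[OF C.decomp_dsum[OF em(3,6)] W(3)] .
    then have "C.additive.isom IC (dsum ?E W) ((syzygy QC IC ^^ n) ?N)"
      using C.additive.decomp_unique[OF C.additive.decomp_cong[OF C.decomp_dsum[OF dm(3) WM] _ C.additive.isom_refl[OF WM]] W(2)]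
      by blast
    then obtain h where "short_exact QC ?V1 ?V0 ((syzygy QC IC ^^ n) ?N) f3 h"
      using C.short_exact_isom[OF s3] by blast
    then have "short_exact QC ?V1 ?V0 ((syzygy QC IC ^^ (n + 1)) M) f3 h" by (simp add: funpow_swap1)
    moreover have "?V1 \<in> add_class QC IC {V}"
      unfolding addI
      using sumI[OF dm(1) C.zero_rep_mod sumI[OF em(1,4) addA[OF SA(1)] addB[OF SB(1)]] C.cat.add_closure.zero[OF C.zero_rep_null]] .
    moreover have "?V0 \<in> add_class QC IC {V}"
      unfolding addI using sumI[OF dm(2) WM sumI[OF em(2,5) addA[OF SA(2)] addB[OF SB(2)]] addW[OF W(1)]] .
    ultimately show "\<exists>V1\<in>add_class QC IC {V}. \<exists>V0\<in>add_class QC IC {V}.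
      \<exists>f g. short_exact QC V1 V0 ((syzygy QC IC ^^ (n + 1)) M) f g" by blast
  qed
qed

end

theorem proposition3p2:
  fixes n :: nat
    and QA QB QC :: "('v, 'e) pre_digraph"
    and IA IB IC :: "(('v, 'e) path \<Rightarrow> 'k::field) set"
    and \<alpha>s \<beta>s :: "'e set"
    and Ss :: "('v, 'e, 'k) rep list"
  assumes "bound_quiver QA IA" and "bound_quiver QB IB" and "bound_quiver QC IC"
    and "Morita_context_ideal QA IA QB IB IC"
    and "glued_quiver QA QB \<alpha>s \<beta>s QC"
    and "genideal (path_algebra QC) (gluing_relations QA IA QB IB \<alpha>s \<beta>s QC) \<subseteq> IC"
    and "complete_simples QC IC Ss"
    and "finitely_generated_subgroup (K0 QC IC)
      (K0_span QC IC (pair_class QA QB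
        (add_class QA IA
          (syzygy_orbit QA IA (restrict_rep QA (syzygy QC IC (dsum_list Ss)))))
        (add_class QB IB
          (syzygy_orbit QB IB (restrict_rep QB (syzygy QC IC (dsum_list Ss)))))))"
    and "Igusa_Todorov n QA IA" and "Igusa_Todorov n QB IB"
  shows "Igusa_Todorov (n + 1) QC IC"
proof -
  have bqa: "bound_quiver_algebra Q I" if "bound_quiver Q I"
    for Q :: "('v, 'e) pre_digraph" and I :: "(('v, 'e) path \<Rightarrow> 'k) set"
    using that unfolding bound_quiver_def bound_quiver_algebra_def bound_quiver_algebra_axioms_def by blast
  interpret gluing QA QB QC IA IB IC \<alpha>s \<beta>s
    using assms(1-6) bqa by (intro gluing.intro gluing_axioms.intro)
  show ?thesis using Igusa_Todorov_gluing assms(7-10) by blast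
qed

end
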